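(* Let $S=\{c_1,\dots,c_n\}$ with $0\le c_1<\dots<c_n=\bar c$ and $\tilde S=S\setminus\{c_n\}$. There exists a threshold function $z^*:\tilde S\to[0,\infty)$ that is optimal among threshold functions, i.e. $W^{z^*}(x,c_i)\ge W^z(x,c_i)$ for every threshold function $z:\tilde S\to[0,\infty)$, every $x\ge0$ and every $i$; and for any such optimal $z^*$, $W^{z^*}(x,c_i)=V^S(x,c_i)$ for all $x\ge0$ and $i=1,\dots,n$. In particular, the threshold strategy associated with $z^*$ is an optimal ratcheting strategy.
   Context: Fix constants $\mu>0$, $\sigma>0$, $q>0$. Let $W$ be a standard Brownian motion and $X_t=x+\mu t+\sigma W_t$, with $(\mathcal F_t)_{t\ge0}$ the completed filtration generated by $X$. For $S\subset[0,\infty)$ with $\bar c=\max S<\infty$, $x\ge0$, $c\in S$, $\Pi^S_{x,c}$ is the set of non-decreasing, right-continuous, adapted processes $C$ with $C_t\in S$, $C_t\ge c$ for all $t$; $X^C_t=X_t-\int_0^tC_sds$, $\tau=\inf\{t\ge0:X^C_t<0\}$, $J(x;C)=\mathbb E[\int_0^\tau e^{-qs}C_sds]$, $V^S(x,c)=\sup_{C\in\Pi^S_{x,c}}J(x;C)$. Threshold strategy: given $z:\tilde S\to[0,\infty)$, define strategies $C_{x,c_i}\in\Pi^S_{x,c_i}$ by backward recursion: for $i=n$, $C_{x,c_n}\equiv c_n$ until ruin; for $i<n$ and $x\ge z(c_i)$, $C_{x,c_i}=C_{x,c_{i+1}}$; for $i<n$ and $x<z(c_i)$, pay at rate $c_i$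 until the first time $\hat\tau$ the controlled surplus reaches $z(c_i)$ (or ruin, whichever is first), and from $\hat\tau$ on follow $C_{z(c_i),c_{i+1}}$ (restarted at $\hat\tau$). The value function is $W^z(x,c_i):=J(x;C_{x,c_i})$. *)

theory Defs
  imports "HOL-Probability.Probability"
begin

definition std_brownian_motion :: "'a measure \<Rightarrow> (real \<Rightarrow> 'a \<Rightarrow> real) \<Rightarrow> bool" where
  "std_brownian_motion M W \<longleftrightarrow>
     prob_space M \<and>
     (\<forall>t. W t \<in> borel_measurable M) \<and>
     (\<forall>\<omega>\<in>space M. W 0 \<omega> = 0 \<and> continuous_on {0..} (\<lambda>t. W t \<omega>)) \<and>
     (\<forall>s t. 0 \<le> s \<longrightarrow> s < t \<longrightarrow>
        distributed M lborel (\<lambda>\<omega>. W t \<omega> - W s \<omega>)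
          (\<lambda>y. ennreal (normal_density 0 (sqrt (t - s)) y))) \<and>
     (\<forall>(ts :: nat \<Rightarrow> real) n. 0 \<le> ts 0 \<longrightarrow> (\<forall>i<n. ts i < ts (Suc i)) \<longrightarrow>
        prob_space.indep_vars M (\<lambda>_. borel) (\<lambda>i \<omega>. W (ts (Suc i)) \<omega> - W (ts i) \<omega>) {..<n})"

definition surplus :: "real \<Rightarrow> real \<Rightarrow> (real \<Rightarrow> 'a \<Rightarrow> real) \<Rightarrow> real \<Rightarrow> real \<Rightarrow> 'a \<Rightarrow> real" where
  "surplus \<mu> \<sigma> W x t \<omega> = x + \<mu> * t + \<sigma> * W t \<omega>"

definition gen_sigma :: "'a measure \<Rightarrow> real \<Rightarrow> real \<Rightarrow> (real \<Rightarrow> 'a \<Rightarrow> real) \<Rightarrow> real \<Rightarrow> real \<Rightarrow> 'a set set" where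
  "gen_sigma M \<mu> \<sigma> W x t = sigma_sets (space M)
     {(surplus \<mu> \<sigma> W x s) -` B \<inter> space M | s B. 0 \<le> s \<and> s \<le> t \<and> B \<in> sets borel}"

definition filt :: "'a measure \<Rightarrow> real \<Rightarrow> real \<Rightarrow> (real \<Rightarrow> 'a \<Rightarrow> real) \<Rightarrow> real \<Rightarrow> real \<Rightarrow> 'a set set" where
  "filt M \<mu> \<sigma> W x t = {A. A \<subseteq> space M \<and>
     (\<exists>B\<in>gen_sigma M \<mu> \<sigma> W x t. \<exists>N\<in>null_sets M. (A - B) \<union> (B - A) \<subseteq> N)}"

definition admissible :: "'a measure \<Rightarrow> real \<Rightarrow> real \<Rightarrow> (real \<Rightarrow> 'a \<Rightarrow> real) \<Rightarrow>
    real set \<Rightarrow> real \<Rightarrow> real \<Rightarrow> (real \<Rightarrow> 'a \<Rightarrow> real) set" where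
  "admissible M \<mu> \<sigma> W S x c = {C.
     (\<forall>t\<ge>0. \<forall>B\<in>sets borel. (C t) -` B \<inter> space M \<in> filt M \<mu> \<sigma> W x t) \<and>
     (\<forall>\<omega>\<in>space M.
        (\<forall>t\<ge>0. C t \<omega> \<in> S \<and> c \<le> C t \<omega>) \<and>
        mono_on {0..} (\<lambda>t. C t \<omega>) \<and>
        (\<forall>t\<ge>0. continuous (at_right t) (\<lambda>s. C s \<omega>)))}"

definition ctrl_surplus :: "real \<Rightarrow> real \<Rightarrow> (real \<Rightarrow> 'a \<Rightarrow> real) \<Rightarrow> real \<Rightarrow>
    (real \<Rightarrow> 'a \<Rightarrow> real) \<Rightarrow> real \<Rightarrow> 'a \<Rightarrow> real" where
  "ctrl_surplus \<mu> \<sigma> W x C t \<omega> = surplus \<mu> \<sigma> W x t \<omega> - integral {0..t} (\<lambda>s. C s \<omega>)"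

text \<open>ruin time tau = inf {t >= 0. X^C_t < 0} (= infinity if the set is empty)\<close>
definition ruin_time :: "real \<Rightarrow> real \<Rightarrow> (real \<Rightarrow> 'a \<Rightarrow> real) \<Rightarrow> real \<Rightarrow>
    (real \<Rightarrow> 'a \<Rightarrow> real) \<Rightarrow> 'a \<Rightarrow> ereal" where
  "ruin_time \<mu> \<sigma> W x C \<omega> = Inf (ereal ` {t. 0 \<le> t \<and> ctrl_surplus \<mu> \<sigma> W x C t \<omega> < 0})"

definition Jval :: "'a measure \<Rightarrow> real \<Rightarrow> real \<Rightarrow> real \<Rightarrow> (real \<Rightarrow> 'a \<Rightarrow> real) \<Rightarrow> real \<Rightarrow>
    (real \<Rightarrow> 'a \<Rightarrow> real) \<Rightarrow> ennreal" where
  "Jval M \<mu> \<sigma> q W x C = (\<integral>\<^sup>+ \<omega>. (\<integral>\<^sup>+ s. ennreal (exp (- q * s) * C s \<omega>) *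
       indicator {s. 0 \<le> s \<and> ereal s < ruin_time \<mu> \<sigma> W x C \<omega>} s \<partial>lborel) \<partial>M)"

definition Vval :: "'a measure \<Rightarrow> real \<Rightarrow> real \<Rightarrow> real \<Rightarrow> (real \<Rightarrow> 'a \<Rightarrow> real) \<Rightarrow>
    real set \<Rightarrow> real \<Rightarrow> real \<Rightarrow> ennreal" where
  "Vval M \<mu> \<sigma> q W S x c = (SUP C\<in>admissible M \<mu> \<sigma> W S x c. Jval M \<mu> \<sigma> q W x C)"

text \<open>Pathwise description. The list argument is the remaining levels c_i, ..., c_n,
  z is the threshold function, x the current starting surplus, w the driving path
  w(s) = X_s - X_0 = mu s + sigma W_s (restarted paths are shifted increments).
  Returns the payment rate at time t.\<close>
primrec thr :: "real list \<Rightarrow> (real \<Rightarrow> real) \<Rightarrow> real \<Rightarrow> (real \<Rightarrow> real) \<Rightarrow> real \<Rightarrow> real" where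
  "thr [] z x w t = 0"
| "thr (c # cs) z x w t =
     (if cs = [] then c
      else if z c \<le> x then thr cs z x w t
      else if (\<exists>s\<ge>0. z c \<le> x + w s - c * s) then
        (let h = Inf {s. 0 \<le> s \<and> z c \<le> x + w s - c * s} in
          if t < h then c else thr cs z (z c) (\<lambda>s. w (h + s) - w h) (t - h))
      else c)"

text \<open>The threshold strategy C_{x,c_i} (levels given as the strictly increasing list cs,
  0-based index i).\<close>
definition thr_strategy :: "real \<Rightarrow> real \<Rightarrow> (real \<Rightarrow> 'a \<Rightarrow> real) \<Rightarrow> real list \<Rightarrow>
    (real \<Rightarrow> real) \<Rightarrow> real \<Rightarrow> nat \<Rightarrow> real \<Rightarrow> 'a \<Rightarrow> real" where
  "thr_strategy \<mu> \<sigma> W cs z x i t \<omega> = thr (drop i cs) z x (\<lambda>s. \<mu> * s + \<sigma> * W s \<omega>) t"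

definition Wz :: "'a measure \<Rightarrow> real \<Rightarrow> real \<Rightarrow> real \<Rightarrow> (real \<Rightarrow> 'a \<Rightarrow> real) \<Rightarrow> real list \<Rightarrow>
    (real \<Rightarrow> real) \<Rightarrow> real \<Rightarrow> nat \<Rightarrow> ennreal" where
  "Wz M \<mu> \<sigma> q W cs z x i = Jval M \<mu> \<sigma> q W x (thr_strategy \<mu> \<sigma> W cs z x i)"

definition threshold_fun :: "real list \<Rightarrow> (real \<Rightarrow> real) \<Rightarrow> bool" where
  "threshold_fun cs z \<longleftrightarrow> (\<forall>c\<in>set (butlast cs). 0 \<le> z c)"

definition optimal_threshold :: "'a measure \<Rightarrow> real \<Rightarrow> real \<Rightarrow> real \<Rightarrow> (real \<Rightarrow> 'a \<Rightarrow> real) \<Rightarrow>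
    real list \<Rightarrow> (real \<Rightarrow> real) \<Rightarrow> bool" where
  "optimal_threshold M \<mu> \<sigma> q W cs zs \<longleftrightarrow> threshold_fun cs zs \<and>
     (\<forall>z. threshold_fun cs z \<longrightarrow> (\<forall>x\<ge>0. \<forall>i<length cs.
        Wz M \<mu> \<sigma> q W cs z x i \<le> Wz M \<mu> \<sigma> q W cs zs x i))"

end

theory Submission
  imports Defs
begin

text \<open>
  Write \<open>L\<^sup>c f = \<sigma>\<^sup>2/2 f'' + (\<mu> - c) f' - q f + c\<close>. Going down from the top level, the value
  \<open>v\<close> at level \<open>c\<close> is obtained from the value \<open>G\<close> at the next level by following the largest
  solution of \<open>L\<^sup>c f = 0\<close>, \<open>f 0 = 0\<close> that touches \<open>G\<close> up to the last touching point \<open>z\<close>, and \<open>G\<close>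
  beyond it. Throughout, \<open>G' - 1\<close> changes sign at most once, from positive to negative: where \<open>G\<close>
  solves \<open>L\<^sup>k G = 0\<close> one has \<open>L\<^sup>c G = (k - c) (G' - 1)\<close>, so the last touching point lies in
  the region \<open>G' \<le> 1\<close> and \<open>L\<^sup>c v \<le> 0\<close> everywhere; and \<open>f'\<close> is convex with \<open>f' z \<le> 1\<close>, which
  propagates the sign condition.

  The verification replaces stochastic calculus by Dynkin's formula for a single Gaussian step. A
  control is frozen at grid points, the discounted value is telescoped over the grid until the
  frozen surplus is negative at a grid point, and the mesh tends to zero. Every error term tends to
  zero for each path and almost every time, so dominated convergence suffices, even though the second
  derivative of the value jumps at the thresholds. For an arbitrary control this bounds the payoff
  by \<open>v\<close>; for the threshold strategy at the points \<open>z\<close> all inequalities become equalities.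
\<close>

text \<open>Ratcheting makes the discretisation one-sided. Before ruin it is therefore nonnegative,
  which is where L^c v <= 0 is known, and it tends to the true surplus from above. For the threshold
  strategy the equation is thus needed only on a right neighbourhood of the current surplus; this is
  available because a surplus still waiting below the top level is strictly below its threshold. For
  an arbitrary control the switching terms have the right sign, because the values decrease in the
  level. Optimality among threshold functions comes last, from a sandwich: every W^z is at most V by
  admissibility, and V <= v <= W^z for the z that is constructed. \<open>regular\<close> leaves
  \<open>f2\<close> free on a finite set; at a threshold the formula valid to its right is
  used.\<close>

definition regular :: "(real \<Rightarrow> real) \<Rightarrow> (real \<Rightarrow> real) \<Rightarrow> (real \<Rightarrow> real) \<Rightarrow> bool" where
  "regular f f1 f2 \<longleftrightarrow>
     (\<forall>x. (f has_real_derivative f1 x) (at x)) \<and> continuous_on UNIV f1 \<and>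
     (\<exists>F. finite F \<and> (\<forall>x. x \<notin> F \<longrightarrow> (f1 has_real_derivative f2 x) (at x))) \<and>
     f2 \<in> borel_measurable borel \<and>
     (\<exists>B. \<forall>x. \<bar>f x\<bar> \<le> B \<and> \<bar>f1 x\<bar> \<le> B \<and> \<bar>f2 x\<bar> \<le> B)"

subsection \<open>The obstacle problem\<close>

text \<open>The fundamental theorem of calculus tolerates finitely many exceptional points, so
  monotonicity survives the jumps of the second derivative at thresholds of higher levels.\<close>

lemma deriv_nonpos_off_finite_imp_le:
  fixes h h' :: "real \<Rightarrow> real"
  assumes "finite F" "a \<le> b" "continuous_on {a..b} h"
    and "\<And>x. x \<in> {a<..<b} - F \<Longrightarrow> (h has_real_derivative h' x) (at x)"
    and "\<And>x. x \<in> {a<..<b} \<Longrightarrow> h' x \<le> 0"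
  shows "h b \<le> h a"
proof -
  have "(h' has_integral (h b - h a)) {a..b}"
    by (rule fundamental_theorem_of_calculus_interior_strong[OF assms(1,2) _ assms(3)])
       (use assms(4) in \<open>simp add: has_real_derivative_iff_has_vector_derivative\<close>)
  then have "(h' has_integral (h b - h a)) {a<..<b}"
    by (simp add: has_integral_Icc_iff_Ioo)
  from has_integral_le[OF this has_integral_0] assms(5) show ?thesis
    by simp
qed

text \<open>Smooth fit: both one-sided difference quotients at \<open>z\<close> have the limit
  \<open>d\<close>, because the pieces agree there in value and slope.\<close>

lemma has_real_derivative_If_le:
  fixes f g :: "real \<Rightarrow> real"
  assumes "(f has_real_derivative d) (at z)" "(g has_real_derivative d) (at z)" "f z = g z"
  shows "((\<lambda>x. if x \<le> z then f x else g x) has_real_derivative d) (at z)"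
  unfolding has_field_derivative_iff
proof (rule filterlim_split_at)
  let ?h = "\<lambda>x. if x \<le> z then f x else g x"
  have "((\<lambda>y. (f y - f z) / (y - z)) \<longlongrightarrow> d) (at_left z)"
    using assms(1) unfolding has_field_derivative_iff by (rule filterlim_mono) (auto intro: at_le)
  moreover have "\<forall>\<^sub>F y in at_left z. (f y - f z) / (y - z) = (?h y - ?h z) / (y - z)"
    by (auto simp: eventually_at_left_field intro!: exI[of _ "z - 1"])
  ultimately show "((\<lambda>y. (?h y - ?h z) / (y - z)) \<longlongrightarrow> d) (at_left z)"
    by (rule Lim_transform_eventually)
  have "((\<lambda>y. (g y - g z) / (y - z)) \<longlongrightarrow> d) (at_right z)"
    using assms(2) unfolding has_field_derivative_iff by (rule filterlim_mono) (auto intro: at_le)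
  moreover have "\<forall>\<^sub>F y in at_right z. (g y - g z) / (y - z) = (?h y - ?h z) / (y - z)"
    using assms(3) by (auto simp: eventually_at_right_field intro!: exI[of _ "z + 1"])
  ultimately show "((\<lambda>y. (?h y - ?h z) / (y - z)) \<longlongrightarrow> d) (at_right z)"
    by (rule Lim_transform_eventually)
qed

lemma has_real_derivative_If_left:
  fixes f g :: "real \<Rightarrow> real"
  assumes "(f has_real_derivative d) (at x)" "x < z"
  shows "((\<lambda>x. if x \<le> z then f x else g x) has_real_derivative d) (at x)"
  by (rule has_field_derivative_transform_within_open[OF assms(1), of "{..<z}"]) (use assms in auto)

lemma has_real_derivative_If_right:
  fixes f g :: "real \<Rightarrow> real"
  assumes "(g has_real_derivative d) (at x)" "z < x"
  shows "((\<lambda>x. if x \<le> z then f x else g x) has_real_derivative d) (at x)"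
  by (rule has_field_derivative_transform_within_open[OF assms(1), of "{z<..}"]) (use assms in auto)

section \<open>Solutions of the linear equation at one level\<close>

locale dividend_model =
  fixes \<mu> \<sigma> q :: real
  assumes sigma_pos: "\<sigma> > 0" and q_pos: "q > 0"
begin

text \<open>\<open>root1\<close> and \<open>root2\<close> are the positive and the negative root of
  the characteristic polynomial \<sigma>^2/2 r^2 + (\<mu> - c) r - q.\<close>

definition root1 :: "real \<Rightarrow> real" where
  "root1 c = ((c - \<mu>) + sqrt ((\<mu> - c)\<^sup>2 + 2 * q * \<sigma>\<^sup>2)) / \<sigma>\<^sup>2"

definition root2 :: "real \<Rightarrow> real" where
  "root2 c = ((c - \<mu>) - sqrt ((\<mu> - c)\<^sup>2 + 2 * q * \<sigma>\<^sup>2)) / \<sigma>\<^sup>2"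

definition gen :: "real \<Rightarrow> real \<Rightarrow> real \<Rightarrow> real \<Rightarrow> real" where
  "gen c f0 f1 f2 = \<sigma>\<^sup>2 / 2 * f2 + (\<mu> - c) * f1 - q * f0 + c"

lemma q_nonzero [simp]: "q \<noteq> 0"
  using q_pos by simp

lemma abs_less_sqrt_disc: "\<bar>\<mu> - c\<bar> < sqrt ((\<mu> - c)\<^sup>2 + 2 * q * \<sigma>\<^sup>2)"
  using sigma_pos q_pos by (intro real_less_rsqrt) (simp add: power2_abs)

lemma root1_pos: "root1 c > 0"
  using abs_less_sqrt_disc[of c] sigma_pos unfolding root1_def by (intro divide_pos_pos) auto

lemma root2_neg: "root2 c < 0"
  using abs_less_sqrt_disc[of c] sigma_pos unfolding root2_def by (intro divide_neg_pos) auto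

text \<open>Vieta's relation for the sum; with \<open>root_prod\<close> it lets the second-order
  operator be split into two first-order factors in \<open>gen_factor\<close>.\<close>

lemma root_sum: "\<sigma>\<^sup>2 * (root1 c + root2 c) = 2 * (c - \<mu>)"
  using sigma_pos by (simp add: root1_def root2_def field_simps)

lemma root_prod: "\<sigma>\<^sup>2 * (root1 c * root2 c) = - 2 * q"
proof -
  let ?s = "sqrt ((\<mu> - c)\<^sup>2 + 2 * q * \<sigma>\<^sup>2)"
  have "?s\<^sup>2 = (\<mu> - c)\<^sup>2 + 2 * q * \<sigma>\<^sup>2" using sigma_pos q_pos by simp
  moreover have "root1 c * root2 c = ((c - \<mu>)\<^sup>2 - ?s\<^sup>2) / (\<sigma>\<^sup>2)\<^sup>2"
    unfolding root1_def root2_def by (simp add: power2_eq_square algebra_simps add_divide_distrib diff_divide_distrib)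
  ultimately have "root1 c * root2 c = (- 2 * q * \<sigma>\<^sup>2) / (\<sigma>\<^sup>2)\<^sup>2"
    by (simp add: power2_commute)
  then show ?thesis using sigma_pos by (simp add: power2_eq_square field_simps)
qed

lemma root_eq:
  assumes "r = root1 c \<or> r = root2 c"
  shows "\<sigma>\<^sup>2 / 2 * r\<^sup>2 + (\<mu> - c) * r - q = 0"
proof -
  have "\<sigma>\<^sup>2 * ((r - root1 c) * (r - root2 c)) = 0" using assms by auto
  moreover have "\<sigma>\<^sup>2 * ((r - root1 c) * (r - root2 c)) =
      \<sigma>\<^sup>2 * r\<^sup>2 - \<sigma>\<^sup>2 * (root1 c + root2 c) * r + \<sigma>\<^sup>2 * (root1 c * root2 c)"
    by (simp add: power2_eq_square algebra_simps)
  ultimately have "\<sigma>\<^sup>2 * r\<^sup>2 - \<sigma>\<^sup>2 * (root1 c + root2 c) * r + \<sigma>\<^sup>2 * (root1 c * root2 c) = 0"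
    by simp
  then show ?thesis unfolding root_sum root_prod by (simp add: algebra_simps)
qed

text \<open>The one-parameter family of all solutions vanishing at 0. The case \<open>A = 0\<close>
  is the bounded one, the value of paying \<open>c\<close> until ruin; \<open>A\<close> multiplies
  the homogeneous solution that vanishes at 0.\<close>

definition ext :: "real \<Rightarrow> real \<Rightarrow> real \<Rightarrow> real" where
  "ext c A x = c / q * (1 - exp (root2 c * x)) + A * (exp (root1 c * x) - exp (root2 c * x))"

definition ext1 :: "real \<Rightarrow> real \<Rightarrow> real \<Rightarrow> real" where
  "ext1 c A x = A * root1 c * exp (root1 c * x) + - (c / q + A) * root2 c * exp (root2 c * x)"

definition ext2 :: "real \<Rightarrow> real \<Rightarrow> real \<Rightarrow> real" where
  "ext2 c A x = A * (root1 c)\<^sup>2 * exp (root1 c * x) + - (c / q + A) * (root2 c)\<^sup>2 * exp (root2 c * x)"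

lemma ext_deriv: "(ext c A has_real_derivative ext1 c A x) (at x)"
  unfolding ext_def[abs_def] ext1_def by (auto intro!: derivative_eq_intros simp: algebra_simps)

lemma ext1_deriv: "(ext1 c A has_real_derivative ext2 c A x) (at x)"
  unfolding ext1_def[abs_def] ext2_def
  by (auto intro!: derivative_eq_intros simp: algebra_simps power2_eq_square)

lemma ext_0 [simp]: "ext c A 0 = 0" by (simp add: ext_def)

lemma gen_ext: "gen c (ext c A x) (ext1 c A x) (ext2 c A x) = 0"
proof -
  have 1: "\<sigma>\<^sup>2 / 2 * (root1 c)\<^sup>2 = q - (\<mu> - c) * root1 c" using root_eq[of "root1 c" c] by simp
  have 2: "\<sigma>\<^sup>2 / 2 * (root2 c)\<^sup>2 = q - (\<mu> - c) * root2 c" using root_eq[of "root2 c" c] by simp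
  let ?e1 = "exp (root1 c * x)" and ?e2 = "exp (root2 c * x)" and ?d = "c / q"
  have "\<sigma>\<^sup>2 / 2 * ext2 c A x = A * (\<sigma>\<^sup>2 / 2 * (root1 c)\<^sup>2) * ?e1 - (?d + A) * (\<sigma>\<^sup>2 / 2 * (root2 c)\<^sup>2) * ?e2"
    unfolding ext2_def by (simp add: algebra_simps)
  also have "\<dots> = A * (q - (\<mu> - c) * root1 c) * ?e1 - (?d + A) * (q - (\<mu> - c) * root2 c) * ?e2"
    unfolding 1 2 ..
  also have "\<dots> = q * ext c A x - (\<mu> - c) * ext1 c A x - q * ?d"
  proof -
    define d where "d = c / q"
    show ?thesis unfolding ext_def ext1_def d_def[symmetric] by (simp add: algebra_simps)
  qed
  finally have e: "\<sigma>\<^sup>2 / 2 * ext2 c A x = q * ext c A x - (\<mu> - c) * ext1 c A x - q * ?d" .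
  show ?thesis unfolding gen_def e by simp
qed

lemma ext_continuous [continuous_intros]: "continuous_on S (ext c A)" "continuous_on S (ext1 c A)" "continuous_on S (ext2 c A)"
  unfolding ext_def[abs_def] ext1_def[abs_def] ext2_def[abs_def] by (auto intro!: continuous_intros)

text \<open>Both exponentials enter with a nonnegative coefficient, the second because
  \<open>root2 c\<close> is negative.\<close>

lemma ext1_convex:
  assumes "0 \<le> A" "0 \<le> c"
  shows "convex_on UNIV (ext1 c A)"
proof -
  have e: "convex_on UNIV (\<lambda>x. exp (r * x))" for r :: real
    by (rule f''_ge0_imp_convex[where f' = "\<lambda>x. r * exp (r * x)" and f'' = "\<lambda>x. r * r * exp (r * x)"])
       (auto intro!: derivative_eq_intros)
  have "0 \<le> A * root1 c" "0 \<le> c / q + A"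
    using assms root1_pos[of c] q_pos by auto
  moreover from this(2) have "0 \<le> - (c / q + A) * root2 c"
    using root2_neg[of c] by (intro mult_nonpos_nonpos) auto
  ultimately have "0 \<le> A * root1 c" "0 \<le> - (c / q + A) * root2 c" by auto
  then show ?thesis
    unfolding ext1_def[abs_def] by (intro convex_on_add convex_on_cmul e)
qed

text \<open>The invariant of the backward recursion. \<open>L\<close> is the top level and stays
  fixed: the limit \<open>L / q\<close> guarantees that a lower level \<open>c < L\<close> yields a
  positive homogeneous coefficient. \<open>b\<close> is the point where the slope passes 1, and
  \<open>k\<close> is the level whose equation holds at \<open>x\<close>. Bounds are asked only on
  the half-line, since the exponential with the negative root explodes to the left.\<close>

definition value_profile :: "real \<Rightarrow> real \<Rightarrow> (real \<Rightarrow> real) \<Rightarrow> (real \<Rightarrow> real) \<Rightarrow> (real \<Rightarrow> real) \<Rightarrow> bool" where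
  "value_profile L c G G1 G2 \<longleftrightarrow>
     G 0 = 0 \<and> (\<forall>x. (G has_real_derivative G1 x) (at x)) \<and> continuous_on UNIV G1 \<and>
     (\<exists>F. finite F \<and> (\<forall>x. x \<notin> F \<longrightarrow> (G1 has_real_derivative G2 x) (at x))) \<and>
     G2 \<in> borel_measurable borel \<and>
     (\<exists>B. \<forall>x\<ge>0. \<bar>G x\<bar> \<le> B \<and> \<bar>G1 x\<bar> \<le> B \<and> \<bar>G2 x\<bar> \<le> B) \<and>
     (\<exists>b\<ge>0. (\<forall>x. 0 \<le> x \<and> x < b \<longrightarrow> 1 \<le> G1 x) \<and> (\<forall>x\<ge>b. G1 x \<le> 1)) \<and>
     (\<forall>x\<ge>0. \<exists>k\<ge>c. gen k (G x) (G1 x) (G2 x) = 0) \<and>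
     (G \<longlongrightarrow> L / q) at_top"

lemma exp_root2_le_1: "0 \<le> x \<Longrightarrow> exp (root2 c * x) \<le> 1"
  using root2_neg[of c] by (simp add: mult_nonpos_nonneg)

lemma exp_root2_tendsto: "((\<lambda>x. exp (root2 c * x)) \<longlongrightarrow> 0) at_top"
  by (rule filterlim_compose[OF exp_at_bot])
     (rule filterlim_tendsto_neg_mult_at_bot[OF tendsto_const root2_neg filterlim_ident])

text \<open>The slope is a nonnegative multiple of a decaying exponential, hence antitone with limit
  0, so it passes 1 at most once and is eventually below it.\<close>

lemma value_profile_top:
  assumes "0 \<le> c"
  shows "value_profile c c (ext c 0) (ext1 c 0) (ext2 c 0)"
  unfolding value_profile_def
proof (intro conjI)
  have ext1: "ext1 c 0 x = c / q * (- root2 c) * exp (root2 c * x)" for x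
    by (simp add: ext1_def)
  have nn: "0 \<le> c / q * (- root2 c)" using assms q_pos root2_neg[of c]
    by (intro mult_nonneg_nonneg) auto
  show "\<exists>B. \<forall>x\<ge>0. \<bar>ext c 0 x\<bar> \<le> B \<and> \<bar>ext1 c 0 x\<bar> \<le> B \<and> \<bar>ext2 c 0 x\<bar> \<le> B"
  proof (intro exI[of _ "\<bar>c / q\<bar> + \<bar>c / q * root2 c\<bar> + \<bar>c / q * (root2 c)\<^sup>2\<bar>"] allI impI)
    fix x :: real assume x: "0 \<le> x"
    have e: "0 < exp (root2 c * x)" "exp (root2 c * x) \<le> 1" using exp_root2_le_1[OF x] by auto
    have "\<bar>ext c 0 x\<bar> \<le> \<bar>c / q\<bar> * 1" unfolding ext_def mult_zero_left add_0_right abs_mult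
      using e by (intro mult_left_mono) auto
    moreover have "\<bar>ext1 c 0 x\<bar> = \<bar>c / q * root2 c\<bar> * exp (root2 c * x)"
      by (simp add: ext1_def abs_mult)
    then have "\<bar>ext1 c 0 x\<bar> \<le> \<bar>c / q * root2 c\<bar> * 1"
      using e mult_left_mono[of "exp (root2 c * x)" 1 "\<bar>c / q * root2 c\<bar>"] by simp
    moreover have "\<bar>ext2 c 0 x\<bar> = \<bar>c / q * (root2 c)\<^sup>2\<bar> * exp (root2 c * x)"
      by (simp add: ext2_def abs_mult)
    then have "\<bar>ext2 c 0 x\<bar> \<le> \<bar>c / q * (root2 c)\<^sup>2\<bar> * 1"
      using e mult_left_mono[of "exp (root2 c * x)" 1 "\<bar>c / q * (root2 c)\<^sup>2\<bar>"] by simp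
    ultimately show "\<bar>ext c 0 x\<bar> \<le> \<bar>c / q\<bar> + \<bar>c / q * root2 c\<bar> + \<bar>c / q * (root2 c)\<^sup>2\<bar> \<and>
      \<bar>ext1 c 0 x\<bar> \<le> \<bar>c / q\<bar> + \<bar>c / q * root2 c\<bar> + \<bar>c / q * (root2 c)\<^sup>2\<bar> \<and>
      \<bar>ext2 c 0 x\<bar> \<le> \<bar>c / q\<bar> + \<bar>c / q * root2 c\<bar> + \<bar>c / q * (root2 c)\<^sup>2\<bar>" by linarith
  qed
  show "\<exists>b\<ge>0. (\<forall>x. 0 \<le> x \<and> x < b \<longrightarrow> 1 \<le> ext1 c 0 x) \<and> (\<forall>x\<ge>b. ext1 c 0 x \<le> 1)"
  proof -
    have anti: "ext1 c 0 y \<le> ext1 c 0 x" if "x \<le> y" for x y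
      unfolding ext1 using that root2_neg[of c] nn by (intro mult_left_mono) auto
    have "((\<lambda>x. c / q * (- root2 c) * exp (root2 c * x)) \<longlongrightarrow> c / q * (- root2 c) * 0) at_top"
      by (intro tendsto_intros exp_root2_tendsto)
    then have "\<forall>\<^sub>F x in at_top. ext1 c 0 x < 1" unfolding ext1 by (rule order_tendstoD) simp
    then obtain y where y: "\<And>x. y \<le> x \<Longrightarrow> ext1 c 0 x < 1" by (auto simp: eventually_at_top_linorder)
    \<comment> \<open>The infimum lies in the closed set, so the slope at \<open>b\<close> is
      already at most 1; \<open>b = 0\<close> is allowed, and then the condition to the left of
      \<open>b\<close> is empty.\<close>
    define b where "b = Inf {x. 0 \<le> x \<and> ext1 c 0 x \<le> 1}"
    have ne: "{x. 0 \<le> x \<and> ext1 c 0 x \<le> 1} \<noteq> {}" using y[of "max 0 y"] by (auto intro!: exI[of _ "max 0 y"])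
    have bdd: "bdd_below {x. 0 \<le> x \<and> ext1 c 0 x \<le> 1}" by (auto intro: bdd_belowI[of _ 0])
    have "closed ({0..} \<inter> {x. ext1 c 0 x \<le> 1})"
      by (intro closed_Int closed_atLeast closed_Collect_le ext_continuous continuous_on_const)
    also have "{0..} \<inter> {x. ext1 c 0 x \<le> 1} = {x. 0 \<le> x \<and> ext1 c 0 x \<le> 1}" by auto
    finally have "b \<in> {x. 0 \<le> x \<and> ext1 c 0 x \<le> 1}"
      unfolding b_def using ne bdd by (intro closed_contains_Inf)
    then have b: "0 \<le> b" "ext1 c 0 b \<le> 1" by auto
    have "1 \<le> ext1 c 0 x" if "0 \<le> x" "x < b" for x
    proof (rule ccontr)
      assume "\<not> ?thesis"
      then have "b \<le> x" unfolding b_def using that by (intro cInf_lower bdd) auto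
      with that show False by simp
    qed
    then show ?thesis using b anti by (intro exI[of _ b]) (auto intro: order_trans)
  qed
  show "(ext c 0 \<longlongrightarrow> c / q) at_top"
  proof -
    have "((\<lambda>x. c / q * (1 - exp (root2 c * x))) \<longlongrightarrow> c / q * (1 - 0)) at_top"
      by (intro tendsto_intros exp_root2_tendsto)
    then show ?thesis by (simp add: ext_def[abs_def])
  qed
  show "\<forall>x\<ge>0. \<exists>k\<ge>c. gen k (ext c 0 x) (ext1 c 0 x) (ext2 c 0 x) = 0"
    using gen_ext by blast
  show "\<exists>F. finite F \<and> (\<forall>x. x \<notin> F \<longrightarrow> (ext1 c 0 has_real_derivative ext2 c 0 x) (at x))"
    by (rule exI[of _ "{}"]) (simp add: ext1_deriv)
qed (auto intro: ext_deriv ext_continuous borel_measurable_continuous_onI)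

lemma gen_diff: "gen c f0 f1 f2 = gen k f0 f1 f2 + (k - c) * (f1 - 1)"
  by (simp add: gen_def algebra_simps)

text \<open>The inhomogeneous term \<open>c\<close> cancels in a difference, and Vieta turns what
  remains into \<sigma>^2/2 (D - root1)(D - root2) applied to \<open>f - g\<close>, with D the
  derivative. This replaces a maximum principle by two first-order comparisons.\<close>

lemma gen_factor:
  "\<sigma>\<^sup>2 / 2 * ((f2 - g2) - (root1 c + root2 c) * (f1 - g1) + root1 c * root2 c * (f0 - g0)) =
     gen c f0 f1 f2 - gen c g0 g1 g2"
proof -
  have "\<sigma>\<^sup>2 / 2 * ((f2 - g2) - (root1 c + root2 c) * (f1 - g1) + root1 c * root2 c * (f0 - g0)) =
    \<sigma>\<^sup>2 / 2 * (f2 - g2) - (\<sigma>\<^sup>2 * (root1 c + root2 c)) / 2 * (f1 - g1) + (\<sigma>\<^sup>2 * (root1 c * root2 c)) / 2 * (f0 - g0)"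
    by (simp add: field_simps)
  also have "\<dots> = gen c f0 f1 f2 - gen c g0 g1 g2"
    unfolding root_sum root_prod gen_def by (simp add: field_simps)
  finally show ?thesis .
qed

text \<open>The largest maximiser of the coefficient of the homogeneous solution. Taking the largest one
  makes the strict inequality hold beyond it, which is what forces the derivative condition there.\<close>

lemma largest_touching_point:
  assumes prof: "value_profile L c' G G1 G2" and "0 \<le> c" "c < L"
  obtains A z where "A > 0" "0 \<le> z" "\<And>x. 0 \<le> x \<Longrightarrow> G x \<le> ext c A x"
    "\<And>x. z < x \<Longrightarrow> G x < ext c A x" "ext c A z = G z" "ext1 c A z = G1 z"
proof -
  define D where "D x = exp (root1 c * x) - exp (root2 c * x)" for x
  define N where "N x = G x - c / q * (1 - exp (root2 c * x))" for x
  \<comment> \<open>\<open>a x\<close> is the coefficient for which \<open>ext c A\<close> passes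
    through \<open>G\<close> at \<open>x\<close>. All these curves meet at the origin, where
    numerator and denominator vanish; the quotient of their derivatives is the continuous value
    there.\<close>
  define a where "a x = (if x = 0 then (G1 0 + c / q * root2 c) / (root1 c - root2 c) else N x / D x)" for x
  have G0: "G 0 = 0" and G: "\<And>x. (G has_real_derivative G1 x) (at x)"
    and Glim: "(G \<longlongrightarrow> L / q) at_top"
    using prof unfolding value_profile_def by auto
  have r: "root1 c > 0" "root2 c < 0" by (rule root1_pos root2_neg)+
  have Dpos: "D x > 0" if "x > 0" for x
    using that r mult_strict_right_mono[of "root2 c" "root1 c" x] unfolding D_def by simp
  have Dnz: "D x \<noteq> 0" if "x \<noteq> 0" for x
    using that r unfolding D_def by simp
  have dN: "(N has_real_derivative G1 x + c / q * root2 c * exp (root2 c * x)) (at x)" for x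
    unfolding N_def by (auto intro!: derivative_eq_intros G simp: algebra_simps)
  have dD: "(D has_real_derivative root1 c * exp (root1 c * x) - root2 c * exp (root2 c * x)) (at x)" for x
    unfolding D_def by (auto intro!: derivative_eq_intros simp: algebra_simps)
  have "isCont a x" for x
  proof (cases "x = 0")
    case True
    have "((\<lambda>h. (N h - N 0) / (h - 0)) \<longlongrightarrow> G1 0 + c / q * root2 c) (at 0)"
      using dN[of 0] unfolding has_field_derivative_iff by simp
    moreover have "((\<lambda>h. (D h - D 0) / (h - 0)) \<longlongrightarrow> root1 c - root2 c) (at 0)"
      using dD[of 0] unfolding has_field_derivative_iff by simp
    ultimately have "((\<lambda>h. ((N h - N 0) / (h - 0)) / ((D h - D 0) / (h - 0))) \<longlongrightarrow> a 0) (at 0)"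
      using r tendsto_divide by (fastforce simp: a_def simp del: divide_divide_eq_left divide_divide_eq_right)
    moreover have "\<forall>\<^sub>F h in at 0. ((N h - N 0) / (h - 0)) / ((D h - D 0) / (h - 0)) = a h"
      unfolding eventually_at_filter a_def by (auto simp: N_def D_def G0)
    ultimately show ?thesis using True unfolding isCont_def by (auto intro: Lim_transform_eventually)
  next
    case False
    have "isCont (\<lambda>x. N x / D x) x"
      using dN[THEN DERIV_isCont] dD[THEN DERIV_isCont] Dnz[OF False] by (intro continuous_intros) auto
    moreover have "\<forall>\<^sub>F y in nhds x. N y / D y = a y"
      using t1_space_nhds[OF False] unfolding a_def by eventually_elim auto
    ultimately show ?thesis using isCont_cong[of "\<lambda>x. N x / D x" a x] by simp
  qed
  then have a_cont: "continuous_on S a" for S by (intro continuous_at_imp_continuous_on) auto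
  \<comment> \<open>The limit is \<open>(L - c) / q > 0\<close> while \<open>D\<close> tends to
    infinity. So \<open>a\<close> is eventually positive and tends to 0, and hence its supremum is
    attained and positive.\<close>
  have Nlim: "(N \<longlongrightarrow> L / q - c / q * (1 - 0)) at_top"
    unfolding N_def by (intro tendsto_intros Glim exp_root2_tendsto)
  have Dlim: "filterlim D at_top at_top"
  proof (rule filterlim_at_top_mono)
    show "filterlim (\<lambda>x. root1 c * x) at_top at_top"
      by (rule filterlim_tendsto_pos_mult_at_top[OF tendsto_const r(1) filterlim_ident])
    show "\<forall>\<^sub>F x in at_top. root1 c * x \<le> D x"
      using eventually_ge_at_top[of 0]
    proof eventually_elim
      case (elim x)
      then show ?case unfolding D_def
        using exp_ge_add_one_self[of "root1 c * x"] exp_root2_le_1[of x c] by linarith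
    qed
  qed
  have "((\<lambda>x. N x / D x) \<longlongrightarrow> 0) at_top"
    by (rule tendsto_divide_0[OF Nlim filterlim_at_top_imp_at_infinity[OF Dlim]])
  moreover have "\<forall>\<^sub>F x in at_top. N x / D x = a x"
    using eventually_gt_at_top[of 0] by eventually_elim (auto simp: a_def)
  ultimately have alim: "(a \<longlongrightarrow> 0) at_top" by (rule Lim_transform_eventually)
  have "\<forall>\<^sub>F x in at_top. N x > 0"
    by (rule order_tendstoD(1)[OF Nlim]) (use assms q_pos in \<open>simp add: divide_strict_right_mono\<close>)
  then have "\<forall>\<^sub>F x in at_top. a x > 0 \<and> x > 0"
    using eventually_gt_at_top[of 0] by eventually_elim (auto simp: a_def Dpos)
  then obtain x0 where x0: "a x0 > 0" "x0 > 0"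
    using eventually_happens'[OF trivial_limit_at_top_linorder] by blast
  obtain R0 where R0: "\<And>x. R0 \<le> x \<Longrightarrow> a x < a x0"
    using order_tendstoD(2)[OF alim x0(1)] unfolding eventually_at_top_linorder by auto
  \<comment> \<open>Beyond \<open>R\<close> the function stays below its value at \<open>x0\<close>,
    so a maximum over the compact interval is a global one.\<close>
  define R where "R = max R0 x0"
  have R: "x0 \<le> R" "\<And>x. R \<le> x \<Longrightarrow> a x < a x0" unfolding R_def using R0 by auto
  obtain y where y: "y \<in> {0..R}" "\<And>x. x \<in> {0..R} \<Longrightarrow> a x \<le> a y"
    using continuous_attains_sup[of "{0..R}" a] a_cont x0 R by auto
  define A where "A = a y"
  have A: "A \<ge> a x0" unfolding A_def using y x0 R by auto
  have aA: "a x \<le> A" if "0 \<le> x" for x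
    using that y(2)[of x] R(2)[of x] A unfolding A_def by (cases "x \<le> R") auto
  define K where "K = {0..R} \<inter> {x. A \<le> a x}"
  have "compact K" unfolding K_def
    by (intro compact_Int_closed compact_Icc closed_Collect_le continuous_on_const a_cont)
  moreover have "K \<noteq> {}" using y unfolding K_def A_def by auto
  \<comment> \<open>The maximisers form a compact set, so a largest one exists.\<close>
  ultimately obtain z where z: "z \<in> K" "\<And>x. x \<in> K \<Longrightarrow> x \<le> z"
    using compact_attains_sup[of K] by auto
  have z0: "0 \<le> z" and az: "a z = A" using z(1) aA[of z] unfolding K_def by auto
  have strict: "a x < A" if "z < x" for x
  proof (cases "x \<le> R")
    case True
    then show ?thesis using z(2)[of x] that z0 unfolding K_def by fastforce
  qed (use R(2)[of x] A in auto)
  have ext: "ext c A x = c / q * (1 - exp (root2 c * x)) + A * D x" for x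
    unfolding ext_def D_def ..
  have le: "G x \<le> ext c A x" if "0 \<le> x" for x
  proof (cases "x = 0")
    case False
    then have "N x / D x \<le> A" using aA[OF that] by (simp add: a_def)
    then have "N x \<le> A * D x" using Dpos[of x] that False by (simp add: field_simps)
    then show ?thesis unfolding ext N_def by simp
  qed (simp add: G0)
  have less: "G x < ext c A x" if "z < x" for x
  proof -
    have "x > 0" using that z0 by simp
    moreover have "N x / D x < A" using strict[OF that] \<open>x > 0\<close> by (simp add: a_def)
    ultimately have "N x < A * D x" using Dpos[of x] by (simp add: field_simps)
    then show ?thesis unfolding ext N_def by simp
  qed
  have touch: "ext c A z = G z"
  proof (cases "z = 0")
    case False
    then have "N z = A * D z" using az Dnz[of z] by (simp add: a_def field_simps)
    then show ?thesis unfolding ext N_def by simp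
  qed (simp add: G0)
  \<comment> \<open>For \<open>z > 0\<close> the difference has an interior minimum. At
    \<open>z = 0\<close> only one side is available, and equality of slopes is read off from the
    value chosen for \<open>a 0\<close>.\<close>
  have "ext1 c A z = G1 z"
  proof (cases "z = 0")
    case True
    then have "G1 0 + c / q * root2 c = A * (root1 c - root2 c)"
      using az r by (simp add: a_def divide_eq_eq)
    then show ?thesis unfolding ext1_def True by (simp add: algebra_simps)
  next
    case False
    have d: "((\<lambda>x. ext c A x - G x) has_real_derivative ext1 c A z - G1 z) (at z)"
      by (intro derivative_intros ext_deriv G)
    have "ext1 c A z - G1 z = 0"
      by (rule DERIV_local_min[OF d, of z]) (use False z0 touch le in auto)
    then show ?thesis by simp
  qed
  then show thesis using that[of A z] A x0 z0 le less touch by auto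
qed

text \<open>The new value follows the touching solution up to the last touching point and the old
  value afterwards. The crux is that this point is not to the left of \<open>b\<close>: then the
  slope of \<open>G\<close> beyond it is at most 1, and changing the level from \<open>k\<close>
  down to \<open>c\<close> makes the generator nonpositive.\<close>

lemma value_profile_step:
  assumes prof: "value_profile L c' G G1 G2" and c: "0 \<le> c" "c < c'" "c < L"
  shows "\<exists>z V V1 V2. 0 \<le> z \<and> value_profile L c V V1 V2 \<and>
    (\<forall>x\<ge>0. G x \<le> V x) \<and> (\<forall>x\<ge>z. V x = G x) \<and>
    (\<forall>x. 0 \<le> x \<and> x < z \<longrightarrow> gen c (V x) (V1 x) (V2 x) = 0) \<and>
    (\<forall>x\<ge>0. gen c (V x) (V1 x) (V2 x) \<le> 0)"
proof -
  obtain A z where A: "A > 0" and z0: "0 \<le> z" and le: "\<And>x. 0 \<le> x \<Longrightarrow> G x \<le> ext c A x"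
    and less: "\<And>x. z < x \<Longrightarrow> G x < ext c A x" and touch: "ext c A z = G z" and touch1: "ext1 c A z = G1 z"
    using largest_touching_point[OF prof c(1,3)] by blast
  obtain F B b where G0: "G 0 = 0" and G: "\<And>x. (G has_real_derivative G1 x) (at x)"
    and G1c: "continuous_on UNIV G1"
    and F: "finite F" and G1: "\<And>x. x \<notin> F \<Longrightarrow> (G1 has_real_derivative G2 x) (at x)"
    and G2m: "G2 \<in> borel_measurable borel"
    and B: "\<And>x. 0 \<le> x \<Longrightarrow> \<bar>G x\<bar> \<le> B \<and> \<bar>G1 x\<bar> \<le> B \<and> \<bar>G2 x\<bar> \<le> B"
    and b: "0 \<le> b" "\<And>x. 0 \<le> x \<Longrightarrow> x < b \<Longrightarrow> 1 \<le> G1 x" "\<And>x. b \<le> x \<Longrightarrow> G1 x \<le> 1"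
    and k: "\<And>x. 0 \<le> x \<Longrightarrow> \<exists>k\<ge>c'. gen k (G x) (G1 x) (G2 x) = 0"
    and Glim: "(G \<longlongrightarrow> L / q) at_top"
    using prof unfolding value_profile_def by metis
  have Gc: "continuous_on S G" for S
    using G DERIV_isCont by (intro continuous_at_imp_continuous_on) blast
  have G1c': "continuous_on S G1" for S using G1c continuous_on_subset by blast
  have genG: "\<exists>k\<ge>c'. gen c (G x) (G1 x) (G2 x) = (k - c) * (G1 x - 1)" if "0 \<le> x" for x
    using k[OF that] by (metis gen_diff add_0)
  \<comment> \<open>If \<open>z < b\<close>, then \<open>G\<close> is a subsolution at level
    \<open>c\<close> on the interval between them, as its slope is at least 1 there. The touching
    solution starts at \<open>z\<close> with the same value and slope, so comparison puts it at or
    below \<open>G\<close> at \<open>b\<close>, against strictness beyond \<open>z\<close>.\<close>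
  have bz: "b \<le> z"
  proof (rule ccontr)
    assume "\<not> b \<le> z"
    then have zb: "z < b" by simp
    define w where "w x = ext c A x - G x" for x
    define w1 where "w1 x = ext1 c A x - G1 x" for x
    \<comment> \<open>The integrating factor of the first factor: \<open>u'\<close> is
      \<open>exp (- root1 c * x)\<close> times (D - root1)(D - root2) applied to \<open>w\<close>,
      which \<open>gen_factor\<close> makes nonpositive. The matching data at \<open>z\<close> give
      \<open>u z = 0\<close>.\<close>
    define u where "u x = exp (- root1 c * x) * (w1 x - root2 c * w x)" for x
    define u' where "u' x = exp (- root1 c * x) * ((ext2 c A x - G2 x) - (root1 c + root2 c) * w1 x + root1 c * root2 c * w x)" for x
    have u_le: "u y \<le> u z" if y: "z \<le> y" "y \<le> b" for y
    proof (rule deriv_nonpos_off_finite_imp_le[OF F y(1), where h' = u'])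
      show "continuous_on {z..y} u" unfolding u_def w1_def w_def
        by (intro continuous_intros Gc G1c')
      show "(u has_real_derivative u' x) (at x)" if "x \<in> {z<..<y} - F" for x
        unfolding u_def w1_def w_def u'_def using that
        by (auto intro!: derivative_eq_intros ext_deriv ext1_deriv G G1 simp: algebra_simps)
      show "u' x \<le> 0" if "x \<in> {z<..<y}" for x
      proof -
        have x: "0 \<le> x" "x < b" using that z0 y by auto
        obtain k where "k \<ge> c'" "gen c (G x) (G1 x) (G2 x) = (k - c) * (G1 x - 1)" using genG[OF x(1)] by blast
        then have "gen c (G x) (G1 x) (G2 x) \<ge> 0" using c b(2)[OF x] by simp
        then have "\<sigma>\<^sup>2 / 2 * ((ext2 c A x - G2 x) - (root1 c + root2 c) * w1 x + root1 c * root2 c * w x) \<le> 0"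
          unfolding w_def w1_def gen_factor gen_ext by simp
        then have "(ext2 c A x - G2 x) - (root1 c + root2 c) * w1 x + root1 c * root2 c * w x \<le> 0"
          using sigma_pos by (simp add: mult_le_0_iff)
        then show ?thesis unfolding u'_def by (simp add: mult_nonneg_nonpos)
      qed
    qed
    have "u z = 0" unfolding u_def w_def w1_def by (simp add: touch touch1)
    then have w1_le: "w1 y - root2 c * w y \<le> 0" if "z \<le> y" "y \<le> b" for y
      using u_le[OF that] unfolding u_def by (simp add: mult_le_0_iff)
    \<comment> \<open>The second factor is integrated in the same way, starting from
      \<open>w z = 0\<close>.\<close>
    have "exp (- root2 c * b) * w b \<le> exp (- root2 c * z) * w z"
    proof (rule deriv_nonpos_off_finite_imp_le[of "{}" z b "\<lambda>x. exp (- root2 c * x) * w x"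
          "\<lambda>x. exp (- root2 c * x) * (w1 x - root2 c * w x)"])
      show "((\<lambda>x. exp (- root2 c * x) * w x) has_real_derivative exp (- root2 c * x) * (w1 x - root2 c * w x)) (at x)" for x
        unfolding w_def w1_def by (auto intro!: derivative_eq_intros ext_deriv G simp: algebra_simps)
      show "continuous_on {z..b} (\<lambda>x. exp (- root2 c * x) * w x)" unfolding w_def
        by (intro continuous_intros Gc)
      show "exp (- root2 c * x) * (w1 x - root2 c * w x) \<le> 0" if "x \<in> {z<..<b}" for x
        using w1_le[of x] that by (intro mult_nonneg_nonpos) auto
    qed (use zb in auto)
    then have "w b \<le> 0" by (simp add: w_def touch mult_le_0_iff)
    then show False using less[OF zb] by (simp add: w_def)
  qed
  define V where "V x = (if x \<le> z then ext c A x else G x)" for x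
  define V1 where "V1 x = (if x \<le> z then ext1 c A x else G1 x)" for x
  \<comment> \<open>Strict inequality, unlike in \<open>V\<close> and \<open>V1\<close>: at
    \<open>z\<close> the second derivative jumps, and taking the one of \<open>G\<close> keeps the
    equation of \<open>G\<close> valid at \<open>z\<close> itself.\<close>
  define V2 where "V2 x = (if x < z then ext2 c A x else G2 x)" for x
  have V_ge: "V x = G x" "V1 x = G1 x" "V2 x = G2 x" if "z \<le> x" for x
    using that touch touch1 by (auto simp: V_def V1_def V2_def)
  have V_lt: "V x = ext c A x" "V1 x = ext1 c A x" "V2 x = ext2 c A x" if "x < z" for x
    using that by (auto simp: V_def V1_def V2_def)
  have gen0: "gen c (V x) (V1 x) (V2 x) = 0" if "x < z" for x
    using that by (simp add: V_lt gen_ext)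
  have "value_profile L c V V1 V2"
    unfolding value_profile_def
  proof (intro conjI)
    show "V 0 = 0" using G0 by (simp add: V_def)
    show "\<forall>x. (V has_real_derivative V1 x) (at x)"
    proof
      fix x
      consider "x < z" | "x = z" | "z < x" by linarith
      then show "(V has_real_derivative V1 x) (at x)"
      proof cases
        case 1
        then show ?thesis unfolding V_def[abs_def] V_lt[OF 1]
          by (intro has_real_derivative_If_left ext_deriv)
      next
        case 2
        have "(ext c A has_real_derivative G1 z) (at z)" using ext_deriv[of c A z] touch1 by simp
        then show ?thesis unfolding V_def[abs_def] 2 V_ge[OF order_refl]
          by (intro has_real_derivative_If_le G touch)
      next
        case 3
        then show ?thesis unfolding V_def[abs_def] V_ge[OF less_imp_le[OF 3]]
          by (intro has_real_derivative_If_right G)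
      qed
    qed
    have "continuous_on ({..z} \<union> {z..}) V1" unfolding V1_def[abs_def]
      by (rule continuous_on_If[OF closed_atMost closed_atLeast])
         (auto intro: ext_continuous G1c' simp: touch1)
    then show "continuous_on UNIV V1"
      by (rule continuous_on_subset) auto
    show "\<exists>F. finite F \<and> (\<forall>x. x \<notin> F \<longrightarrow> (V1 has_real_derivative V2 x) (at x))"
    proof (intro exI[of _ "insert z F"] conjI allI impI)
      fix x assume x: "x \<notin> insert z F"
      show "(V1 has_real_derivative V2 x) (at x)"
      proof (cases "x < z")
        case True
        then show ?thesis unfolding V1_def[abs_def] V_lt(3)[OF True]
          by (intro has_real_derivative_If_left ext1_deriv)
      next
        case False
        then have "z < x" using x by auto
        then show ?thesis unfolding V1_def[abs_def] V_ge(3)[OF less_imp_le[OF \<open>z < x\<close>]]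
          using x by (intro has_real_derivative_If_right G1) auto
      qed
    qed (use F in auto)
    have [measurable]: "G2 \<in> borel_measurable borel" "ext2 c A \<in> borel_measurable borel"
      by (auto intro: G2m borel_measurable_continuous_onI ext_continuous)
    show "V2 \<in> borel_measurable borel" unfolding V2_def[abs_def] by measurable
    show "\<exists>B. \<forall>x\<ge>0. \<bar>V x\<bar> \<le> B \<and> \<bar>V1 x\<bar> \<le> B \<and> \<bar>V2 x\<bar> \<le> B"
    proof -
      have "bounded (f ` {0..z})" if "continuous_on {0..z} f" for f :: "real \<Rightarrow> real"
        using that by (intro compact_imp_bounded compact_continuous_image) auto
      then obtain B0 B1 B2 where Bs: "\<forall>x\<in>{0..z}. \<bar>ext c A x\<bar> \<le> B0" "\<forall>x\<in>{0..z}. \<bar>ext1 c A x\<bar> \<le> B1"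
        "\<forall>x\<in>{0..z}. \<bar>ext2 c A x\<bar> \<le> B2"
        by (metis (no_types, lifting) ext_continuous bounded_iff imageI real_norm_def)
      show ?thesis
      proof (intro exI[of _ "max B (max B0 (max B1 B2))"] allI impI)
        fix x :: real assume "0 \<le> x"
        then show "\<bar>V x\<bar> \<le> max B (max B0 (max B1 B2)) \<and> \<bar>V1 x\<bar> \<le> max B (max B0 (max B1 B2)) \<and>
          \<bar>V2 x\<bar> \<le> max B (max B0 (max B1 B2))"
          using B[of x] Bs by (cases "x < z") (auto simp: V_lt V_ge le_max_iff_disj)
      qed
    qed
    show "\<exists>b\<ge>0. (\<forall>x. 0 \<le> x \<and> x < b \<longrightarrow> 1 \<le> V1 x) \<and> (\<forall>x\<ge>b. V1 x \<le> 1)"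
    proof -
      have "closed ({0..z} \<inter> {x. ext1 c A x \<le> 1})"
        by (intro closed_Int closed_atLeastAtMost closed_Collect_le ext_continuous continuous_on_const)
      moreover have zin: "z \<in> {0..z} \<inter> {x. ext1 c A x \<le> 1}"
        using z0 touch1 b(3)[OF bz] by auto
      moreover have bdd: "bdd_below ({0..z} \<inter> {x. ext1 c A x \<le> 1})" by auto
      ultimately have inf: "Inf ({0..z} \<inter> {x. ext1 c A x \<le> 1}) \<in> {0..z} \<inter> {x. ext1 c A x \<le> 1}"
        by (intro closed_contains_Inf) auto
      \<comment> \<open>The first point of \<open>{0..z}\<close> with slope at most 1. The set
        contains \<open>z\<close>, because the slope of \<open>G\<close> at \<open>z\<close> is at
        most 1 by \<open>bz\<close>.\<close>
      define b' where "b' = Inf ({0..z} \<inter> {x. ext1 c A x \<le> 1})"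
      have b': "0 \<le> b'" "b' \<le> z" "ext1 c A b' \<le> 1" using inf unfolding b'_def by auto
      have "1 \<le> V1 x" if "0 \<le> x" "x < b'" for x
      proof (rule ccontr)
        assume "\<not> ?thesis"
        then have "x \<in> {0..z} \<inter> {x. ext1 c A x \<le> 1}" using that b' by (auto simp: V1_def)
        then have "b' \<le> x" unfolding b'_def using bdd by (intro cInf_lower)
        with that show False by simp
      qed
      moreover have "V1 x \<le> 1" if "b' \<le> x" for x
      proof (cases "x \<le> z")
        case True
        \<comment> \<open>A convex function that is at most 1 at both ends \<open>b'\<close> and
          \<open>z\<close> is at most 1 between them, so the slope cannot rise above 1 again before
          the pasting point.\<close>
        have "x \<in> convex hull {b', z}"
          using True that b' by (simp add: closed_segment_eq_real_ivl flip: segment_convex_hull)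
        then have "ext1 c A x \<le> 1"
          using convex_on_convex_hull_bound[of "{b', z}" "ext1 c A" 1] ext1_convex[of A c] A c b' zin
          by (auto intro: convex_on_subset)
        then show ?thesis using True b' zin by (auto simp: V1_def)
      qed (use b(3)[of x] bz in \<open>auto simp: V1_def\<close>)
      ultimately show ?thesis using b' by auto
    qed
    show "\<forall>x\<ge>0. \<exists>k\<ge>c. gen k (V x) (V1 x) (V2 x) = 0"
    proof (intro allI impI)
      fix x :: real assume "0 \<le> x"
      then show "\<exists>k\<ge>c. gen k (V x) (V1 x) (V2 x) = 0"
      proof (cases "x < z")
        case False
        then show ?thesis using k[OF \<open>0 \<le> x\<close>] c(2) by (auto simp: V_ge intro: order_trans less_imp_le)
      qed (use gen0 in auto)
    qed
    have "\<forall>\<^sub>F x in at_top. G x = V x"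
      using eventually_ge_at_top[of z] by eventually_elim (simp add: V_ge)
    then show "(V \<longlongrightarrow> L / q) at_top" by (rule Lim_transform_eventually[OF Glim])
  qed
  moreover have "G x \<le> V x" if "0 \<le> x" for x using le[OF that] by (simp add: V_def)
  moreover have "gen c (V x) (V1 x) (V2 x) \<le> 0" if x: "0 \<le> x" for x
  proof (cases "x < z")
    case False
    obtain k where "k \<ge> c'" "gen c (G x) (G1 x) (G2 x) = (k - c) * (G1 x - 1)" using genG[OF x] by blast
    then show ?thesis using False c b(3)[of x] bz by (simp add: V_ge mult_nonneg_nonpos)
  qed (simp add: gen0)
  ultimately show ?thesis using z0 gen0 V_ge by blast
qed

text \<open>Any bounded extension to negative arguments will do: the time that the frozen surplus spends
  below zero before it is stopped tends to zero with the mesh.\<close>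

lemma regular_extension:
  assumes "value_profile L c G G1 G2"
  shows "\<exists>f f1 f2. regular f f1 f2 \<and> (\<forall>x\<ge>0. f x = G x \<and> f1 x = G1 x \<and> f2 x = G2 x)"
proof -
  obtain F B where G0: "G 0 = 0" and G: "\<And>x. (G has_real_derivative G1 x) (at x)"
    and G1c: "continuous_on UNIV G1"
    and F: "finite F" and G1: "\<And>x. x \<notin> F \<Longrightarrow> (G1 has_real_derivative G2 x) (at x)"
    and G2m: "G2 \<in> borel_measurable borel"
    and B: "\<And>x. 0 \<le> x \<Longrightarrow> \<bar>G x\<bar> \<le> B \<and> \<bar>G1 x\<bar> \<le> B \<and> \<bar>G2 x\<bar> \<le> B"
    using assms unfolding value_profile_def by metis
  define d where "d = G1 0"
  \<comment> \<open>On the left this branch has value 0 and slope \<open>d\<close> at the origin, as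
    \<open>G\<close> does, and is bounded together with its first two derivatives.\<close>
  define f where "f x = (if x \<le> 0 then d * (exp x - 1) else G x)" for x
  define f1 where "f1 x = (if x \<le> 0 then d * exp x else G1 x)" for x
  \<comment> \<open>The point 0 is given to \<open>G2\<close>, so that agreement holds on the closed
    half-line.\<close>
  define f2 where "f2 x = (if x < 0 then d * exp x else G2 x)" for x
  have "regular f f1 f2"
    unfolding regular_def
  proof (intro conjI)
    show "\<forall>x. (f has_real_derivative f1 x) (at x)"
    proof
      fix x :: real
      have e: "((\<lambda>x. d * (exp x - 1)) has_real_derivative d * exp x) (at x)" for x
        by (auto intro!: derivative_eq_intros)
      consider "x < 0" | "x = 0" | "0 < x" by linarith
      then show "(f has_real_derivative f1 x) (at x)"
      proof cases
        case 1
        then show ?thesis using has_real_derivative_If_left[OF e 1] by (simp add: f_def[abs_def] f1_def)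
      next
        case 2
        have "((\<lambda>x. d * (exp x - 1)) has_real_derivative d) (at 0)" using e[of 0] by simp
        from has_real_derivative_If_le[OF this, of G] G[of 0] G0 show ?thesis
          by (simp add: 2 f_def[abs_def] f1_def d_def)
      next
        case 3
        then show ?thesis using has_real_derivative_If_right[OF G 3] by (simp add: f_def[abs_def] f1_def)
      qed
    qed
    have "continuous_on ({..0} \<union> {0..}) f1" unfolding f1_def[abs_def]
      by (rule continuous_on_If[OF closed_atMost closed_atLeast])
         (auto intro!: continuous_intros continuous_on_subset[OF G1c] simp: d_def)
    then show "continuous_on UNIV f1" by (rule continuous_on_subset) auto
    show "\<exists>F. finite F \<and> (\<forall>x. x \<notin> F \<longrightarrow> (f1 has_real_derivative f2 x) (at x))"
    proof (intro exI[of _ "insert 0 F"] conjI allI impI)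
      fix x :: real assume x: "x \<notin> insert 0 F"
      have e: "((\<lambda>x. d * exp x) has_real_derivative d * exp x) (at x)"
        by (auto intro!: derivative_eq_intros)
      show "(f1 has_real_derivative f2 x) (at x)"
        using x has_real_derivative_If_left[OF e, of 0 G1] has_real_derivative_If_right[OF G1[of x], of 0]
        by (cases "x < 0") (auto simp: f1_def[abs_def] f2_def)
    qed (use F in auto)
    have [measurable]: "G2 \<in> borel_measurable borel" by (rule G2m)
    show "f2 \<in> borel_measurable borel" unfolding f2_def[abs_def] by measurable
    show "\<exists>B. \<forall>x. \<bar>f x\<bar> \<le> B \<and> \<bar>f1 x\<bar> \<le> B \<and> \<bar>f2 x\<bar> \<le> B"
    proof (intro exI[of _ "B + \<bar>d\<bar>"] allI)
      fix x :: real
      have B0: "0 \<le> B" using B[of 0] by auto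
      show "\<bar>f x\<bar> \<le> B + \<bar>d\<bar> \<and> \<bar>f1 x\<bar> \<le> B + \<bar>d\<bar> \<and> \<bar>f2 x\<bar> \<le> B + \<bar>d\<bar>"
      proof (cases "x \<le> 0")
        case True
        have m: "\<bar>d\<bar> * \<bar>y\<bar> \<le> \<bar>d\<bar>" if "\<bar>y\<bar> \<le> 1" for y :: real
          using mult_left_mono[OF that, of "\<bar>d\<bar>"] by simp
        have "exp x \<le> 1" "0 < exp x" using True by auto
        then have "\<bar>d * (exp x - 1)\<bar> \<le> \<bar>d\<bar>" "\<bar>d * exp x\<bar> \<le> \<bar>d\<bar>"
          using m[of "exp x - 1"] m[of "exp x"] by (auto simp: abs_mult)
        moreover have "\<bar>G2 x\<bar> \<le> B" if "\<not> x < 0" using B[of x] that by auto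
        ultimately show ?thesis using True B0 by (auto simp: f_def f1_def f2_def)
      next
        case False
        then show ?thesis using B[of x] by (auto simp: f_def f1_def f2_def)
      qed
    qed
  qed
  moreover have "f x = G x \<and> f1 x = G1 x \<and> f2 x = G2 x" if "0 \<le> x" for x
    using that G0 by (auto simp: f_def f1_def f2_def d_def)
  ultimately show ?thesis by blast
qed

text \<open>The regularity requirement \<open>P\<close> is a parameter so that one system serves
  both for profiles on the half-line and for their extensions to the real line. All functions are
  indexed by the level itself, as the thresholds are in \<open>thr\<close>.\<close>

definition variational_system ::
    "(real \<Rightarrow> (real \<Rightarrow> real) \<Rightarrow> (real \<Rightarrow> real) \<Rightarrow> (real \<Rightarrow> real) \<Rightarrow> bool) \<Rightarrow> real list \<Rightarrow> (real \<Rightarrow> real) \<Rightarrow> (real \<Rightarrow> real \<Rightarrow> real) \<Rightarrow> (real \<Rightarrow> real \<Rightarrow> real) \<Rightarrow> (real \<Rightarrow> real \<Rightarrow> real) \<Rightarrow> bool" where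
  "variational_system P cs z V V1 V2 \<longleftrightarrow>
    (\<forall>c\<in>set cs. P c (V c) (V1 c) (V2 c) \<and> (\<forall>x\<ge>0. gen c (V c x) (V1 c x) (V2 c x) \<le> 0)) \<and>
    (\<forall>x\<ge>0. gen (last cs) (V (last cs) x) (V1 (last cs) x) (V2 (last cs) x) = 0) \<and>
    (\<forall>i. Suc i < length cs \<longrightarrow> 0 \<le> z (cs ! i) \<and>
      (\<forall>x\<ge>0. V (cs ! Suc i) x \<le> V (cs ! i) x) \<and> (\<forall>x\<ge>z (cs ! i). V (cs ! i) x = V (cs ! Suc i) x) \<and>
      (\<forall>x. 0 \<le> x \<and> x < z (cs ! i) \<longrightarrow> gen (cs ! i) (V (cs ! i) x) (V1 (cs ! i) x) (V2 (cs ! i) x) = 0))"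

lemma ex_value_profiles:
  assumes "cs \<noteq> []" "sorted_wrt (<) cs" "0 \<le> hd cs"
  shows "\<exists>z V V1 V2. variational_system (value_profile (last cs)) cs z V V1 V2"
  using assms
proof (induction cs rule: list_nonempty_induct)
  case (single c)
  then show ?case using value_profile_top[of c]
    by (intro exI[of _ "\<lambda>_. 0"] exI[of _ "\<lambda>_. ext c 0"] exI[of _ "\<lambda>_. ext1 c 0"] exI[of _ "\<lambda>_. ext2 c 0"])
       (auto simp: gen_ext variational_system_def)
next
  case (cons c cs)
  have c: "\<And>d. d \<in> set cs \<Longrightarrow> c < d" "0 \<le> c" using cons.prems by auto
  have hd: "hd cs \<in> set cs" "last cs \<in> set cs" using cons.hyps by auto
  have "0 \<le> hd cs" using c hd by force
  then obtain z V V1 V2 where sys: "variational_system (value_profile (last cs)) cs z V V1 V2"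
    using cons.IH cons.prems by auto
  have
    1: "\<And>d. d \<in> set cs \<Longrightarrow> value_profile (last cs) d (V d) (V1 d) (V2 d)"
       "\<And>d x. d \<in> set cs \<Longrightarrow> 0 \<le> x \<Longrightarrow> gen d (V d x) (V1 d x) (V2 d x) \<le> 0"
    and 2: "\<And>x. 0 \<le> x \<Longrightarrow> gen (last cs) (V (last cs) x) (V1 (last cs) x) (V2 (last cs) x) = 0"
    and 3: "\<And>i. Suc i < length cs \<Longrightarrow> 0 \<le> z (cs ! i) \<and>
      (\<forall>x\<ge>0. V (cs ! Suc i) x \<le> V (cs ! i) x) \<and> (\<forall>x\<ge>z (cs ! i). V (cs ! i) x = V (cs ! Suc i) x) \<and>
      (\<forall>x. 0 \<le> x \<and> x < z (cs ! i) \<longrightarrow> gen (cs ! i) (V (cs ! i) x) (V1 (cs ! i) x) (V2 (cs ! i) x) = 0)"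
    using sys unfolding variational_system_def by blast+
  obtain z0 U U1 U2 where U: "0 \<le> z0" "value_profile (last cs) c U U1 U2"
    "\<forall>x\<ge>0. V (hd cs) x \<le> U x" "\<forall>x\<ge>z0. U x = V (hd cs) x"
    "\<forall>x. 0 \<le> x \<and> x < z0 \<longrightarrow> gen c (U x) (U1 x) (U2 x) = 0"
    "\<forall>x\<ge>0. gen c (U x) (U1 x) (U2 x) \<le> 0"
    using value_profile_step[OF 1(1)[OF hd(1)] c(2) c(1)[OF hd(1)] c(1)[OF hd(2)]] by metis
  have ne: "d \<noteq> c" if "d \<in> set cs" for d using c(1)[OF that] by auto
  have nth: "cs ! i \<noteq> c" if "i < length cs" for i using ne that by auto
  show ?case
    unfolding variational_system_def
  \<comment> \<open>Strict increase keeps \<open>c\<close> out of \<open>cs\<close>, so updating the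
    four functions at \<open>c\<close> does not disturb the system already built for the higher
    levels.\<close>
  proof (rule exI[of _ "z(c := z0)"], rule exI[of _ "V(c := U)"], rule exI[of _ "V1(c := U1)"],
      rule exI[of _ "V2(c := U2)"], intro conjI)
    show "\<forall>d\<in>set (c # cs). value_profile (last (c # cs)) d ((V(c := U)) d) ((V1(c := U1)) d) ((V2(c := U2)) d) \<and>
       (\<forall>x\<ge>0. gen d ((V(c := U)) d x) ((V1(c := U1)) d x) ((V2(c := U2)) d x) \<le> 0)"
      using 1 U ne cons.hyps by auto
    show "\<forall>x\<ge>0. gen (last (c # cs)) ((V(c := U)) (last (c # cs)) x) ((V1(c := U1)) (last (c # cs)) x)
        ((V2(c := U2)) (last (c # cs)) x) = 0"
      using 2 ne[OF hd(2)] cons.hyps by auto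
    show "\<forall>i. Suc i < length (c # cs) \<longrightarrow> 0 \<le> (z(c := z0)) ((c # cs) ! i) \<and>
      (\<forall>x\<ge>0. (V(c := U)) ((c # cs) ! Suc i) x \<le> (V(c := U)) ((c # cs) ! i) x) \<and>
      (\<forall>x\<ge>(z(c := z0)) ((c # cs) ! i). (V(c := U)) ((c # cs) ! i) x = (V(c := U)) ((c # cs) ! Suc i) x) \<and>
      (\<forall>x. 0 \<le> x \<and> x < (z(c := z0)) ((c # cs) ! i) \<longrightarrow>
        gen ((c # cs) ! i) ((V(c := U)) ((c # cs) ! i) x) ((V1(c := U1)) ((c # cs) ! i) x) ((V2(c := U2)) ((c # cs) ! i) x) = 0)"
    proof (intro allI impI)
      fix i assume i: "Suc i < length (c # cs)"
      show "0 \<le> (z(c := z0)) ((c # cs) ! i) \<and>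
        (\<forall>x\<ge>0. (V(c := U)) ((c # cs) ! Suc i) x \<le> (V(c := U)) ((c # cs) ! i) x) \<and>
        (\<forall>x\<ge>(z(c := z0)) ((c # cs) ! i). (V(c := U)) ((c # cs) ! i) x = (V(c := U)) ((c # cs) ! Suc i) x) \<and>
        (\<forall>x. 0 \<le> x \<and> x < (z(c := z0)) ((c # cs) ! i) \<longrightarrow>
          gen ((c # cs) ! i) ((V(c := U)) ((c # cs) ! i) x) ((V1(c := U1)) ((c # cs) ! i) x) ((V2(c := U2)) ((c # cs) ! i) x) = 0)"
      proof (cases i)
        case 0
        then show ?thesis using U nth[of 0] cons.hyps by (simp add: hd_conv_nth)
      next
        case (Suc j)
        then show ?thesis using 3[of j] nth[of j] nth[of "Suc j"] i by simp
      qed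
    qed
  qed
qed

lemma ex_variational_solution:
  assumes "cs \<noteq> []" "sorted_wrt (<) cs" "0 \<le> hd cs"
  shows "\<exists>z V V1 V2. variational_system (\<lambda>c f f1 f2. regular f f1 f2 \<and> f 0 = 0) cs z V V1 V2"
proof -
  obtain z U U1 U2 where sys: "variational_system (value_profile (last cs)) cs z U U1 U2"
    using ex_value_profiles[OF assms] by blast
  have
    1: "\<And>c. c \<in> set cs \<Longrightarrow> value_profile (last cs) c (U c) (U1 c) (U2 c)"
       "\<And>c x. c \<in> set cs \<Longrightarrow> 0 \<le> x \<Longrightarrow> gen c (U c x) (U1 c x) (U2 c x) \<le> 0"
    and 2: "\<And>x. 0 \<le> x \<Longrightarrow> gen (last cs) (U (last cs) x) (U1 (last cs) x) (U2 (last cs) x) = 0"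
    and 3: "\<And>i. Suc i < length cs \<Longrightarrow> 0 \<le> z (cs ! i) \<and>
      (\<forall>x\<ge>0. U (cs ! Suc i) x \<le> U (cs ! i) x) \<and> (\<forall>x\<ge>z (cs ! i). U (cs ! i) x = U (cs ! Suc i) x) \<and>
      (\<forall>x. 0 \<le> x \<and> x < z (cs ! i) \<longrightarrow> gen (cs ! i) (U (cs ! i) x) (U1 (cs ! i) x) (U2 (cs ! i) x) = 0)"
    using sys unfolding variational_system_def by blast+
  have "\<forall>c\<in>set cs. \<exists>f f1 f2. regular f f1 f2 \<and> (\<forall>x\<ge>0. f x = U c x \<and> f1 x = U1 c x \<and> f2 x = U2 c x)"
    using regular_extension 1 by blast
  then obtain V V1 V2 where V: "\<And>c. c \<in> set cs \<Longrightarrow> regular (V c) (V1 c) (V2 c)"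
    "\<And>c x. c \<in> set cs \<Longrightarrow> 0 \<le> x \<Longrightarrow> V c x = U c x \<and> V1 c x = U1 c x \<and> V2 c x = U2 c x"
    by metis
  have nth: "cs ! i \<in> set cs" "cs ! Suc i \<in> set cs" if "Suc i < length cs" for i using that by auto
  \<comment> \<open>Values are linked only beyond a threshold, and thresholds are nonnegative; so
    linking never looks at the arbitrary extension to negative arguments.\<close>
  have ge0: "0 \<le> x" if "Suc i < length cs" "z (cs ! i) \<le> x" for i x
    using 3[OF that(1)] that(2) by auto
  have "variational_system (\<lambda>c f f1 f2. regular f f1 f2 \<and> f 0 = 0) cs z V V1 V2"
    unfolding variational_system_def
  proof (intro conjI ballI allI impI)
    show "V c 0 = 0" if "c \<in> set cs" for c using 1(1)[OF that] V(2)[OF that] by (auto simp: value_profile_def)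
    show "V (cs ! i) x = V (cs ! Suc i) x" if "Suc i < length cs" "z (cs ! i) \<le> x" for i x
      using 3[OF that(1)] V(2)[OF nth(1)] V(2)[OF nth(2)] ge0[OF that] that by auto
  qed (use 1 2 3 V nth assms in auto)
  then show ?thesis by blast
qed

end

subsection \<open>Dynkin's formula for one Gaussian step\<close>

lemma regularD:
  assumes "regular f f1 f2"
  shows "(f has_real_derivative f1 x) (at x)" "isCont f1 x"
    "f \<in> borel_measurable borel" "f1 \<in> borel_measurable borel" "f2 \<in> borel_measurable borel"
    "continuous_on S f"
proof -
  show "(f has_real_derivative f1 x) (at x)" "isCont f1 x" "f2 \<in> borel_measurable borel" "f1 \<in> borel_measurable borel"
    using assms by (auto simp: regular_def continuous_on_eq_continuous_at intro: borel_measurable_continuous_onI)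
  have "continuous_on UNIV f"
    using assms by (auto simp: regular_def continuous_on_eq_continuous_at intro: DERIV_isCont)
  then show "f \<in> borel_measurable borel" "continuous_on S f"
    by (auto intro: borel_measurable_continuous_onI continuous_on_subset)
qed

lemma regular_bound:
  assumes "regular f f1 f2"
  obtains B where "0 \<le> B" "\<And>x. \<bar>f x\<bar> \<le> B" "\<And>x. \<bar>f1 x\<bar> \<le> B" "\<And>x. \<bar>f2 x\<bar> \<le> B"
proof -
  obtain B where B: "\<And>x. \<bar>f x\<bar> \<le> B \<and> \<bar>f1 x\<bar> \<le> B \<and> \<bar>f2 x\<bar> \<le> B"
    using assms by (auto simp: regular_def)
  moreover have "0 \<le> B" using B[of 0] by auto
  ultimately show thesis using that by blast
qed

lemma integrable_bounded_std_normal: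
  fixes g :: "real \<Rightarrow> real"
  assumes [measurable]: "g \<in> borel_measurable borel" and "\<And>x. \<bar>g x\<bar> \<le> B"
  shows "integrable lborel (\<lambda>z. g z * std_normal_density z)"
proof (rule Bochner_Integration.integrable_bound[of _ "\<lambda>z. B * std_normal_density z"])
  show "AE z in lborel. norm (g z * std_normal_density z) \<le> norm (B * std_normal_density z)"
    using assms(2) by (intro always_eventually allI) (auto simp: abs_mult intro!: mult_right_mono order_trans[OF assms(2)])
qed auto

lemma integrable_bounded_std_normal_moment:
  fixes g :: "real \<Rightarrow> real"
  assumes [measurable]: "g \<in> borel_measurable borel" and "\<And>x. \<bar>g x\<bar> \<le> B"
  shows "integrable lborel (\<lambda>z. z * g z * std_normal_density z)"
proof (rule Bochner_Integration.integrable_bound[of _ "\<lambda>z. B * (std_normal_density z * \<bar>z\<bar> ^ 1)"])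
  show "integrable lborel (\<lambda>z. B * (std_normal_density z * \<bar>z\<bar> ^ 1))"
    by (intro integrable_mult_right integrable_std_normal_moment_abs)
  have "\<bar>z\<bar> * \<bar>g z\<bar> \<le> \<bar>B\<bar> * \<bar>z\<bar>" for z
    using assms(2)[of z] mult_left_mono[of "\<bar>g z\<bar>" "\<bar>B\<bar>" "\<bar>z\<bar>"] by (simp add: mult.commute)
  then have "\<bar>z\<bar> * \<bar>g z\<bar> * std_normal_density z \<le> \<bar>B\<bar> * \<bar>z\<bar> * std_normal_density z" for z
    by (intro mult_right_mono) auto
  then show "AE z in lborel. norm (z * g z * std_normal_density z) \<le> norm (B * (std_normal_density z * \<bar>z\<bar> ^ 1))"
    by (intro always_eventually allI) (simp add: abs_mult ac_simps)
qed auto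

lemma std_normal_density_deriv:
  "(std_normal_density has_real_derivative - z * std_normal_density z) (at z)"
  unfolding std_normal_density_def[abs_def]
  by (auto intro!: derivative_eq_intros simp: power2_eq_square field_simps)

text \<open>From \<open>x \<le> 1 + x\<^sup>2 / 2 \<le> exp (x\<^sup>2 / 2)\<close>. This crude
  decay is enough to remove the boundary terms in the integration by parts of
  \<open>stein\<close>.\<close>

lemma std_normal_density_le: "std_normal_density (real (Suc n)) \<le> inverse (real (Suc n))"
proof -
  define x where "x = real (Suc n)"
  have x: "x > 0" by (simp add: x_def)
  have "0 \<le> (x - 1)\<^sup>2" by simp
  then have "x \<le> 1 + x\<^sup>2 / 2" by (simp add: power2_eq_square algebra_simps)
  also have "\<dots> \<le> exp (x\<^sup>2 / 2)" by (rule exp_ge_add_one_self)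
  finally have "inverse (exp (x\<^sup>2 / 2)) \<le> inverse x" using x by (intro le_imp_inverse_le)
  moreover have "1 / sqrt (2 * pi) \<le> 1"
    using pi_gt3 by simp
  ultimately have "(1 / sqrt (2 * pi)) * inverse (exp (x\<^sup>2 / 2)) \<le> 1 * inverse x"
    using x by (intro mult_mono) auto
  then show ?thesis
    by (simp add: std_normal_density_def exp_minus x_def)
qed

text \<open>Gaussian integration by parts, using that the derivative of the density is
  \<open>- z\<close> times the density. It holds although \<open>f1\<close> may have kinks, because
  \<open>f1\<close> is continuous and the kinks are finite in number. For \<open>\<beta> = 0\<close>
  the left side is a first moment and vanishes.\<close>

lemma stein:
  assumes reg: "regular f f1 f2"
  shows "(\<integral>z. z * f1 (\<alpha> + \<beta> * z) * std_normal_density z \<partial>lborel) =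
    \<beta> * (\<integral>z. f2 (\<alpha> + \<beta> * z) * std_normal_density z \<partial>lborel)"
proof (cases "\<beta> = 0")
  case True
  have "(\<integral>z. f1 \<alpha> * (std_normal_density z * z) \<partial>lborel) = 0"
    using normal_moment_nz_1[of 1 0] by (simp add: has_bochner_integral_iff)
  then show ?thesis using True by (simp add: ac_simps)
next
  case False
  note [measurable] = regularD(3-5)[OF reg]
  obtain B where B: "0 \<le> B" "\<And>x. \<bar>f1 x\<bar> \<le> B" "\<And>x. \<bar>f2 x\<bar> \<le> B"
    using regular_bound[OF reg] by metis
  obtain F where F: "finite F" "\<And>x. x \<notin> F \<Longrightarrow> (f1 has_real_derivative f2 x) (at x)"
    using reg by (auto simp: regular_def)
  define g where "g z = f1 (\<alpha> + \<beta> * z) * std_normal_density z" for z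
  define g' where "g' z = \<beta> * (f2 (\<alpha> + \<beta> * z) * std_normal_density z) - z * f1 (\<alpha> + \<beta> * z) * std_normal_density z" for z
  define a where "a n = real (Suc n)" for n
  have i1: "integrable lborel (\<lambda>z. f2 (\<alpha> + \<beta> * z) * std_normal_density z)"
    by (rule integrable_bounded_std_normal) (use B in auto)
  have i2: "integrable lborel (\<lambda>z. z * f1 (\<alpha> + \<beta> * z) * std_normal_density z)"
    by (rule integrable_bounded_std_normal_moment) (use B in auto)
  have int: "integrable lborel g'"
    unfolding g'_def using i1 i2 by auto
  have part: "(LINT z:{- a n..a n}|lborel. g' z) = g (a n) - g (- a n)" for n
  proof -
    have "(g' has_integral (g (a n) - g (- a n))) {- a n..a n}"
    proof (rule fundamental_theorem_of_calculus_interior_strong)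
      \<comment> \<open>Here \<open>\<beta> \<noteq> 0\<close> matters: the affine map is injective,
        so the kinks of \<open>f1\<close> pull back to finitely many points.\<close>
      show "finite ((\<lambda>z. \<alpha> + \<beta> * z) -` F)" using F(1) False by (intro finite_vimageI) (auto simp: inj_on_def)
      show "continuous_on {- a n..a n} g"
        unfolding g_def
        by (intro continuous_at_imp_continuous_on ballI continuous_mult isCont_o2[OF _ regularD(2)[OF reg]]
            DERIV_isCont[OF std_normal_density_deriv] continuous_intros)
      show "(g has_vector_derivative g' z) (at z)" if "z \<in> {- a n<..<a n} - (\<lambda>z. \<alpha> + \<beta> * z) -` F" for z
      proof -
        have "(f1 has_real_derivative f2 (\<alpha> + \<beta> * z)) (at (\<alpha> + \<beta> * z))" using that F by auto
        then have "((\<lambda>z. f1 (\<alpha> + \<beta> * z)) has_real_derivative f2 (\<alpha> + \<beta> * z) * \<beta>) (at z)"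
          by (rule DERIV_chain2) (auto intro!: derivative_eq_intros)
        from DERIV_mult[OF this std_normal_density_deriv[of z]]
        show ?thesis unfolding has_real_derivative_iff_has_vector_derivative[symmetric] g_def g'_def
          by (simp add: algebra_simps)
      qed
    qed (simp add: a_def)
    moreover have "set_integrable lborel {- a n..a n} g'"
      using int unfolding set_integrable_def by (intro integrable_mult_indicator) auto
    ultimately show ?thesis
      using set_borel_integral_eq_integral(2) integral_unique by metis
  qed
  have "(\<lambda>n. LINT z:{- a n..a n}|lborel. g' z) \<longlonglongrightarrow> (\<integral>z. g' z \<partial>lborel)"
    unfolding set_lebesgue_integral_def
  proof (rule integral_dominated_convergence[where w = "\<lambda>z. norm (g' z)"])
    show "AE z in lborel. (\<lambda>n. indicator {- a n..a n} z *\<^sub>R g' z) \<longlonglongrightarrow> g' z"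
    proof (intro always_eventually allI)
      fix z :: real
      obtain N :: nat where N: "\<bar>z\<bar> \<le> real N" using real_arch_simple by blast
      have "\<forall>n\<ge>N. indicator {- a n..a n} z *\<^sub>R g' z = g' z"
        using N by (auto simp: a_def indicator_def)
      then show "(\<lambda>n. indicator {- a n..a n} z *\<^sub>R g' z) \<longlonglongrightarrow> g' z"
        by (intro tendsto_eventually) (auto simp: eventually_sequentially)
    qed
    show "AE z in lborel. norm (indicator {- a n..a n} z *\<^sub>R g' z) \<le> norm (g' z)" for n
      by (auto simp: indicator_def)
  qed (use int in \<open>auto simp: borel_measurable_integrable\<close>)
  moreover have "(\<lambda>n. g (a n) - g (- a n)) \<longlonglongrightarrow> 0"
  proof (rule Lim_null_comparison)
    show "(\<lambda>n. 2 * B * inverse (real (Suc n))) \<longlonglongrightarrow> 0"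
      using tendsto_mult[OF tendsto_const[of "2 * B"] LIMSEQ_inverse_real_of_nat] by simp
    show "\<forall>\<^sub>F n in sequentially. norm (g (a n) - g (- a n)) \<le> 2 * B * inverse (real (Suc n))"
    proof (intro always_eventually allI)
      fix n
      have sym: "std_normal_density (- a n) = std_normal_density (a n)" by (simp add: std_normal_density_def)
      have "norm (g (a n) - g (- a n)) = \<bar>f1 (\<alpha> + \<beta> * a n) - f1 (\<alpha> - \<beta> * a n)\<bar> * std_normal_density (a n)"
        unfolding g_def sym by (simp add: left_diff_distrib[symmetric] abs_mult)
      also have "\<dots> \<le> (2 * B) * inverse (real (Suc n))"
        using B(2)[of "\<alpha> + \<beta> * a n"] B(2)[of "\<alpha> - \<beta> * a n"] B(1) std_normal_density_le[of n]
        by (intro mult_mono) (auto simp: a_def)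
      finally show "norm (g (a n) - g (- a n)) \<le> 2 * B * inverse (real (Suc n))" .
    qed
  qed
  ultimately have "(\<integral>z. g' z \<partial>lborel) = 0"
    unfolding part by (rule LIMSEQ_unique)
  then show ?thesis
    unfolding g'_def using i1 i2 by simp
qed

text \<open>The heat semigroup: the expectation of \<open>g\<close> at
  \<open>y + \<sigma> * W s\<close>. Writing it with a standard normal variable puts the time into a
  scale factor, which can be differentiated under the integral.\<close>

definition gauss_avg :: "real \<Rightarrow> (real \<Rightarrow> real) \<Rightarrow> real \<Rightarrow> real \<Rightarrow> real" where
  "gauss_avg \<sigma> g s y = (\<integral>z. g (y + \<sigma> * sqrt s * z) * std_normal_density z \<partial>lborel)"

lemma gauss_avg_measurable [measurable]:
  assumes [measurable]: "g \<in> borel_measurable borel"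
  shows "(\<lambda>(s, y). gauss_avg \<sigma> g s y) \<in> borel_measurable (borel \<Otimes>\<^sub>M borel)"
  unfolding gauss_avg_def by measurable

lemma abs_gauss_avg_le:
  assumes "g \<in> borel_measurable borel" "\<And>x. \<bar>g x\<bar> \<le> B"
  shows "\<bar>gauss_avg \<sigma> g s y\<bar> \<le> B"
proof -
  note [measurable] = assms(1)
  have "\<bar>gauss_avg \<sigma> g s y\<bar> \<le> (\<integral>z. B * std_normal_density z \<partial>lborel)"
    unfolding gauss_avg_def
  proof (rule integral_abs_bound[THEN order_trans], rule integral_mono)
    show "integrable lborel (\<lambda>z. \<bar>g (y + \<sigma> * sqrt s * z) * std_normal_density z\<bar>)"
      by (intro integrable_abs integrable_bounded_std_normal[of _ B]) (use assms in auto)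
    show "\<bar>g (y + \<sigma> * sqrt s * z) * std_normal_density z\<bar> \<le> B * std_normal_density z" for z
      using assms(2) by (simp add: abs_mult mult_right_mono)
  qed auto
  then show ?thesis by simp
qed

text \<open>The discounted average is differentiated along the drift line. The only term that is not
  of generator form carries a factor \<open>z * f1\<close>, and \<open>stein\<close> converts it
  into the second-derivative term; integrating back over time gives the formula.\<close>

lemma dynkin_gauss:
  fixes q m \<sigma> d y :: real
  assumes reg: "regular f f1 f2" and q: "0 \<le> q" and d: "0 \<le> d"
  defines "Af \<equiv> \<lambda>x. \<sigma>\<^sup>2 / 2 * f2 x + m * f1 x - q * f x"
  shows "exp (- q * d) * gauss_avg \<sigma> f d (y + m * d) - f y =
    (LINT s:{0..d}|lborel. exp (- q * s) * gauss_avg \<sigma> Af s (y + m * s))"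
proof -
  note [measurable] = regularD(3-5)[OF reg]
  obtain B where B: "0 \<le> B" "\<And>x. \<bar>f x\<bar> \<le> B" "\<And>x. \<bar>f1 x\<bar> \<le> B" "\<And>x. \<bar>f2 x\<bar> \<le> B"
    using regular_bound[OF reg] by metis
  have [measurable]: "Af \<in> borel_measurable borel" unfolding Af_def by measurable
  (* the time variable is s = r\<^sup>2, which removes the singularity of the square root at 0 *)
  define R where "R = sqrt d"
  have R: "0 \<le> R" "R\<^sup>2 = d" using d by (auto simp: R_def)
  define K where "K r z = exp (- q * r\<^sup>2) * f (y + m * r\<^sup>2 + \<sigma> * r * z)" for r z
  define K' where "K' r z = exp (- q * r\<^sup>2) * (f1 (y + m * r\<^sup>2 + \<sigma> * r * z) * (2 * m * r + \<sigma> * z)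
      - 2 * q * r * f (y + m * r\<^sup>2 + \<sigma> * r * z))" for r z
  define H where "H s = exp (- q * s) * gauss_avg \<sigma> Af s (y + m * s)" for s
  have ftc: "(\<integral>r. K' r z * indicator {0..R} r \<partial>lborel) = K R z - K 0 z" for z
  proof (rule integral_FTC_Icc_real[OF R(1)])
    fix r :: real
    have "((\<lambda>r. f (y + m * r\<^sup>2 + \<sigma> * r * z)) has_real_derivative f1 (y + m * r\<^sup>2 + \<sigma> * r * z) * (2 * m * r + \<sigma> * z)) (at r)"
      by (rule DERIV_chain2[OF regularD(1)[OF reg]]) (auto intro!: derivative_eq_intros)
    then show "((\<lambda>r. K r z) has_real_derivative K' r z) (at r)"
      unfolding K_def K'_def by (auto intro!: derivative_eq_intros simp: algebra_simps)
    have "isCont f r" for r using regularD(1)[OF reg] DERIV_isCont by blast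
    then show "isCont (\<lambda>r. K' r z) r"
      unfolding K'_def by (intro continuous_intros isCont_o2[OF _ regularD(2)[OF reg]] isCont_o2[of r _ f])
  qed
  \<comment> \<open>The constant that dominates the \<open>r\<close>-derivative by
    \<open>C * (1 + \<bar>z\<bar>)\<close> on the whole interval. A first Gaussian moment is then
    enough for interchanging the two integrals.\<close>
  define C where "C = 2 * \<bar>m\<bar> * R * B + 2 * q * R * B + \<bar>\<sigma>\<bar> * B"
  have C: "0 \<le> C" unfolding C_def using B R q by auto
  have bound: "\<bar>K' r z * indicator {0..R} r\<bar> \<le> C * (1 + \<bar>z\<bar>) * indicator {0..R} r" for r z
  proof (cases "r \<in> {0..R}")
    case True
    then have r: "0 \<le> r" "r \<le> R" by auto
    let ?x = "y + m * r\<^sup>2 + \<sigma> * r * z"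
    have "\<bar>f1 ?x * (2 * m * r + \<sigma> * z) - 2 * q * r * f ?x\<bar> \<le> \<bar>f1 ?x * (2 * m * r + \<sigma> * z)\<bar> + \<bar>2 * q * r * f ?x\<bar>"
      by (rule abs_triangle_ineq4)
    also have "\<dots> = \<bar>f1 ?x\<bar> * \<bar>2 * m * r + \<sigma> * z\<bar> + 2 * q * r * \<bar>f ?x\<bar>"
      using q r by (simp add: abs_mult)
    also have "\<dots> \<le> B * (2 * \<bar>m\<bar> * R + \<bar>\<sigma>\<bar> * \<bar>z\<bar>) + 2 * q * R * B"
    proof (intro add_mono mult_mono)
      have "\<bar>2 * m * r + \<sigma> * z\<bar> \<le> 2 * \<bar>m\<bar> * r + \<bar>\<sigma>\<bar> * \<bar>z\<bar>"
        using r abs_triangle_ineq[of "2 * m * r" "\<sigma> * z"] by (simp add: abs_mult)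
      also have "\<dots> \<le> 2 * \<bar>m\<bar> * R + \<bar>\<sigma>\<bar> * \<bar>z\<bar>" using r by (intro add_mono mult_left_mono) auto
      finally show "\<bar>2 * m * r + \<sigma> * z\<bar> \<le> 2 * \<bar>m\<bar> * R + \<bar>\<sigma>\<bar> * \<bar>z\<bar>" .
    qed (use B q r in auto)
    also have "\<dots> \<le> C * (1 + \<bar>z\<bar>)"
    proof -
      have "0 \<le> (2 * \<bar>m\<bar> * R * B + 2 * q * R * B) * \<bar>z\<bar> + \<bar>\<sigma>\<bar> * B" using B R q by auto
      then show ?thesis unfolding C_def by (simp add: algebra_simps)
    qed
    finally have "\<bar>f1 ?x * (2 * m * r + \<sigma> * z) - 2 * q * r * f ?x\<bar> \<le> C * (1 + \<bar>z\<bar>)" .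
    moreover have "exp (- q * r\<^sup>2) \<le> 1" using q by simp
    ultimately have "exp (- q * r\<^sup>2) * \<bar>f1 ?x * (2 * m * r + \<sigma> * z) - 2 * q * r * f ?x\<bar> \<le> 1 * (C * (1 + \<bar>z\<bar>))"
      by (intro mult_mono) auto
    then show ?thesis using True by (simp add: K'_def abs_mult)
  qed simp
  have int2: "integrable (lborel \<Otimes>\<^sub>M lborel) (\<lambda>(r, z). K' r z * indicator {0..R} r * std_normal_density z)"
  proof (rule Bochner_Integration.integrable_bound)
    have iz: "integrable lborel (\<lambda>z. (1 + \<bar>z\<bar>) * std_normal_density z)"
    proof -
      have "(\<lambda>z. (1 + \<bar>z\<bar>) * std_normal_density z) = (\<lambda>z. std_normal_density z + std_normal_density z * \<bar>z\<bar> ^ 1)"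
        by (auto simp: algebra_simps)
      then show ?thesis
        by (simp only:) (intro Bochner_Integration.integrable_add integrable_normal_density integrable_std_normal_moment_abs zero_less_one)
    qed
    show "integrable (lborel \<Otimes>\<^sub>M lborel) (\<lambda>(r, z). C * indicator {0..R} r * ((1 + \<bar>z\<bar>) * std_normal_density z))"
    proof (rule lborel_pair.Fubini_integrable)
      show "AE r in lborel. integrable lborel (\<lambda>z. case (r, z) of (r, z) \<Rightarrow> C * indicator {0..R} r * ((1 + \<bar>z\<bar>) * std_normal_density z))"
        using iz by simp
      have "(\<integral>z. norm (case (r, z) of (r, z) \<Rightarrow> C * indicator {0..R} r * ((1 + \<bar>z\<bar>) * std_normal_density z)) \<partial>lborel)
         = indicator {0..R} r * (C * (\<integral>z. (1 + \<bar>z\<bar>) * std_normal_density z \<partial>lborel))" for r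
        using C by (simp add: abs_mult)
      moreover have "integrable lborel (indicat_real {0..R})"
        by (intro integrable_real_indicator) (auto simp: emeasure_lborel_Icc_eq)
      ultimately show "integrable lborel (\<lambda>r. \<integral>z. norm (case (r, z) of (r, z) \<Rightarrow> C * indicator {0..R} r * ((1 + \<bar>z\<bar>) * std_normal_density z)) \<partial>lborel)"
        by simp
    qed measurable
    show "AE p in lborel \<Otimes>\<^sub>M lborel. norm (case p of (r, z) \<Rightarrow> K' r z * indicator {0..R} r * std_normal_density z)
       \<le> norm (case p of (r, z) \<Rightarrow> C * indicator {0..R} r * ((1 + \<bar>z\<bar>) * std_normal_density z))"
    proof (intro always_eventually allI, clarify)
      fix r z :: real
      have "\<bar>K' r z * indicator {0..R} r\<bar> * std_normal_density z \<le> C * (1 + \<bar>z\<bar>) * indicator {0..R} r * std_normal_density z"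
        by (intro mult_right_mono bound) auto
      then show "norm (K' r z * indicator {0..R} r * std_normal_density z)
       \<le> norm (C * indicator {0..R} r * ((1 + \<bar>z\<bar>) * std_normal_density z))"
        using C by (simp add: abs_mult ac_simps)
    qed
    show "(\<lambda>(r, z). K' r z * indicator {0..R} r * std_normal_density z) \<in> borel_measurable (lborel \<Otimes>\<^sub>M lborel)"
      unfolding K'_def by measurable
  qed
  \<comment> \<open>\<open>stein\<close> with slope \<open>\<sigma> * r\<close> turns
    \<open>\<sigma> * z * f1\<close> into \<open>\<sigma>\<^sup>2 * r * f2\<close>; now every term
    has the factor \<open>2 * r\<close>, the Jacobian of the time substitution.\<close>
  have inner: "(\<integral>z. K' r z * indicator {0..R} r * std_normal_density z \<partial>lborel) = H (r\<^sup>2) * (2 * r) * indicator {0..R} r" for r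
  proof (cases "r \<in> {0..R}")
    case True
    then have r: "sqrt (r\<^sup>2) = r" by simp
    let ?\<alpha> = "y + m * r\<^sup>2" and ?\<beta> = "\<sigma> * r"
    have [simp]: "integrable lborel (\<lambda>z. f1 (?\<alpha> + ?\<beta> * z) * std_normal_density z)"
      "integrable lborel (\<lambda>z. f (?\<alpha> + ?\<beta> * z) * std_normal_density z)"
      "integrable lborel (\<lambda>z. f2 (?\<alpha> + ?\<beta> * z) * std_normal_density z)"
      "integrable lborel (\<lambda>z. z * f1 (?\<alpha> + ?\<beta> * z) * std_normal_density z)"
      by (rule integrable_bounded_std_normal integrable_bounded_std_normal_moment; use B in auto)+
    have "(\<integral>z. K' r z * indicator {0..R} r * std_normal_density z \<partial>lborel) =
      (\<integral>z. exp (- q * r\<^sup>2) * (2 * m * r * (f1 (?\<alpha> + ?\<beta> * z) * std_normal_density z)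
        + \<sigma> * (z * f1 (?\<alpha> + ?\<beta> * z) * std_normal_density z)
        - 2 * q * r * (f (?\<alpha> + ?\<beta> * z) * std_normal_density z)) \<partial>lborel)"
      using True by (intro Bochner_Integration.integral_cong) (auto simp: K'_def algebra_simps)
    also have "\<dots> = exp (- q * r\<^sup>2) * (2 * m * r * (\<integral>z. f1 (?\<alpha> + ?\<beta> * z) * std_normal_density z \<partial>lborel)
        + \<sigma> * (\<integral>z. z * f1 (?\<alpha> + ?\<beta> * z) * std_normal_density z \<partial>lborel)
        - 2 * q * r * (\<integral>z. f (?\<alpha> + ?\<beta> * z) * std_normal_density z \<partial>lborel))"
      by simp
    also have "\<dots> = exp (- q * r\<^sup>2) * (2 * r) * (\<sigma>\<^sup>2 / 2 * (\<integral>z. f2 (?\<alpha> + ?\<beta> * z) * std_normal_density z \<partial>lborel)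
        + m * (\<integral>z. f1 (?\<alpha> + ?\<beta> * z) * std_normal_density z \<partial>lborel)
        - q * (\<integral>z. f (?\<alpha> + ?\<beta> * z) * std_normal_density z \<partial>lborel))"
      unfolding stein[OF reg] by (simp add: algebra_simps power2_eq_square)
    also have "\<dots> = exp (- q * r\<^sup>2) * (2 * r) * (\<integral>z. \<sigma>\<^sup>2 / 2 * (f2 (?\<alpha> + ?\<beta> * z) * std_normal_density z)
        + m * (f1 (?\<alpha> + ?\<beta> * z) * std_normal_density z) - q * (f (?\<alpha> + ?\<beta> * z) * std_normal_density z) \<partial>lborel)"
      by simp
    also have "\<dots> = H (r\<^sup>2) * (2 * r) * indicator {0..R} r"
      using True unfolding H_def gauss_avg_def Af_def r by (simp add: algebra_simps)
    finally show ?thesis .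
  qed simp
  have BA: "\<bar>Af x\<bar> \<le> \<sigma>\<^sup>2 / 2 * B + \<bar>m\<bar> * B + q * B" for x
  proof -
    have "\<bar>Af x\<bar> \<le> \<bar>\<sigma>\<^sup>2 / 2 * f2 x\<bar> + \<bar>m * f1 x\<bar> + \<bar>q * f x\<bar>" unfolding Af_def by linarith
    also have "\<dots> \<le> \<sigma>\<^sup>2 / 2 * B + \<bar>m\<bar> * B + q * B"
      using B q by (auto simp: abs_mult intro!: add_mono mult_left_mono)
    finally show ?thesis .
  qed
  have Hint: "set_integrable lborel {0\<^sup>2..R\<^sup>2} H"
    unfolding set_integrable_def
  proof (rule Bochner_Integration.integrable_bound)
    show "integrable lborel (\<lambda>s. indicator {0\<^sup>2..R\<^sup>2} s *\<^sub>R (\<sigma>\<^sup>2 / 2 * B + \<bar>m\<bar> * B + q * B))" by simp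
    show "(\<lambda>s. indicat_real {0\<^sup>2..R\<^sup>2} s *\<^sub>R H s) \<in> borel_measurable lborel" unfolding H_def by measurable
    show "AE s in lborel. norm (indicat_real {0\<^sup>2..R\<^sup>2} s *\<^sub>R H s) \<le> norm (indicat_real {0\<^sup>2..R\<^sup>2} s *\<^sub>R (\<sigma>\<^sup>2 / 2 * B + \<bar>m\<bar> * B + q * B))"
    proof (intro always_eventually allI)
      fix s :: real
      have "\<bar>H s\<bar> \<le> 1 * (\<sigma>\<^sup>2 / 2 * B + \<bar>m\<bar> * B + q * B)" if "0 \<le> s"
        unfolding H_def abs_mult using q that abs_gauss_avg_le[OF _ BA] by (intro mult_mono) auto
      then show "norm (indicat_real {0\<^sup>2..R\<^sup>2} s *\<^sub>R H s) \<le> norm (indicat_real {0\<^sup>2..R\<^sup>2} s *\<^sub>R (\<sigma>\<^sup>2 / 2 * B + \<bar>m\<bar> * B + q * B))"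
        by (auto simp: indicator_def)
    qed
  qed
  have if1: "integrable lborel (\<lambda>z. K r z * std_normal_density z)" for r
    unfolding K_def by (rule integrable_bounded_std_normal[of _ B])
      (use B q in \<open>auto simp: abs_mult intro: order_trans[OF mult_left_le_one_le]\<close>)
  have "exp (- q * d) * gauss_avg \<sigma> f d (y + m * d) - f y = (\<integral>z. K R z * std_normal_density z \<partial>lborel) - (\<integral>z. K 0 z * std_normal_density z \<partial>lborel)"
    unfolding K_def gauss_avg_def R(2) by (simp add: R_def mult.assoc)
  also have "\<dots> = (\<integral>z. (K R z - K 0 z) * std_normal_density z \<partial>lborel)"
    using if1 by (simp add: left_diff_distrib)
  also have "\<dots> = (\<integral>z. (\<integral>r. K' r z * indicator {0..R} r * std_normal_density z \<partial>lborel) \<partial>lborel)"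
    unfolding ftc[symmetric] by simp
  also have "\<dots> = (\<integral>r. (\<integral>z. K' r z * indicator {0..R} r * std_normal_density z \<partial>lborel) \<partial>lborel)"
    using lborel_pair.Fubini_integral[OF int2] by simp
  also have "\<dots> = (\<integral>r. H (r\<^sup>2) * (2 * r) * indicator {0..R} r \<partial>lborel)"
    unfolding inner ..
  also have "\<dots> = (\<integral>s. H s * indicator {0\<^sup>2..R\<^sup>2} s \<partial>lborel)"
    by (rule integral_substitution(2)[where g = "\<lambda>r. r\<^sup>2" and a = 0 and b = R, OF Hint, symmetric])
       (auto intro!: derivative_eq_intros continuous_intros R)
  also have "\<dots> = (LINT s:{0..d}|lborel. H s)"
    unfolding R(2) set_lebesgue_integral_def by (simp add: mult.commute)
  finally show ?thesis unfolding H_def .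
qed

subsection \<open>Brownian increments and the completed filtration\<close>

text \<open>The definition of Brownian motion gives independence only of consecutive increments
  along one finite sequence of times. The observation times are sorted together with 0 and
  \<open>t\<close>, and \<open>t + u\<close> is appended; the past values are then partial sums of
  the earlier increments, and the last increment is the one after \<open>t\<close>.\<close>

lemma (in prob_space) increment_indep_finite_past:
  assumes BM: "std_brownian_motion M W" and t: "0 \<le> t" "0 < u"
    and J: "finite J" "J \<subseteq> {0..t}" and Bs: "\<And>j. j \<in> J \<Longrightarrow> Bs j \<in> sets borel" and B: "B \<in> sets borel"
  shows "prob ({\<omega>\<in>space M. \<forall>j\<in>J. W j \<omega> \<in> Bs j} \<inter> {\<omega>\<in>space M. W (t + u) \<omega> - W t \<omega> \<in> B}) =
    prob {\<omega>\<in>space M. \<forall>j\<in>J. W j \<omega> \<in> Bs j} * prob {\<omega>\<in>space M. W (t + u) \<omega> - W t \<omega> \<in> B}"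
proof -
  define K where "K = insert 0 (insert t J)"
  define xs where "xs = sorted_list_of_set K"
  define n where "n = length xs"
  \<comment> \<open>Index \<open>n\<close> stands for \<open>t + u\<close>. Hence
    \<open>D (n - 1)\<close> is the increment from \<open>t\<close> to \<open>t + u\<close>, and the
    indices below \<open>n - 1\<close> see only the past.\<close>
  define ts where "ts i = (if i < n then xs ! i else t + u)" for i
  define D where "D i \<omega> = W (ts (Suc i)) \<omega> - W (ts i) \<omega>" for i \<omega>
  have K: "finite K" "K \<noteq> {}" "K \<subseteq> {0..t}" "0 \<in> K" "t \<in> K" using J t by (auto simp: K_def)
  have xs: "set xs = K" "sorted_wrt (<) xs" using K by (auto simp: xs_def strict_sorted_list_of_set)
  have n: "0 < n" using K xs(1) by (auto simp: n_def)
  have sorted: "xs ! i < xs ! j" if "i < j" "j < n" for i j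
    using sorted_wrt_nth_less[OF xs(2)] that by (simp add: n_def)
  have idx: "\<exists>i<n. xs ! i = k" if "k \<in> K" for k
    using that xs(1) by (auto simp: n_def in_set_conv_nth)
  have ts0: "ts 0 = 0"
  proof -
    obtain i where i: "i < n" "xs ! i = 0" using idx K(4) by blast
    have "xs ! 0 \<in> K" using n xs(1) by (auto simp: n_def)
    then have "0 \<le> xs ! 0" using K(3) by auto
    then show ?thesis using sorted[of 0 i] i n by (cases "i = 0") (auto simp: ts_def)
  qed
  have tsl: "ts (n - 1) = t"
  proof -
    obtain i where i: "i < n" "xs ! i = t" using idx K(5) by blast
    have "xs ! (n - 1) \<in> K" using n xs(1) by (auto simp: n_def)
    then have "xs ! (n - 1) \<le> t" using K(3) by auto
    moreover have "i < n - 1" if "i \<noteq> n - 1" using i that by linarith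
    ultimately show ?thesis using sorted[of i "n - 1"] i n by (cases "i = n - 1") (auto simp: ts_def)
  qed
  have "ts i < ts (Suc i)" if "i < n" for i
  proof (cases "Suc i < n")
    case False
    then have "i = n - 1" using that by auto
    then show ?thesis using tsl t n by (simp add: ts_def)
  qed (use sorted[of i "Suc i"] in \<open>simp add: ts_def\<close>)
  then have iv: "indep_vars (\<lambda>_. borel) D {..<n}"
    using BM ts0 unfolding std_brownian_motion_def D_def by auto
  have ind: "indep_var (PiM {..<n - 1} (\<lambda>_. borel)) (\<lambda>\<omega>. restrict (\<lambda>i. D i \<omega>) {..<n - 1})
      (PiM {n - 1} (\<lambda>_. borel)) (\<lambda>\<omega>. restrict (\<lambda>i. D i \<omega>) {n - 1})"
    by (rule indep_var_restrict[OF iv]) (use n in auto)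
  have "\<forall>j\<in>J. \<exists>k<n. xs ! k = j" using idx by (auto simp: K_def)
  then obtain k where k: "\<And>j. j \<in> J \<Longrightarrow> k j < n \<and> xs ! k j = j" by metis
  have W0: "W 0 \<omega> = 0" if "\<omega> \<in> space M" for \<omega> using BM that by (auto simp: std_brownian_motion_def)
  have Wj: "W j \<omega> = (\<Sum>i<k j. D i \<omega>)" if "j \<in> J" "\<omega> \<in> space M" for j \<omega>
  proof -
    have "(\<Sum>i<k j. D i \<omega>) = W (ts (k j)) \<omega> - W (ts 0) \<omega>"
      unfolding D_def by (rule sum_lessThan_telescope)
    then show ?thesis using k[OF that(1)] W0[OF that(2)] ts0 by (simp add: ts_def)
  qed
  \<comment> \<open>The past event in terms of increments. Since \<open>k j < n\<close>, each
    partial sum uses only indices below \<open>n - 1\<close>.\<close>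
  define E where "E = {f \<in> space (PiM {..<n - 1} (\<lambda>_. borel)). \<forall>j\<in>J. (\<Sum>i<k j. f i) \<in> Bs j}"
  define E' where "E' = {f \<in> space (PiM {n - 1} (\<lambda>_. borel :: real measure)). f (n - 1) \<in> B}"
  have "E \<in> sets (PiM {..<n - 1} (\<lambda>_. borel))"
    unfolding E_def
  proof (intro sets.sets_Collect_finite_All J(1))
    fix j assume j: "j \<in> J"
    have [measurable]: "(\<lambda>f. \<Sum>i<k j. f i) \<in> borel_measurable (PiM {..<n - 1} (\<lambda>_. borel :: real measure))"
      using k[OF j] by (intro borel_measurable_sum measurable_component_singleton) auto
    show "{f \<in> space (PiM {..<n - 1} (\<lambda>_. borel)). (\<Sum>i<k j. f i) \<in> Bs j} \<in> sets (PiM {..<n - 1} (\<lambda>_. borel))"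
      using Bs[OF j] by measurable
  qed
  moreover have "E' \<in> sets (PiM {n - 1} (\<lambda>_. borel))"
    unfolding E'_def using B by measurable
  ultimately have eq: "prob ((\<lambda>\<omega>. (restrict (\<lambda>i. D i \<omega>) {..<n - 1}, restrict (\<lambda>i. D i \<omega>) {n - 1})) -` (E \<times> E') \<inter> space M) =
     prob ((\<lambda>\<omega>. restrict (\<lambda>i. D i \<omega>) {..<n - 1}) -` E \<inter> space M) * prob ((\<lambda>\<omega>. restrict (\<lambda>i. D i \<omega>) {n - 1}) -` E' \<inter> space M)"
    by (rule indep_varD[OF ind])
  have sumr: "(\<Sum>i<k j. restrict (\<lambda>i. D i \<omega>) {..<n - 1} i) = (\<Sum>i<k j. D i \<omega>)" if "j \<in> J" for j \<omega>
    using k[OF that] by (intro sum.cong) auto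
  have e1: "(\<lambda>\<omega>. restrict (\<lambda>i. D i \<omega>) {..<n - 1}) -` E \<inter> space M = {\<omega>\<in>space M. \<forall>j\<in>J. W j \<omega> \<in> Bs j}"
    unfolding E_def using Wj sumr by (auto simp: space_PiM)
  have "D (n - 1) \<omega> = W (t + u) \<omega> - W t \<omega>" for \<omega>
    using tsl n by (simp add: D_def ts_def)
  then have e2: "(\<lambda>\<omega>. restrict (\<lambda>i. D i \<omega>) {n - 1}) -` E' \<inter> space M = {\<omega>\<in>space M. W (t + u) \<omega> - W t \<omega> \<in> B}"
    unfolding E'_def by (auto simp: space_PiM)
  have e3: "(\<lambda>\<omega>. (restrict (\<lambda>i. D i \<omega>) {..<n - 1}, restrict (\<lambda>i. D i \<omega>) {n - 1})) -` (E \<times> E') \<inter> space M =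
    {\<omega>\<in>space M. \<forall>j\<in>J. W j \<omega> \<in> Bs j} \<inter> {\<omega>\<in>space M. W (t + u) \<omega> - W t \<omega> \<in> B}"
    using e1 e2 by blast
  show ?thesis using eq unfolding e1 e2 e3 .
qed

text \<open>Finite-dimensional cylinders are stable under intersection and generate the past, so
  independence extends from them to the generated sigma-algebra. An affine change of variable passes
  from the surplus to the Brownian motion.\<close>

lemma (in prob_space) increment_indep_past:
  assumes BM: "std_brownian_motion M W" and t: "0 \<le> t" "0 < u"
    and A: "A \<in> gen_sigma M \<mu> \<sigma> W x t" and B: "B \<in> sets borel"
  shows "prob (A \<inter> {\<omega>\<in>space M. W (t + u) \<omega> - W t \<omega> \<in> B}) = prob A * prob {\<omega>\<in>space M. W (t + u) \<omega> - W t \<omega> \<in> B}"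
proof -
  have [measurable]: "W s \<in> borel_measurable M" for s using BM by (auto simp: std_brownian_motion_def)
  define P where "P = {{\<omega>\<in>space M. \<forall>j\<in>J. W j \<omega> \<in> Bs j} | J Bs. finite J \<and> J \<subseteq> {0..t} \<and> (\<forall>j\<in>J. Bs j \<in> sets borel)}"
  define Q where "Q = {{\<omega>\<in>space M. W (t + u) \<omega> - W t \<omega> \<in> B} | B. B \<in> sets borel}"
  have "indep_set P Q"
  proof (rule indep_setI)
    show "P \<subseteq> events"
    proof
      fix a assume "a \<in> P"
      then obtain J Bs where a: "finite J" "\<forall>j\<in>J. Bs j \<in> sets borel" "a = {\<omega>\<in>space M. \<forall>j\<in>J. W j \<omega> \<in> Bs j}"
        unfolding P_def by auto
      show "a \<in> events" unfolding a(3) using a(1,2) by (intro sets.sets_Collect_finite_All) (auto intro: measurable_sets_Collect)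
    qed
    show "Q \<subseteq> events" unfolding Q_def by auto
    show "prob (a \<inter> b) = prob a * prob b" if "a \<in> P" "b \<in> Q" for a b
      using that increment_indep_finite_past[OF BM t] unfolding P_def Q_def by auto
  qed
  moreover have "Int_stable P"
  proof (rule Int_stableI)
    fix a b assume "a \<in> P" "b \<in> P"
    then obtain J Bs J' Bs' where
      a: "finite J" "J \<subseteq> {0..t}" "\<forall>j\<in>J. Bs j \<in> sets borel" "a = {\<omega>\<in>space M. \<forall>j\<in>J. W j \<omega> \<in> Bs j}" and
      b: "finite J'" "J' \<subseteq> {0..t}" "\<forall>j\<in>J'. Bs' j \<in> sets borel" "b = {\<omega>\<in>space M. \<forall>j\<in>J'. W j \<omega> \<in> Bs' j}"
      unfolding P_def by auto
    define Cs where "Cs j = (if j \<in> J then Bs j else UNIV) \<inter> (if j \<in> J' then Bs' j else UNIV)" for j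
    have "a \<inter> b = {\<omega>\<in>space M. \<forall>j\<in>J \<union> J'. W j \<omega> \<in> Cs j}"
      unfolding a(4) b(4) Cs_def by auto
    moreover have "\<forall>j\<in>J \<union> J'. Cs j \<in> sets borel" using a(3) b(3) by (auto simp: Cs_def)
    ultimately show "a \<inter> b \<in> P" using a(1,2) b(1,2) unfolding P_def by blast
  qed
  moreover have "Int_stable Q"
  proof (rule Int_stableI)
    fix a b assume "a \<in> Q" "b \<in> Q"
    then obtain A B where ab: "A \<in> sets borel" "B \<in> sets borel"
      "a = {\<omega>\<in>space M. W (t + u) \<omega> - W t \<omega> \<in> A}" "b = {\<omega>\<in>space M. W (t + u) \<omega> - W t \<omega> \<in> B}"
      unfolding Q_def by auto
    have "a \<inter> b = {\<omega>\<in>space M. W (t + u) \<omega> - W t \<omega> \<in> A \<inter> B}" unfolding ab by auto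
    then show "a \<inter> b \<in> Q" using ab(1,2) unfolding Q_def by blast
  qed
  ultimately have ind: "indep_set (sigma_sets (space M) P) (sigma_sets (space M) Q)"
    by (rule indep_set_sigma_sets)
  have "A \<in> sigma_sets (space M) P"
    using A unfolding gen_sigma_def
  proof (rule set_mp[OF sigma_sets_mono, rotated], safe)
    fix s :: real and B :: "real set" assume s: "0 \<le> s" "s \<le> t" "B \<in> sets borel"
    have "(\<lambda>w. x + \<mu> * s + \<sigma> * w) -` B \<inter> space borel \<in> sets borel"
      using s(3) by (intro measurable_sets[OF _ s(3)]) simp
    moreover have "surplus \<mu> \<sigma> W x s -` B \<inter> space M = {\<omega>\<in>space M. \<forall>j\<in>{s}. W j \<omega> \<in> (\<lambda>w. x + \<mu> * s + \<sigma> * w) -` B}"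
      by (auto simp: surplus_def)
    ultimately have "surplus \<mu> \<sigma> W x s -` B \<inter> space M \<in> P"
      unfolding P_def using s by (auto intro!: exI[of _ "{s}"] exI[of _ "\<lambda>_. (\<lambda>w. x + \<mu> * s + \<sigma> * w) -` B"])
    then show "surplus \<mu> \<sigma> W x s -` B \<inter> space M \<in> sigma_sets (space M) P" by auto
  qed
  moreover have "{\<omega>\<in>space M. W (t + u) \<omega> - W t \<omega> \<in> B} \<in> sigma_sets (space M) Q"
    using B unfolding Q_def by (intro sigma_sets.Basic) auto
  ultimately show ?thesis
    by (rule indep_setD[OF ind])
qed

lemma gen_sigma_mono: "s \<le> t \<Longrightarrow> gen_sigma M \<mu> \<sigma> W x s \<subseteq> gen_sigma M \<mu> \<sigma> W x t"
  unfolding gen_sigma_def by (rule sigma_sets_mono') (auto intro: order_trans)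

lemma gen_sigma_sub_filt: "gen_sigma M \<mu> \<sigma> W x t \<subseteq> filt M \<mu> \<sigma> W x t"
proof
  fix A assume A: "A \<in> gen_sigma M \<mu> \<sigma> W x t"
  then have "A \<subseteq> space M" unfolding gen_sigma_def by (rule sigma_sets_into_sp[rotated]) auto
  then show "A \<in> filt M \<mu> \<sigma> W x t" using A unfolding filt_def by (intro CollectI conjI bexI[of _ A] bexI[of _ "{}"]) auto
qed

lemma gen_sigma_sigma_algebra: "sigma_algebra (space M) (gen_sigma M \<mu> \<sigma> W x t)"
  unfolding gen_sigma_def by (intro sigma_algebra_sigma_sets) auto

text \<open>A set and its approximation have the same symmetric difference as their complements, and
  countably many exceptional null sets have a null union.\<close>

lemma filt_sigma_algebra: "sigma_algebra (space M) (filt M \<mu> \<sigma> W x t)"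
  unfolding sigma_algebra_iff2
proof (intro conjI ballI allI impI)
  interpret G: sigma_algebra "space M" "gen_sigma M \<mu> \<sigma> W x t" by (rule gen_sigma_sigma_algebra)
  show "filt M \<mu> \<sigma> W x t \<subseteq> Pow (space M)" by (auto simp: filt_def)
  show "{} \<in> filt M \<mu> \<sigma> W x t" using G.empty_sets gen_sigma_sub_filt by blast
  fix A assume "A \<in> filt M \<mu> \<sigma> W x t"
  then obtain B N where "A \<subseteq> space M" "B \<in> gen_sigma M \<mu> \<sigma> W x t" "N \<in> null_sets M" "(A - B) \<union> (B - A) \<subseteq> N"
    by (auto simp: filt_def)
  then show "space M - A \<in> filt M \<mu> \<sigma> W x t"
    unfolding filt_def by (intro CollectI conjI bexI[of _ "space M - B"] bexI[of _ N]) auto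
next
  interpret G: sigma_algebra "space M" "gen_sigma M \<mu> \<sigma> W x t" by (rule gen_sigma_sigma_algebra)
  fix A :: "nat \<Rightarrow> _" assume A: "range A \<subseteq> filt M \<mu> \<sigma> W x t"
  then have Ai: "A i \<in> filt M \<mu> \<sigma> W x t" for i by auto
  have "\<forall>i. \<exists>B N. B \<in> gen_sigma M \<mu> \<sigma> W x t \<and> N \<in> null_sets M \<and> (A i - B) \<union> (B - A i) \<subseteq> N"
    using Ai unfolding filt_def mem_Collect_eq Bex_def by simp
  then obtain B N where BN: "\<And>i. B i \<in> gen_sigma M \<mu> \<sigma> W x t" "\<And>i. N i \<in> null_sets M" "\<And>i. (A i - B i) \<union> (B i - A i) \<subseteq> N i"
    by metis
  have "(\<Union>i. B i) \<in> gen_sigma M \<mu> \<sigma> W x t" "(\<Union>i. N i) \<in> null_sets M" using BN by auto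
  moreover have "((\<Union>i. A i) - (\<Union>i. B i)) \<union> ((\<Union>i. B i) - (\<Union>i. A i)) \<subseteq> (\<Union>i. N i)" using BN(3) by blast
  moreover have "(\<Union>i. A i) \<subseteq> space M" using Ai by (auto simp: filt_def)
  ultimately show "(\<Union>i. A i) \<in> filt M \<mu> \<sigma> W x t"
    unfolding filt_def by (intro CollectI conjI bexI[of _ "\<Union>i. B i"] bexI[of _ "\<Union>i. N i"])
qed

text \<open>What is kept of the Brownian motion: an abstract filtration contained in the measurable
  sets and independent of later increments. It will be instantiated with the completed measure,
  where the completed filtration qualifies.\<close>

locale bm_filtration = prob_space M for M :: "'a measure" +
  fixes W :: "real \<Rightarrow> 'a \<Rightarrow> real" and F :: "real \<Rightarrow> 'a set set"
  assumes F_sigma: "\<And>t. sigma_algebra (space M) (F t)"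
    and F_sub: "\<And>t. F t \<subseteq> sets M"
    and F_mono: "\<And>s t. s \<le> t \<Longrightarrow> F s \<subseteq> F t"
    and W_adapted: "\<And>t B. 0 \<le> t \<Longrightarrow> B \<in> sets borel \<Longrightarrow> W t -` B \<inter> space M \<in> F t"
    and W_cont: "\<And>\<omega>. \<omega> \<in> space M \<Longrightarrow> continuous_on {0..} (\<lambda>t. W t \<omega>)"
    and W_zero: "\<And>\<omega>. \<omega> \<in> space M \<Longrightarrow> W 0 \<omega> = 0"
    and increment_law: "\<And>t u. 0 \<le> t \<Longrightarrow> 0 < u \<Longrightarrow>
      distr M borel (\<lambda>\<omega>. W (t + u) \<omega> - W t \<omega>) = density lborel (\<lambda>y. ennreal (normal_density 0 (sqrt u) y))"
    and increment_indep: "\<And>t u A B. 0 \<le> t \<Longrightarrow> 0 < u \<Longrightarrow> A \<in> F t \<Longrightarrow> B \<in> sets borel \<Longrightarrow>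
      prob (A \<inter> {\<omega>\<in>space M. W (t + u) \<omega> - W t \<omega> \<in> B}) = prob A * prob {\<omega>\<in>space M. W (t + u) \<omega> - W t \<omega> \<in> B}"

text \<open>In the completion of the measure the sets of the completed filtration are measurable, and the
  payoff, a lower integral, is unchanged.\<close>

lemma bm_filtration_completion:
  assumes BM: "std_brownian_motion M W" and \<sigma>: "\<sigma> \<noteq> 0"
  shows "bm_filtration (completion M) W (filt M \<mu> \<sigma> W x)"
proof -
  interpret prob_space M using BM by (simp add: std_brownian_motion_def)
  have [measurable]: "W s \<in> borel_measurable M" for s using BM by (auto simp: std_brownian_motion_def)
  have paths: "\<forall>\<omega>\<in>space M. W 0 \<omega> = 0 \<and> continuous_on {0..} (\<lambda>t. W t \<omega>)"
    and laws: "\<forall>s t. 0 \<le> s \<longrightarrow> s < t \<longrightarrow> distributed M lborel (\<lambda>\<omega>. W t \<omega> - W s \<omega>)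
      (\<lambda>y. ennreal (normal_density 0 (sqrt (t - s)) y))"
    using BM unfolding std_brownian_motion_def by blast+
  have gen_sub: "gen_sigma M \<mu> \<sigma> W x t \<subseteq> sets M" for t
    unfolding gen_sigma_def by (intro sets.sigma_sets_subset) (auto simp: surplus_def[abs_def])
  \<comment> \<open>Almost sure equality with a set of the uncompleted past carries measurability
    and probabilities over, hence also independence.\<close>
  have filtE: "\<exists>B\<in>gen_sigma M \<mu> \<sigma> W x t. A \<in> sets (completion M) \<and> (AE \<omega> in completion M. \<omega> \<in> A \<longleftrightarrow> \<omega> \<in> B)"
    if A: "A \<in> filt M \<mu> \<sigma> W x t" for A t
  proof -
    obtain B N where B: "B \<in> gen_sigma M \<mu> \<sigma> W x t" "N \<in> null_sets M" "(A - B) \<union> (B - A) \<subseteq> N" "A \<subseteq> space M"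
      using A unfolding filt_def by auto
    have A_eq: "A = (B - N) \<union> (A \<inter> N)" using B(3) by auto
    have "B - N \<in> sets M" using B(1) gen_sub[of t] null_setsD2[OF B(2)] by (intro sets.Diff) auto
    then have "A \<in> sets (completion M)"
      by (rule sets_completionI[OF A_eq Int_lower2 B(2)])
    moreover have "AE \<omega> in completion M. \<omega> \<notin> N"
      using AE_not_in[OF B(2)] by (rule AE_completion)
    then have "AE \<omega> in completion M. \<omega> \<in> A \<longleftrightarrow> \<omega> \<in> B" using B(3) by (auto elim!: eventually_mono)
    ultimately show ?thesis using B(1) by blast
  qed
  show ?thesis
  proof (intro bm_filtration.intro bm_filtration_axioms.intro)
    show "prob_space (completion M)" by (rule prob_spaceI) (simp add: emeasure_space_1)
    show "sigma_algebra (space (completion M)) (filt M \<mu> \<sigma> W x t)" for t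
      using filt_sigma_algebra by simp
    show "filt M \<mu> \<sigma> W x t \<subseteq> sets (completion M)" for t using filtE by blast
    show "filt M \<mu> \<sigma> W x s \<subseteq> filt M \<mu> \<sigma> W x t" if "s \<le> t" for s t
    proof
      fix A assume "A \<in> filt M \<mu> \<sigma> W x s"
      then obtain B N where "A \<subseteq> space M" "B \<in> gen_sigma M \<mu> \<sigma> W x s" "N \<in> null_sets M" "(A - B) \<union> (B - A) \<subseteq> N"
        by (auto simp: filt_def)
      moreover from this(2) have "B \<in> gen_sigma M \<mu> \<sigma> W x t" using gen_sigma_mono[OF that] by (rule rev_subsetD)
      ultimately show "A \<in> filt M \<mu> \<sigma> W x t"
        unfolding filt_def by (intro CollectI conjI bexI[of _ B] bexI[of _ N])
    qed
    show "W t -` B \<inter> space (completion M) \<in> filt M \<mu> \<sigma> W x t" if "0 \<le> t" "B \<in> sets borel" for t B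
    proof -
      let ?B = "(\<lambda>y. (y - x - \<mu> * t) / \<sigma>) -` B \<inter> space borel"
      have "?B \<in> sets borel" using that by measurable
      then have "surplus \<mu> \<sigma> W x t -` ?B \<inter> space M \<in> gen_sigma M \<mu> \<sigma> W x t"
        unfolding gen_sigma_def using that by (intro sigma_sets.Basic) auto
      moreover have "surplus \<mu> \<sigma> W x t -` ?B \<inter> space M = W t -` B \<inter> space (completion M)"
        using \<sigma> by (auto simp: surplus_def)
      ultimately show ?thesis using gen_sigma_sub_filt[of M \<mu> \<sigma> W x t] by (simp add: subset_iff)
    qed
    show "continuous_on {0..} (\<lambda>t. W t \<omega>)" "W 0 \<omega> = 0" if "\<omega> \<in> space (completion M)" for \<omega>
      using paths that by auto
    show "distr (completion M) borel (\<lambda>\<omega>. W (t + u) \<omega> - W t \<omega>) = density lborel (\<lambda>y. ennreal (normal_density 0 (sqrt u) y))"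
      if "0 \<le> t" "0 < u" for t u
    proof -
      have d: "distributed M lborel (\<lambda>\<omega>. W (t + u) \<omega> - W t \<omega>) (\<lambda>y. ennreal (normal_density 0 (sqrt (t + u - t)) y))"
        using laws[rule_format, of t "t + u"] that by simp
      have "distr (completion M) borel (\<lambda>\<omega>. W (t + u) \<omega> - W t \<omega>) = distr M lborel (\<lambda>\<omega>. W (t + u) \<omega> - W t \<omega>)"
      proof (rule measure_eqI)
        fix A assume "A \<in> sets (distr (completion M) borel (\<lambda>\<omega>. W (t + u) \<omega> - W t \<omega>))"
        then have A: "A \<in> sets borel" by simp
        have m: "(\<lambda>\<omega>. W (t + u) \<omega> - W t \<omega>) -` A \<inter> space M \<in> sets M" using A by measurable
        show "emeasure (distr (completion M) borel (\<lambda>\<omega>. W (t + u) \<omega> - W t \<omega>)) A = emeasure (distr M lborel (\<lambda>\<omega>. W (t + u) \<omega> - W t \<omega>)) A"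
          using A m by (simp add: emeasure_distr measurable_completion)
      qed simp
      then show ?thesis using d unfolding distributed_def by simp
    qed
    show "measure (completion M) (A \<inter> {\<omega>\<in>space (completion M). W (t + u) \<omega> - W t \<omega> \<in> B}) =
      measure (completion M) A * measure (completion M) {\<omega>\<in>space (completion M). W (t + u) \<omega> - W t \<omega> \<in> B}"
      if t: "0 \<le> t" "0 < u" and A: "A \<in> filt M \<mu> \<sigma> W x t" and B: "B \<in> sets borel" for t u A B
    proof -
      obtain A' where A': "A' \<in> gen_sigma M \<mu> \<sigma> W x t" "A \<in> sets (completion M)" "AE \<omega> in completion M. \<omega> \<in> A \<longleftrightarrow> \<omega> \<in> A'"
        using filtE[OF A] by blast
      let ?D = "{\<omega>\<in>space M. W (t + u) \<omega> - W t \<omega> \<in> B}"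
      have D: "?D \<in> sets M" using B by measurable
      have A'm: "A' \<in> sets M" using A' gen_sub by auto
      have "measure (completion M) A = measure (completion M) A'"
        using A' A'm by (intro measure_eq_AE) auto
      moreover have "measure (completion M) (A \<inter> ?D) = measure (completion M) (A' \<inter> ?D)"
        using A' A'm D by (intro measure_eq_AE) (auto elim!: eventually_mono)
      ultimately show ?thesis
        using increment_indep_past[OF BM t A'(1) B] A'm D by simp
    qed
  qed
qed

text \<open>Adding 1 to the rounded index puts the grid point strictly to the right of
  \<open>t\<close>, so that right continuity alone applies along the sequence.\<close>

lemma floor_grid_upper_tendsto:
  fixes t :: real
  assumes "0 \<le> t"
  shows "filterlim (\<lambda>n. (real (nat \<lfloor>t * real (Suc n)\<rfloor>) + 1) / real (Suc n)) (at_right t) sequentially"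
proof -
  let ?g = "\<lambda>n. (real (nat \<lfloor>t * real (Suc n)\<rfloor>) + 1) / real (Suc n)"
  have b: "t < ?g n \<and> ?g n \<le> t + inverse (real (Suc n))" for n
  proof -
    have "0 \<le> t * real (Suc n)" using assms by simp
    then have "real (nat \<lfloor>t * real (Suc n)\<rfloor>) = of_int \<lfloor>t * real (Suc n)\<rfloor>" by (simp del: of_nat_Suc)
    then have "t * real (Suc n) < real (nat \<lfloor>t * real (Suc n)\<rfloor>) + 1" "real (nat \<lfloor>t * real (Suc n)\<rfloor>) \<le> t * real (Suc n)"
      by linarith+
    then show ?thesis by (simp add: field_simps del: of_nat_Suc)
  qed
  have "?g \<longlonglongrightarrow> t"
  proof (rule tendsto_sandwich[of "\<lambda>_. t" _ _ "\<lambda>n. t + inverse (real (Suc n))"])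
    show "(\<lambda>n. t + inverse (real (Suc n))) \<longlonglongrightarrow> t"
      using tendsto_add[OF tendsto_const[of t] LIMSEQ_inverse_real_of_nat] by simp
  qed (use b in \<open>auto intro!: always_eventually less_imp_le\<close>)
  then show ?thesis
    unfolding filterlim_at using b less_imp_neq[THEN not_sym] by (auto intro!: always_eventually simp del: of_nat_Suc)
qed

text \<open>The process is the pointwise limit of its values at grid points to the right, and each
  approximation is a countable patchwork of measurable pieces. Clipping time at 0 defines the map on
  the whole line.\<close>

lemma right_continuous_joint_measurable:
  fixes f :: "real \<Rightarrow> 'a \<Rightarrow> real"
  assumes f: "\<And>t. 0 \<le> t \<Longrightarrow> f t \<in> borel_measurable N"
    and rc: "\<And>\<omega> t. \<omega> \<in> space N \<Longrightarrow> 0 \<le> t \<Longrightarrow> continuous (at_right t) (\<lambda>s. f s \<omega>)"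
  shows "(\<lambda>(\<omega>, t). f (max 0 t) \<omega>) \<in> borel_measurable (N \<Otimes>\<^sub>M borel)"
proof (rule borel_measurable_LIMSEQ_real)
  let ?k = "\<lambda>n (p :: 'a \<times> real). nat \<lfloor>max 0 (snd p) * real (Suc n)\<rfloor>"
  show "(\<lambda>p. f ((real (?k n p) + 1) / real (Suc n)) (fst p)) \<in> borel_measurable (N \<Otimes>\<^sub>M borel)" for n
  proof (rule measurable_compose_countable[of "\<lambda>i p. f ((real i + 1) / real (Suc n)) (fst p)" _ _ "?k n"])
    show "(\<lambda>p. f ((real i + 1) / real (Suc n)) (fst p)) \<in> borel_measurable (N \<Otimes>\<^sub>M borel)" for i
      by (rule measurable_compose[OF measurable_fst f]) simp
    show "?k n \<in> N \<Otimes>\<^sub>M borel \<rightarrow>\<^sub>M count_space UNIV" by measurable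
  qed
  fix p :: "'a \<times> real" assume "p \<in> space (N \<Otimes>\<^sub>M borel)"
  then have p: "fst p \<in> space N" by (auto simp: space_pair_measure)
  have "((\<lambda>s. f s (fst p)) \<longlongrightarrow> f (max 0 (snd p)) (fst p)) (at_right (max 0 (snd p)))"
    using rc[OF p, of "max 0 (snd p)"] by (simp add: continuous_within)
  then show "(\<lambda>n. f ((real (?k n p) + 1) / real (Suc n)) (fst p)) \<longlonglongrightarrow> (case p of (\<omega>, t) \<Rightarrow> f (max 0 t) \<omega>)"
    unfolding case_prod_beta by (rule filterlim_compose) (rule floor_grid_upper_tendsto, simp)
qed

lemma (in prob_space) fubini_bounded:
  fixes h :: "'a \<Rightarrow> real \<Rightarrow> real"
  assumes [measurable]: "(\<lambda>(\<omega>, s). h \<omega> s) \<in> borel_measurable (M \<Otimes>\<^sub>M borel)"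
    and B: "\<And>\<omega> s. \<omega> \<in> space M \<Longrightarrow> s \<in> {a..b} \<Longrightarrow> \<bar>h \<omega> s\<bar> \<le> B"
  shows "(\<integral>\<omega>. (LINT s:{a..b}|lborel. h \<omega> s) \<partial>M) = (LINT s:{a..b}|lborel. (\<integral>\<omega>. h \<omega> s \<partial>M))"
proof -
  interpret P: pair_sigma_finite M lborel ..
  have [measurable]: "(\<lambda>(\<omega>, s). h \<omega> s) \<in> borel_measurable (M \<Otimes>\<^sub>M lborel)"
    using assms(1) by simp
  have I: "integrable lborel (\<lambda>s. indicat_real {a..b} s * c)" for c
    by (intro integrable_mult_left integrable_real_indicator) (auto simp: emeasure_lborel_Icc_eq)
  have "integrable (M \<Otimes>\<^sub>M lborel) (\<lambda>(\<omega>, s). indicator {a..b} s *\<^sub>R h \<omega> s)"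
  proof (rule Bochner_Integration.integrable_bound)
    show "integrable (M \<Otimes>\<^sub>M lborel) (\<lambda>(\<omega>, s). indicator {a..b} s * B)"
    proof (rule P.Fubini_integrable)
      show "integrable M (\<lambda>\<omega>. \<integral>s. norm (case (\<omega>, s) of (\<omega>, s) \<Rightarrow> indicator {a..b} s * B) \<partial>lborel)" by simp
      show "AE \<omega> in M. integrable lborel (\<lambda>s. case (\<omega>, s) of (\<omega>, s) \<Rightarrow> indicator {a..b} s * B)"
        using I by simp
    qed measurable
    show "AE p in M \<Otimes>\<^sub>M lborel. norm (case p of (\<omega>, s) \<Rightarrow> indicator {a..b} s *\<^sub>R h \<omega> s) \<le> norm (case p of (\<omega>, s) \<Rightarrow> indicator {a..b} s * B)"
    proof (rule AE_I2)
      fix p :: "'a \<times> real" assume "p \<in> space (M \<Otimes>\<^sub>M lborel)"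
      then show "norm (case p of (\<omega>, s) \<Rightarrow> indicator {a..b} s *\<^sub>R h \<omega> s) \<le> norm (case p of (\<omega>, s) \<Rightarrow> indicator {a..b} s * B)"
        using B[of "fst p" "snd p"] by (auto simp: space_pair_measure indicator_def)
    qed
    show "(\<lambda>(\<omega>, s). indicator {a..b} s *\<^sub>R h \<omega> s) \<in> borel_measurable (M \<Otimes>\<^sub>M lborel)" by measurable
  qed
  from P.Fubini_integral[OF this] show ?thesis
    unfolding set_lebesgue_integral_def by simp
qed

lemma integral_scale_diff:
  fixes i f g :: "'a \<Rightarrow> real"
  assumes "integrable M (\<lambda>\<omega>. i \<omega> * f \<omega>)" "integrable M (\<lambda>\<omega>. i \<omega> * g \<omega>)"
  shows "(\<integral>\<omega>. i \<omega> * (e * f \<omega> - g \<omega>) \<partial>M) = e * (\<integral>\<omega>. i \<omega> * f \<omega> \<partial>M) - (\<integral>\<omega>. i \<omega> * g \<omega> \<partial>M)"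
proof -
  have "(\<integral>\<omega>. i \<omega> * (e * f \<omega> - g \<omega>) \<partial>M) = (\<integral>\<omega>. e * (i \<omega> * f \<omega>) - i \<omega> * g \<omega> \<partial>M)"
    by (intro Bochner_Integration.integral_cong) (auto simp: algebra_simps)
  then show ?thesis using assms by simp
qed

lemma gauss_avg_eq_density:
  fixes g :: "real \<Rightarrow> real"
  assumes "0 < u" and [measurable]: "g \<in> borel_measurable borel"
  shows "gauss_avg \<sigma> g u y = (\<integral>w. g (y + \<sigma> * w) \<partial>density lborel (\<lambda>w. ennreal (normal_density 0 (sqrt u) w)))"
proof -
  have "(\<integral>w. g (y + \<sigma> * w) \<partial>density lborel (\<lambda>w. ennreal (normal_density 0 (sqrt u) w))) =
    (\<integral>w. normal_density 0 (sqrt u) w * g (y + \<sigma> * w) \<partial>lborel)"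
    by (subst integral_density) auto
  also have "\<dots> = \<bar>sqrt u\<bar> *\<^sub>R (\<integral>z. normal_density 0 (sqrt u) (0 + sqrt u * z) * g (y + \<sigma> * (0 + sqrt u * z)) \<partial>lborel)"
    using assms(1) by (intro lborel_integral_real_affine) simp
  also have "\<dots> = (\<integral>z. sqrt u * (normal_density 0 (sqrt u) (sqrt u * z) * g (y + \<sigma> * (sqrt u * z))) \<partial>lborel)"
    using assms(1) by simp
  also have "\<dots> = gauss_avg \<sigma> g u y"
    unfolding gauss_avg_def
  proof (intro Bochner_Integration.integral_cong refl)
    fix z :: real
    have "sqrt u * normal_density 0 (sqrt u) (sqrt u * z) = std_normal_density z"
      using assms(1) unfolding normal_density_def by (simp add: power_mult_distrib real_sqrt_mult field_simps)
    then have "sqrt u * normal_density 0 (sqrt u) (sqrt u * z) * g (y + \<sigma> * sqrt u * z) = std_normal_density z * g (y + \<sigma> * sqrt u * z)"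
      by simp
    then show "sqrt u * (normal_density 0 (sqrt u) (sqrt u * z) * g (y + \<sigma> * (sqrt u * z))) = g (y + \<sigma> * sqrt u * z) * std_normal_density z"
      by (simp add: ac_simps)
  qed
  finally show ?thesis ..
qed

section \<open>Markov property and the one-step formula at a deterministic time\<close>

context bm_filtration
begin

definition Fm :: "real \<Rightarrow> 'a measure" where
  "Fm t = sigma (space M) (F t)"

lemma space_Fm [simp]: "space (Fm t) = space M"
  and sets_Fm [simp]: "sets (Fm t) = F t"
proof -
  interpret sigma_algebra "space M" "F t" by (rule F_sigma)
  show "space (Fm t) = space M" "sets (Fm t) = F t"
    unfolding Fm_def by (auto simp: space_measure_of_conv sets_measure_of_conv space_closed sigma_sets_eq)
qed

lemma measurable_Fm: "f \<in> measurable (Fm t) N \<Longrightarrow> f \<in> measurable M N"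
  using F_sub[of t] unfolding measurable_def by auto

lemma measurable_Fm_mono: "f \<in> measurable (Fm s) N \<Longrightarrow> s \<le> t \<Longrightarrow> f \<in> measurable (Fm t) N"
  using F_mono[of s t] unfolding measurable_def by auto

lemma W_Fm: "0 \<le> s \<Longrightarrow> s \<le> t \<Longrightarrow> W s \<in> borel_measurable (Fm t)"
  using W_adapted[of s] F_mono[of s t] by (intro measurableI) (auto simp: subset_iff)

lemma W_measurable: "0 \<le> s \<Longrightarrow> W s \<in> borel_measurable M"
  using W_Fm[of s s] measurable_Fm by blast

lemma W_right_cont:
  assumes "\<omega> \<in> space M" "0 \<le> t"
  shows "continuous (at_right t) (\<lambda>s. W s \<omega>)"
proof -
  have "continuous (at t within {0..}) (\<lambda>s. W s \<omega>)"
    using W_cont[OF assms(1)] assms(2) by (auto simp: continuous_on_eq_continuous_within)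
  then show ?thesis by (rule continuous_within_subset) (use assms in auto)
qed

lemma W_joint_measurable [measurable]: "(\<lambda>(\<omega>, t). W (max 0 t) \<omega>) \<in> borel_measurable (M \<Otimes>\<^sub>M borel)"
  by (rule right_continuous_joint_measurable) (auto intro: W_measurable W_right_cont)

lemma markov_step:
  fixes g :: "real \<Rightarrow> real"
  assumes t: "0 \<le> t" "0 \<le> u" and A: "A \<in> F t" and U: "U \<in> borel_measurable (Fm t)"
    and g [measurable]: "g \<in> borel_measurable borel" and B: "\<And>x. \<bar>g x\<bar> \<le> B"
  shows "(\<integral>\<omega>. indicator A \<omega> * g (U \<omega> + \<sigma> * (W (t + u) \<omega> - W t \<omega>)) \<partial>M) =
    (\<integral>\<omega>. indicator A \<omega> * gauss_avg \<sigma> g u (U \<omega>) \<partial>M)"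
proof (cases "u = 0")
  case True
  have "(\<integral>z. g c * std_normal_density z \<partial>lborel) = g c" for c by simp
  then show ?thesis by (simp add: True gauss_avg_def)
next
  case False
  then have u: "0 < u" using t by simp
  define D where "D \<omega> = W (t + u) \<omega> - W t \<omega>" for \<omega>
  \<comment> \<open>The dummy zero gives the increment the same value type as \<open>X\<close>,
    since \<open>indep_var\<close> speaks about two variables of one type.\<close>
  define E where "E \<omega> = (D \<omega>, 0 :: real)" for \<omega>
  define X where "X \<omega> = (indicator A \<omega> :: real, U \<omega>)" for \<omega>
  have XF: "X \<in> measurable (Fm t) (borel \<Otimes>\<^sub>M borel)"
    unfolding X_def using A U by (intro measurable_Pair borel_measurable_indicator) auto
  have [measurable]: "X \<in> measurable M (borel \<Otimes>\<^sub>M borel)" by (rule measurable_Fm[OF XF])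
  have [measurable]: "D \<in> borel_measurable M"
    unfolding D_def using t by (intro borel_measurable_diff W_measurable) auto
  have [measurable]: "E \<in> measurable M (borel \<Otimes>\<^sub>M borel)" unfolding E_def by measurable
  have "indep_var (borel \<Otimes>\<^sub>M borel) X (borel \<Otimes>\<^sub>M borel) E"
    unfolding indep_var_eq
  proof (intro conjI indep_set_sigma_sets)
    show "indep_set {X -` A \<inter> space M |A. A \<in> sets (borel \<Otimes>\<^sub>M borel)} {E -` A \<inter> space M |A. A \<in> sets (borel \<Otimes>\<^sub>M borel)}"
    proof (rule indep_setI)
      show "{X -` A \<inter> space M |A. A \<in> sets (borel \<Otimes>\<^sub>M borel)} \<subseteq> events"
        "{E -` A \<inter> space M |A. A \<in> sets (borel \<Otimes>\<^sub>M borel)} \<subseteq> events" by (auto intro: measurable_sets)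
      fix a b assume "a \<in> {X -` A \<inter> space M |A. A \<in> sets (borel \<Otimes>\<^sub>M borel)}" "b \<in> {E -` A \<inter> space M |A. A \<in> sets (borel \<Otimes>\<^sub>M borel)}"
      then obtain A' B' where ab: "A' \<in> sets (borel \<Otimes>\<^sub>M borel)" "B' \<in> sets (borel \<Otimes>\<^sub>M borel)" "a = X -` A' \<inter> space M" "b = E -` B' \<inter> space M"
        by auto
      have "a \<in> F t" using measurable_sets[OF XF ab(1)] ab(3) by simp
      moreover have "(\<lambda>w. (w, 0)) -` B' \<inter> space borel \<in> sets borel"
        by (intro measurable_sets[OF _ ab(2)]) simp
      moreover have "b = {\<omega>\<in>space M. W (t + u) \<omega> - W t \<omega> \<in> (\<lambda>w. (w, 0)) -` B' \<inter> space borel}" unfolding ab E_def D_def by auto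
      ultimately show "prob (a \<inter> b) = prob a * prob b" by (simp only: increment_indep[OF t(1) u])
    qed
    show "Int_stable {X -` A \<inter> space M |A. A \<in> sets (borel \<Otimes>\<^sub>M borel)}"
    proof (rule Int_stableI)
      fix a b assume "a \<in> {X -` A \<inter> space M |A. A \<in> sets (borel \<Otimes>\<^sub>M borel)}" "b \<in> {X -` A \<inter> space M |A. A \<in> sets (borel \<Otimes>\<^sub>M borel)}"
      then obtain A' B' where "A' \<in> sets (borel \<Otimes>\<^sub>M borel)" "B' \<in> sets (borel \<Otimes>\<^sub>M borel)" "a = X -` A' \<inter> space M" "b = X -` B' \<inter> space M"
        by auto
      then show "a \<inter> b \<in> {X -` A \<inter> space M |A. A \<in> sets (borel \<Otimes>\<^sub>M borel)}"
        by (auto intro!: exI[of _ "A' \<inter> B'"])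
    qed
    show "Int_stable {E -` A \<inter> space M |A. A \<in> sets (borel \<Otimes>\<^sub>M borel)}"
    proof (rule Int_stableI)
      fix a b assume "a \<in> {E -` A \<inter> space M |A. A \<in> sets (borel \<Otimes>\<^sub>M borel)}" "b \<in> {E -` A \<inter> space M |A. A \<in> sets (borel \<Otimes>\<^sub>M borel)}"
      then obtain A' B' where "A' \<in> sets (borel \<Otimes>\<^sub>M borel)" "B' \<in> sets (borel \<Otimes>\<^sub>M borel)" "a = E -` A' \<inter> space M" "b = E -` B' \<inter> space M"
        by auto
      then show "a \<inter> b \<in> {E -` A \<inter> space M |A. A \<in> sets (borel \<Otimes>\<^sub>M borel)}"
        by (auto intro!: exI[of _ "A' \<inter> B'"])
    qed
  qed measurable
  then have joint: "distr M (borel \<Otimes>\<^sub>M borel) X \<Otimes>\<^sub>M distr M (borel \<Otimes>\<^sub>M borel) E = distr M ((borel \<Otimes>\<^sub>M borel) \<Otimes>\<^sub>M (borel \<Otimes>\<^sub>M borel)) (\<lambda>\<omega>. (X \<omega>, E \<omega>))"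
    by (simp add: indep_var_distribution_eq)
  define h where "h p = fst (fst p) * g (snd (fst p) + \<sigma> * fst (snd p))" for p :: "(real \<times> real) \<times> real \<times> real"
  have [measurable]: "h \<in> borel_measurable ((borel \<Otimes>\<^sub>M borel) \<Otimes>\<^sub>M (borel \<Otimes>\<^sub>M borel))" unfolding h_def by measurable
  interpret PX: prob_space "distr M (borel \<Otimes>\<^sub>M borel) X" by (rule prob_space_distr) measurable
  interpret PE: prob_space "distr M (borel \<Otimes>\<^sub>M borel) E" by (rule prob_space_distr) measurable
  interpret PP: pair_sigma_finite "distr M (borel \<Otimes>\<^sub>M borel) X" "distr M (borel \<Otimes>\<^sub>M borel) E" ..
  have "integrable M (\<lambda>\<omega>. h (X \<omega>, E \<omega>))"
  proof (rule integrable_const_bound[of _ B])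
    show "AE \<omega> in M. norm (h (X \<omega>, E \<omega>)) \<le> B"
      using B order_trans[OF abs_ge_zero B] by (intro AE_I2) (auto simp: h_def X_def indicator_def)
  qed measurable
  then have int: "integrable (distr M (borel \<Otimes>\<^sub>M borel) X \<Otimes>\<^sub>M distr M (borel \<Otimes>\<^sub>M borel) E) h"
    unfolding joint by (subst integrable_distr_eq) auto
  have "(\<integral>\<omega>. indicator A \<omega> * g (U \<omega> + \<sigma> * (W (t + u) \<omega> - W t \<omega>)) \<partial>M) = (\<integral>\<omega>. h (X \<omega>, E \<omega>) \<partial>M)"
    by (simp add: h_def X_def E_def D_def)
  also have "\<dots> = (\<integral>p. h p \<partial>distr M ((borel \<Otimes>\<^sub>M borel) \<Otimes>\<^sub>M (borel \<Otimes>\<^sub>M borel)) (\<lambda>\<omega>. (X \<omega>, E \<omega>)))"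
    by (subst integral_distr) auto
  also have "\<dots> = (\<integral>a. (\<integral>w. h (a, w) \<partial>distr M (borel \<Otimes>\<^sub>M borel) E) \<partial>distr M (borel \<Otimes>\<^sub>M borel) X)"
    unfolding joint[symmetric] by (rule PP.integral_fst'[OF int, symmetric])
  also have "\<dots> = (\<integral>a. fst a * gauss_avg \<sigma> g u (snd a) \<partial>distr M (borel \<Otimes>\<^sub>M borel) X)"
  proof -
    have "(\<integral>w. h (a, w) \<partial>distr M (borel \<Otimes>\<^sub>M borel) E) = (\<integral>\<omega>. fst a * g (snd a + \<sigma> * D \<omega>) \<partial>M)" for a
      by (subst integral_distr) (auto simp: h_def E_def)
    also have "\<dots> a = fst a * gauss_avg \<sigma> g u (snd a)" for a
      unfolding gauss_avg_eq_density[OF u g] increment_law[OF t(1) u, symmetric] D_def[symmetric] by (simp add: integral_distr)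
    finally have "(\<integral>w. h (a, w) \<partial>distr M (borel \<Otimes>\<^sub>M borel) E) = fst a * gauss_avg \<sigma> g u (snd a)" for a .
    then show ?thesis by simp
  qed
  also have "\<dots> = (\<integral>\<omega>. fst (X \<omega>) * gauss_avg \<sigma> g u (snd (X \<omega>)) \<partial>M)"
    by (subst integral_distr) auto
  finally show ?thesis by (simp add: X_def)
qed

text \<open>\<open>markov_step\<close> replaces the increment by a Gaussian average,
  \<open>dynkin_gauss\<close> expands this average in time, and \<open>markov_step\<close> applied
  to the bounded function \<open>Af\<close> puts the increment back under the time integral.
  Continuity of \<open>Af\<close> is not involved, so a jumping second derivative does no
  harm.\<close>

lemma dynkin_step:
  fixes q m \<sigma> d :: real
  assumes reg: "regular f f1 f2" and q: "0 \<le> q" and t: "0 \<le> t" "0 \<le> d"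
    and A: "A \<in> F t" and U: "U \<in> borel_measurable (Fm t)"
  defines "Af \<equiv> \<lambda>x. \<sigma>\<^sup>2 / 2 * f2 x + m * f1 x - q * f x"
  shows "(\<integral>\<omega>. indicator A \<omega> * (exp (- q * d) * f (U \<omega> + m * d + \<sigma> * (W (t + d) \<omega> - W t \<omega>)) - f (U \<omega>)) \<partial>M) =
    (\<integral>\<omega>. (LINT s:{0..d}|lborel. indicator A \<omega> * (exp (- q * s) * Af (U \<omega> + m * s + \<sigma> * (W (t + s) \<omega> - W t \<omega>)))) \<partial>M)"
proof -
  note [measurable] = regularD(3-5)[OF reg]
  obtain B where B: "0 \<le> B" "\<And>x. \<bar>f x\<bar> \<le> B" "\<And>x. \<bar>f1 x\<bar> \<le> B" "\<And>x. \<bar>f2 x\<bar> \<le> B"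
    using regular_bound[OF reg] by metis
  have Af_m [measurable]: "Af \<in> borel_measurable borel" unfolding Af_def by measurable
  define B' where "B' = \<sigma>\<^sup>2 / 2 * B + \<bar>m\<bar> * B + q * B"
  have BA: "\<bar>Af x\<bar> \<le> B'" for x
  proof -
    have "\<bar>Af x\<bar> \<le> \<bar>\<sigma>\<^sup>2 / 2 * f2 x\<bar> + \<bar>m * f1 x\<bar> + \<bar>q * f x\<bar>" unfolding Af_def by linarith
    also have "\<dots> \<le> B'" unfolding B'_def
      using B q by (auto simp: abs_mult intro!: add_mono mult_left_mono)
    finally show ?thesis .
  qed
  have B'0: "0 \<le> B'" using BA[of 0] by simp
  have [measurable]: "U \<in> borel_measurable M" by (rule measurable_Fm[OF U])
  have [measurable]: "A \<in> sets M" using A F_sub by auto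
  have [measurable]: "W t \<in> borel_measurable M" "W (t + d) \<in> borel_measurable M" using t by (auto intro: W_measurable)
  have Ud: "(\<lambda>\<omega>. U \<omega> + c) \<in> borel_measurable (Fm t)" for c using U by simp
  have i1: "integrable M (\<lambda>\<omega>. indicator A \<omega> * f (U \<omega> + m * d + \<sigma> * (W (t + d) \<omega> - W t \<omega>)))"
    and i2: "integrable M (\<lambda>\<omega>. indicator A \<omega> * f (U \<omega>))"
    using B by (auto intro!: integrable_const_bound[of _ B] AE_I2 simp: indicator_def)
  have i3: "integrable M (\<lambda>\<omega>. indicator A \<omega> * gauss_avg \<sigma> f d (U \<omega> + m * d))"
    using abs_gauss_avg_le[of f B] B by (auto intro!: integrable_const_bound[of _ B] AE_I2 simp: indicator_def)
  have bd: "\<bar>indicator A \<omega> * (exp (- q * s) * r)\<bar> \<le> B'" if "\<bar>r\<bar> \<le> B'" "0 \<le> s" for s r :: real and \<omega>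
  proof -
    have "exp (- q * s) \<le> 1" using q that by simp
    then have "exp (- q * s) * \<bar>r\<bar> \<le> 1 * B'" using that by (intro mult_mono) auto
    then show ?thesis using B'0 by (auto simp: indicator_def abs_mult)
  qed
  have "(\<integral>\<omega>. indicator A \<omega> * (exp (- q * d) * f (U \<omega> + m * d + \<sigma> * (W (t + d) \<omega> - W t \<omega>)) - f (U \<omega>)) \<partial>M)
    = exp (- q * d) * (\<integral>\<omega>. indicator A \<omega> * f (U \<omega> + m * d + \<sigma> * (W (t + d) \<omega> - W t \<omega>)) \<partial>M) - (\<integral>\<omega>. indicator A \<omega> * f (U \<omega>) \<partial>M)"
    by (rule integral_scale_diff[OF i1 i2])
  also have "\<dots> = exp (- q * d) * (\<integral>\<omega>. indicator A \<omega> * gauss_avg \<sigma> f d (U \<omega> + m * d) \<partial>M) - (\<integral>\<omega>. indicator A \<omega> * f (U \<omega>) \<partial>M)"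
    using markov_step[OF t A Ud[of "m * d"] regularD(3)[OF reg] B(2), of \<sigma>] by simp
  also have "\<dots> = (\<integral>\<omega>. indicator A \<omega> * (exp (- q * d) * gauss_avg \<sigma> f d (U \<omega> + m * d) - f (U \<omega>)) \<partial>M)"
    by (rule integral_scale_diff[OF i3 i2, symmetric])
  also have "\<dots> = (\<integral>\<omega>. (LINT s:{0..d}|lborel. indicator A \<omega> * (exp (- q * s) * gauss_avg \<sigma> Af s (U \<omega> + m * s))) \<partial>M)"
    unfolding dynkin_gauss[OF reg q t(2)] Af_def by simp
  also have "\<dots> = (LINT s:{0..d}|lborel. (\<integral>\<omega>. indicator A \<omega> * (exp (- q * s) * gauss_avg \<sigma> Af s (U \<omega> + m * s)) \<partial>M))"
  proof (rule fubini_bounded)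
    show "(\<lambda>(\<omega>, s). indicator A \<omega> * (exp (- q * s) * gauss_avg \<sigma> Af s (U \<omega> + m * s))) \<in> borel_measurable (M \<Otimes>\<^sub>M borel)"
      by measurable
    show "\<bar>indicator A \<omega> * (exp (- q * s) * gauss_avg \<sigma> Af s (U \<omega> + m * s))\<bar> \<le> B'" if "s \<in> {0..d}" for \<omega> s
      using that by (intro bd abs_gauss_avg_le BA) auto
  qed
  also have "\<dots> = (LINT s:{0..d}|lborel. (\<integral>\<omega>. indicator A \<omega> * (exp (- q * s) * Af (U \<omega> + m * s + \<sigma> * (W (t + s) \<omega> - W t \<omega>))) \<partial>M))"
  proof (intro set_lebesgue_integral_cong allI impI)
    fix s assume s: "s \<in> {0..d}"
    show "(\<integral>\<omega>. indicator A \<omega> * (exp (- q * s) * gauss_avg \<sigma> Af s (U \<omega> + m * s)) \<partial>M) =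
      (\<integral>\<omega>. indicator A \<omega> * (exp (- q * s) * Af (U \<omega> + m * s + \<sigma> * (W (t + s) \<omega> - W t \<omega>))) \<partial>M)"
    proof -
      have e: "(\<integral>\<omega>. indicator A \<omega> * (exp (- q * s) * r \<omega>) \<partial>M) = exp (- q * s) * (\<integral>\<omega>. indicator A \<omega> * r \<omega> \<partial>M)" for r :: "'a \<Rightarrow> real"
        unfolding integral_mult_right_zero[symmetric]
        by (intro Bochner_Integration.integral_cong) (auto simp: algebra_simps)
      show ?thesis
        unfolding e using markov_step[OF t(1) _ A Ud[of "m * s"] Af_m BA, of s \<sigma>] s by simp
    qed
  qed simp
  \<comment> \<open>Clipping at 0 changes nothing on \<open>{0..d}\<close>; it only makes the
    integrand jointly measurable over all real \<open>s\<close> for the exchange of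
    integrals.\<close>
  also have "\<dots> = (\<integral>\<omega>. (LINT s:{0..d}|lborel. indicator A \<omega> * (exp (- q * s) * Af (U \<omega> + m * s + \<sigma> * (W (max 0 (t + s)) \<omega> - W t \<omega>)))) \<partial>M)"
  proof (subst fubini_bounded)
    have "(\<lambda>p. (fst p, t + snd p)) \<in> measurable (M \<Otimes>\<^sub>M borel) (M \<Otimes>\<^sub>M borel)" by measurable
    from measurable_compose[OF this W_joint_measurable]
    have [measurable]: "(\<lambda>(\<omega>, s). W (max 0 (t + s)) \<omega>) \<in> borel_measurable (M \<Otimes>\<^sub>M borel)"
      by (simp add: case_prod_beta)
    show "(\<lambda>(\<omega>, s). indicator A \<omega> * (exp (- q * s) * Af (U \<omega> + m * s + \<sigma> * (W (max 0 (t + s)) \<omega> - W t \<omega>)))) \<in> borel_measurable (M \<Otimes>\<^sub>M borel)"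
      by measurable
    show "\<bar>indicator A \<omega> * (exp (- q * s) * Af (U \<omega> + m * s + \<sigma> * (W (max 0 (t + s)) \<omega> - W t \<omega>)))\<bar> \<le> B'" if "s \<in> {0..d}" for \<omega> s
      using that by (intro bd BA) auto
    show "(LINT s:{0..d}|lborel. (\<integral>\<omega>. indicator A \<omega> * (exp (- q * s) * Af (U \<omega> + m * s + \<sigma> * (W (t + s) \<omega> - W t \<omega>))) \<partial>M)) =
      (LINT s:{0..d}|lborel. (\<integral>\<omega>. indicator A \<omega> * (exp (- q * s) * Af (U \<omega> + m * s + \<sigma> * (W (max 0 (t + s)) \<omega> - W t \<omega>))) \<partial>M))"
      using t by (intro set_lebesgue_integral_cong) auto
  qed
  also have "\<dots> = (\<integral>\<omega>. (LINT s:{0..d}|lborel. indicator A \<omega> * (exp (- q * s) * Af (U \<omega> + m * s + \<sigma> * (W (t + s) \<omega> - W t \<omega>)))) \<partial>M)"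
    using t by (intro Bochner_Integration.integral_cong set_lebesgue_integral_cong) auto
  finally show ?thesis .
qed

end

subsection \<open>Threshold paths\<close>

text \<open>The start lies strictly below the level, so the time is positive and continuity forces
  equality at it. This exactness is what allows the strategy to restart at the threshold
  itself.\<close>

lemma first_hit:
  fixes w :: "real \<Rightarrow> real"
  assumes w: "continuous_on {0..} w" "w 0 = 0" and "x < y" and ex: "\<exists>s\<ge>0. y \<le> x + w s - c * s"
  defines "h \<equiv> Inf {s. 0 \<le> s \<and> y \<le> x + w s - c * s}"
  shows "0 < h" "x + w h - c * h = y" "\<And>s. 0 \<le> s \<Longrightarrow> s < h \<Longrightarrow> x + w s - c * s < y"
proof -
  let ?H = "{s. 0 \<le> s \<and> y \<le> x + w s - c * s}" and ?g = "\<lambda>s. x + w s - c * s"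
  have g: "continuous_on {0..} ?g" using w by (intro continuous_intros)
  have "closed ?H"
    using continuous_closed_preimage[OF g closed_atLeast, of "{y..}"] by (simp add: vimage_def Int_def)
  moreover have bdd: "bdd_below ?H" by (auto intro: bdd_belowI[of _ 0])
  ultimately have hH: "h \<in> ?H" unfolding h_def using ex by (intro closed_contains_Inf) auto
  show below: "?g s < y" if "0 \<le> s" "s < h" for s
  proof (rule ccontr)
    assume "\<not> ?g s < y"
    then have "h \<le> s" unfolding h_def using that by (intro cInf_lower bdd) auto
    with that show False by simp
  qed
  show h0: "0 < h" using hH \<open>x < y\<close> w(2) by (cases "h = 0") auto
  show "?g h = y"
  proof (rule ccontr)
    assume "?g h \<noteq> y"
    then have "y < ?g h" using hH by simp
    moreover have "?g 0 < y" using w(2) \<open>x < y\<close> by simp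
    ultimately obtain s where "0 \<le> s" "s \<le> h" "?g s = y"
      using IVT'[of ?g 0 y h] h0 g continuous_on_subset[OF g, of "{0..h}"] by auto
    then show False using below[of s] \<open>?g h \<noteq> y\<close> by (cases "s = h") auto
  qed
qed

lemma thr_Cons_unfold:
  assumes "cs \<noteq> []" "x < z c" "\<exists>s\<ge>0. z c \<le> x + w s - c * s"
    and "h = Inf {s. 0 \<le> s \<and> z c \<le> x + w s - c * s}"
  shows "thr (c # cs) z x w t = (if t < h then c else thr cs z (z c) (\<lambda>s. w (h + s) - w h) (t - h))"
  using assms by (simp add: Let_def)

lemma has_integral_delayed:
  fixes f g :: "real \<Rightarrow> real"
  assumes f: "f = (\<lambda>t. if t < h then c else g (t - h))" and h: "0 \<le> h"
    and g: "\<And>t. 0 \<le> t \<Longrightarrow> g integrable_on {0..t}"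
  shows "0 \<le> t \<Longrightarrow> t \<le> h \<Longrightarrow> integral {0..t} f = c * t"
    and "h \<le> t \<Longrightarrow> integral {0..t} f = c * h + integral {0..t - h} g"
proof -
  have 1: "(f has_integral c * t) {0..t}" if "0 \<le> t" "t \<le> h" for t
  proof (rule has_integral_spike_finite[of "{t}"])
    show "((\<lambda>_. c) has_integral c * t) {0..t}"
      using has_integral_const_real[of c 0 t] that by (simp add: mult.commute)
  qed (use that in \<open>auto simp: f\<close>)
  show "integral {0..t} f = c * t" if "0 \<le> t" "t \<le> h" using 1[OF that] by (rule integral_unique)
  show "integral {0..t} f = c * h + integral {0..t - h} g" if "h \<le> t"
  proof -
    have "(g has_integral integral {0..t - h} g) (cbox 0 (t - h))"
      using g[of "t - h"] that by (simp add: integrable_integral)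
    from has_integral_affinity'[OF this zero_less_one, of "- h"]
    have "((\<lambda>s. g (s - h)) has_integral integral {0..t - h} g) {h..t}" by simp
    then have "(f has_integral integral {0..t - h} g) {h..t}"
      by (rule has_integral_spike_finite[of "{}", rotated 2]) (auto simp: f)
    from has_integral_combine[OF h that 1[OF h order_refl] this] show ?thesis by (rule integral_unique)
  qed
qed

text \<open>Neighbouring value functions agree from the threshold upwards, that is, wherever the
  threshold strategy switches. It applies equally to a switch at the threshold and to levels skipped
  because the surplus already exceeds theirs.\<close>

definition linked :: "real list \<Rightarrow> (real \<Rightarrow> real) \<Rightarrow> (real \<Rightarrow> real \<Rightarrow> real) \<Rightarrow> bool" where
  "linked cs z v \<longleftrightarrow> (\<forall>i y. Suc i < length cs \<longrightarrow> z (cs ! i) \<le> y \<longrightarrow> v (cs ! i) y = v (cs ! Suc i) y)"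

lemma linked_tl: "linked (c # cs) z v \<Longrightarrow> linked cs z v"
  unfolding linked_def
proof (intro allI impI)
  fix i y assume "\<forall>i y. Suc i < length (c # cs) \<longrightarrow> z ((c # cs) ! i) \<le> y \<longrightarrow> v ((c # cs) ! i) y = v ((c # cs) ! Suc i) y"
    "Suc i < length cs" "z (cs ! i) \<le> y"
  from this(1)[rule_format, of "Suc i" y] this(2,3) show "v (cs ! i) y = v (cs ! Suc i) y" by simp
qed

lemma linked_hd:
  assumes "linked (c # cs) z v" "cs \<noteq> []" "z c \<le> y"
  shows "v c y = v (hd cs) y"
  using assms(1)[unfolded linked_def, rule_format, of 0 y] assms(2,3) by (simp add: hd_conv_nth)

text \<open>The last conjunct says that the value process does not jump when the strategy switches.\<close>

lemma thr_path:
  fixes w :: "real \<Rightarrow> real" and v :: "real \<Rightarrow> real \<Rightarrow> real"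
  assumes "cs \<noteq> []" "sorted_wrt (<) cs" "continuous_on {0..} w" "w 0 = 0"
  shows "(\<forall>t\<ge>0. thr cs z x w t \<in> set cs) \<and> mono_on {0..} (thr cs z x w) \<and>
    (\<forall>t\<ge>0. continuous (at_right t) (thr cs z x w)) \<and>
    (\<forall>t\<ge>0. thr cs z x w t \<noteq> last cs \<longrightarrow> x + w t - integral {0..t} (thr cs z x w) < z (thr cs z x w t)) \<and>
    ((\<forall>c\<in>set cs. continuous_on UNIV (v c)) \<longrightarrow>
     linked cs z v \<longrightarrow>
     continuous_on {0..} (\<lambda>t. v (thr cs z x w t) (x + w t - integral {0..t} (thr cs z x w))) \<and>
     v (thr cs z x w 0) x = v (hd cs) x)"
  using assms
proof (induction cs arbitrary: x w)
  case Nil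
  then show ?case by simp
next
  case (Cons c cs)
  note w = \<open>continuous_on {0..} w\<close> \<open>w 0 = 0\<close>
  let ?f = "thr (c # cs) z x w"
  show ?case
  proof (cases "cs \<noteq> [] \<and> z c \<le> x")
    case True
    \<comment> \<open>The level \<open>c\<close> is skipped without time passing, and linking
      identifies its value at \<open>x\<close> with that of the next level.\<close>
    then have "?f = thr cs z x w" by auto
    moreover have "v (hd cs) x = v c x" if "linked (c # cs) z v"
      using linked_hd[OF that] True by simp
    ultimately show ?thesis
      using Cons.IH[of w x] True w Cons.prems linked_tl by simp
  next
    case nskip: False
    show ?thesis
    proof (cases "cs \<noteq> [] \<and> (\<exists>s\<ge>0. z c \<le> x + w s - c * s)")
      case False
      have f: "?f = (\<lambda>_. c)" by (rule HOL.ext) (use False nskip in auto)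
      \<comment> \<open>A level other than the last has a successor, so the rate stays at
        \<open>c\<close> only because the threshold is never reached.\<close>
      have below: "x + w t - c * t < z c" if "0 \<le> t" "c \<noteq> last (c # cs)" for t
      proof -
        have "cs \<noteq> []" using that by auto
        then show ?thesis using False that(1) not_le by blast
      qed
      have int: "integral {0..t} (\<lambda>_. c) = c * t" if "0 \<le> t" for t using that by simp
      have "continuous_on {0..} (\<lambda>t. v c (x + w t - integral {0..t} (\<lambda>_. c)))" if "continuous_on UNIV (v c)"
      proof (subst continuous_on_cong[OF refl])
        show "continuous_on {0..} (\<lambda>t. v c (x + w t - c * t))"
          using w by (intro continuous_on_compose2[OF that] continuous_intros) auto
      qed (simp add: mult.commute)
      then show ?thesis unfolding f using below int by (auto simp: mono_on_def simp del: integral_const_real)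
    next
      case True
      define h where "h = Inf {s. 0 \<le> s \<and> z c \<le> x + w s - c * s}"
      define w' where "w' s = w (h + s) - w h" for s
      define g where "g = thr cs z (z c) w'"
      have x: "x < z c" using nskip True by auto
      note hit = first_hit[OF w x, of c, folded h_def]
      have h: "0 < h" "x + w h - c * h = z c" "\<And>s. 0 \<le> s \<Longrightarrow> s < h \<Longrightarrow> x + w s - c * s < z c"
        using hit True by auto
      define F where "F = ?f"
      have f: "F = (\<lambda>t. if t < h then c else g (t - h))"
        unfolding F_def
      proof (rule HOL.ext)
        fix t
        have "?f t = (if t < h then c else thr cs z (z c) (\<lambda>s. w (h + s) - w h) (t - h))"
          by (rule thr_Cons_unfold) (use x True h_def in auto)
        then show "?f t = (if t < h then c else g (t - h))" by (simp only: g_def w'_def[abs_def])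
      qed
      have w': "continuous_on {0..} w'" "w' 0 = 0"
      proof -
        show "continuous_on {0..} w'" unfolding w'_def
          by (intro continuous_on_diff continuous_on_compose2[OF w(1)] continuous_on_add continuous_on_const continuous_on_id)
             (use h(1) in auto)
      qed (simp add: w'_def)
      have "sorted_wrt (<) cs" "cs \<noteq> []" using Cons.prems(2) True by auto
      note IH0 = Cons.IH[of w' "z c", OF this(2,1) w', folded g_def]
      have IH: "\<And>t. 0 \<le> t \<Longrightarrow> g t \<in> set cs" "mono_on {0..} g" "\<And>t. 0 \<le> t \<Longrightarrow> continuous (at_right t) g"
        "\<And>t. 0 \<le> t \<Longrightarrow> g t \<noteq> last cs \<Longrightarrow> z c + w' t - integral {0..t} g < z (g t)"
        and IHv: "\<forall>c\<in>set cs. continuous_on UNIV (v c) \<Longrightarrow>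
         linked cs z v \<Longrightarrow>
         continuous_on {0..} (\<lambda>t. v (g t) (z c + w' t - integral {0..t} g)) \<and> v (g 0) (z c) = v (hd cs) (z c)"
        using IH0 by blast+
      have c_less: "c < d" if "d \<in> set cs" for d using Cons.prems(2) that by auto
      have gi: "g integrable_on {0..t}" for t
        by (rule integrable_on_mono_on[OF monotone_on_subset[OF IH(2)]]) auto
      note int = has_integral_delayed[OF f less_imp_le[OF h(1)] gi]
      have X1: "x + w t - integral {0..t} F = x + w t - c * t" if "0 \<le> t" "t \<le> h" for t
        using int(1)[OF that] by simp
      have X2: "x + w t - integral {0..t} F = z c + w' (t - h) - integral {0..t - h} g" if "h \<le> t" for t
        using int(2)[OF that] h(2) by (simp add: w'_def)
      show ?thesis
        unfolding F_def[symmetric]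
      proof (intro conjI impI allI)
        show "F t \<in> set (c # cs)" if "0 \<le> t" for t using IH(1)[of "t - h"] by (auto simp: f)
        show "mono_on {0..} F"
        proof (rule mono_onI)
          fix r s :: real assume rs: "r \<in> {0..}" "s \<in> {0..}" "r \<le> s"
          show "F r \<le> F s"
            using rs c_less[OF IH(1)[of "s - h"]] mono_onD[OF IH(2), of "r - h" "s - h"] unfolding f by auto
        qed
        show "continuous (at_right t) F" if "0 \<le> t" for t
        proof (cases "t < h")
          case True
          have "\<forall>\<^sub>F s in at_right t. F s = c"
            using eventually_at_right_less[of t] eventually_at_right_field[of "\<lambda>s. s < h" t] True
            by (auto simp: f eventually_at_right_field)
          then show ?thesis unfolding continuous_within using True by (auto simp: f intro: tendsto_eventually)
        next
          case False
          then have "continuous (at_right (t - h)) g" by (intro IH(3)) simp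
          moreover have "filterlim (\<lambda>s. s - h) (at_right (t - h)) (at_right t)"
            by (auto simp: filterlim_at eventually_at_right_field intro!: tendsto_eq_intros exI[of _ "t + 1"])
          ultimately have "((\<lambda>s. g (s - h)) \<longlongrightarrow> g (t - h)) (at_right t)"
            unfolding continuous_within by (rule filterlim_compose)
          moreover have "\<forall>\<^sub>F s in at_right t. g (s - h) = F s"
            using eventually_at_right_less[of t] by eventually_elim (use False in \<open>auto simp: f\<close>)
          ultimately show ?thesis unfolding continuous_within using False
            by (auto simp: f intro: Lim_transform_eventually)
        qed
        show "x + w t - integral {0..t} F < z (F t)" if "0 \<le> t" "F t \<noteq> last (c # cs)" for t
        proof (cases "t < h")
          case True
          then show ?thesis using X1[of t] h(3)[of t] that by (simp add: f)
        next
          case False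
          then show ?thesis using X2[of t] IH(4)[of "t - h"] that True by (auto simp: f)
        qed
        assume vc: "\<forall>c\<in>set (c # cs). continuous_on UNIV (v c)"
          and link: "linked (c # cs) z v"
        have v: "continuous_on {0..} (\<lambda>t. v (g t) (z c + w' t - integral {0..t} g))" "v (g 0) (z c) = v (hd cs) (z c)"
          using IHv vc linked_tl[OF link] by auto
        have vcz: "v c (z c) = v (hd cs) (z c)" using linked_hd[OF link] True by simp
        let ?v = "\<lambda>t. v (F t) (x + w t - integral {0..t} F)"
        \<comment> \<open>The two pieces are glued at the switching time: the surplus equals
          \<open>z c\<close> there, and linking makes the outgoing and the incoming value agree at
          that point.\<close>
        have "continuous_on ({0..h} \<union> {h..}) ?v"
        proof (rule continuous_on_closed_Un)
          have vcc: "continuous_on UNIV (v c)" using vc by simp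
          have "continuous_on {0..h} (\<lambda>t. x + w t - c * t)"
            by (intro continuous_on_diff continuous_on_add continuous_on_mult continuous_on_const continuous_on_id
                continuous_on_subset[OF w(1)]) auto
          from continuous_on_compose2[OF vcc this] have "continuous_on {0..h} (\<lambda>t. v c (x + w t - c * t))" by simp
          moreover have "v c (x + w t - c * t) = ?v t" if "t \<in> {0..h}" for t
          proof (cases "t = h")
            case True
            then show ?thesis using X1[of h] h v(2) vcz by (simp add: f)
          qed (use that X1[of t] in \<open>auto simp: f\<close>)
          ultimately show "continuous_on {0..h} ?v" by (rule continuous_on_eq)
          have "continuous_on {h..} (\<lambda>t. v (g (t - h)) (z c + w' (t - h) - integral {0..t - h} g))"
            by (rule continuous_on_compose2[OF v(1), of "{h..}" "\<lambda>t. t - h"]) (auto intro!: continuous_intros)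
          moreover have "v (g (t - h)) (z c + w' (t - h) - integral {0..t - h} g) = ?v t" if "t \<in> {h..}" for t
            using that X2[of t] by (simp add: f)
          ultimately show "continuous_on {h..} ?v" by (rule continuous_on_eq)
        qed auto
        then show "continuous_on {0..} ?v" by (rule continuous_on_subset) auto
        show "v (F 0) x = v (hd (c # cs)) x" using h(1) by (simp add: f)
      qed
    qed
  qed
qed

text \<open>This turns reaching a level at some time in a continuum into countably many conditions.
  With slack 1/(n+1) a rational time suffices by continuity, and conversely the maximum over the
  compact interval removes the slack. The end point \<open>t\<close> is included because no rational
  inside the interval lies to its right.\<close>

lemma exists_rational_between_near:
  fixes Z :: "real \<Rightarrow> real"
  assumes Z: "continuous_on {0..} Z" and h: "0 \<le> h" "h \<le> t"
  shows "(\<exists>u. h \<le> u \<and> u \<le> t \<and> \<theta> \<le> Z u) \<longleftrightarrow>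
    (\<forall>n. \<exists>r\<in>insert t (\<rat> \<inter> {0..t}). h \<le> r \<and> \<theta> - inverse (real (Suc n)) < Z r)"
proof
  assume "\<exists>u. h \<le> u \<and> u \<le> t \<and> \<theta> \<le> Z u"
  then obtain u where u: "h \<le> u" "u \<le> t" "\<theta> \<le> Z u" by blast
  show "\<forall>n. \<exists>r\<in>insert t (\<rat> \<inter> {0..t}). h \<le> r \<and> \<theta> - inverse (real (Suc n)) < Z r"
  proof
    fix n
    have pos: "0 < inverse (real (Suc n))" by simp
    show "\<exists>r\<in>insert t (\<rat> \<inter> {0..t}). h \<le> r \<and> \<theta> - inverse (real (Suc n)) < Z r"
    proof (cases "u = t")
      case True
      have "h \<le> t" "\<theta> - inverse (real (Suc n)) < Z t" using u pos unfolding True by linarith+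
      then show ?thesis by blast
    next
      case False
      obtain d where d: "0 < d" "\<And>r. 0 \<le> r \<Longrightarrow> dist r u < d \<Longrightarrow> dist (Z r) (Z u) < inverse (real (Suc n))"
        using Z u h pos unfolding continuous_on_iff by (metis atLeast_iff order_trans)
      have "u < min t (u + d)" using False u d by simp
      then obtain r where r: "r \<in> \<rat>" "u < r" "r < min t (u + d)" using Rats_dense_in_real by blast
      have "dist (Z r) (Z u) < inverse (real (Suc n))"
        using r u h by (intro d(2)) (auto simp: dist_real_def)
      then have "\<theta> - inverse (real (Suc n)) < Z r" using u(3) unfolding dist_real_def by linarith
      moreover have "r \<in> \<rat> \<inter> {0..t}" "h \<le> r" using r u h by auto
      ultimately show ?thesis by blast
    qed
  qed
next
  assume R: "\<forall>n. \<exists>r\<in>insert t (\<rat> \<inter> {0..t}). h \<le> r \<and> \<theta> - inverse (real (Suc n)) < Z r"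
  have "continuous_on {h..t} Z" by (rule continuous_on_subset[OF Z]) (use h in auto)
  then obtain u where u: "u \<in> {h..t}" "\<And>r. r \<in> {h..t} \<Longrightarrow> Z r \<le> Z u"
    using continuous_attains_sup[of "{h..t}" Z] h by auto
  have "\<theta> - inverse (real (Suc n)) \<le> Z u" for n
  proof -
    obtain r where r: "r \<in> insert t (\<rat> \<inter> {0..t})" "h \<le> r" "\<theta> - inverse (real (Suc n)) < Z r" using R by blast
    have "Z r \<le> Z u" using r(1,2) by (intro u(2)) auto
    with r(3) show ?thesis by linarith
  qed
  moreover have "(\<lambda>n. \<theta> - inverse (real (Suc n))) \<longlonglongrightarrow> \<theta>"
    using tendsto_diff[OF tendsto_const[of \<theta>] LIMSEQ_inverse_real_of_nat] by simp
  ultimately have "\<theta> \<le> Z u" by (intro LIMSEQ_le_const2) auto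
  then show "\<exists>u. h \<le> u \<and> u \<le> t \<and> \<theta> \<le> Z u" using u(1) by auto
qed

lemma sets_Collect_all_nat_countable_bex:
  assumes "countable I" "\<And>n r. r \<in> I \<Longrightarrow> {\<omega>\<in>space N. Q n r \<omega>} \<in> sets N"
  shows "{\<omega>\<in>space N. \<forall>n::nat. \<exists>r\<in>I. Q n r \<omega>} \<in> sets N"
proof -
  have "{\<omega>\<in>space N. \<forall>n::nat. \<exists>r\<in>I. Q n r \<omega>} = (\<Inter>n. \<Union>r\<in>I. {\<omega>\<in>space N. Q n r \<omega>})" by auto
  also have "\<dots> \<in> sets N" using assms by (intro sets.countable_INT sets.countable_UN' image_subsetI) auto
  finally show ?thesis .
qed

text \<open>The induction carries the current switching time \<open>h\<close> together with \<open>k\<close>, the value of the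
  path at \<open>h\<close>. At the next switching time the surplus equals the threshold, so the new value of the
  path there is an affine function of the two switching times and \<open>k\<close>; no measurability of the path
  at a random time is needed.\<close>

lemma thr_adapted:
  fixes w :: "'a \<Rightarrow> real \<Rightarrow> real" and N :: "real \<Rightarrow> 'a measure"
  assumes sp: "\<And>t. space (N t) = \<Omega>" and mono: "\<And>s t. s \<le> t \<Longrightarrow> sets (N s) \<subseteq> sets (N t)"
    and wm: "\<And>s t. 0 \<le> s \<Longrightarrow> s \<le> t \<Longrightarrow> (\<lambda>\<omega>. w \<omega> s) \<in> borel_measurable (N t)"
    and wc: "\<And>\<omega>. \<omega> \<in> \<Omega> \<Longrightarrow> continuous_on {0..} (w \<omega>)"
  shows "E \<subseteq> \<Omega> \<Longrightarrow> (\<And>\<omega>. \<omega> \<in> E \<Longrightarrow> 0 \<le> h \<omega> \<and> k \<omega> = w \<omega> (h \<omega>)) \<Longrightarrow>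
    (\<And>t. 0 \<le> t \<Longrightarrow> {\<omega>\<in>E. h \<omega> \<le> t} \<in> sets (N t)) \<Longrightarrow>
    (\<And>t. 0 \<le> t \<Longrightarrow> (\<lambda>\<omega>. if \<omega> \<in> E \<and> h \<omega> \<le> t then h \<omega> else 0) \<in> borel_measurable (N t)) \<Longrightarrow>
    (\<And>t. 0 \<le> t \<Longrightarrow> (\<lambda>\<omega>. if \<omega> \<in> E \<and> h \<omega> \<le> t then k \<omega> else 0) \<in> borel_measurable (N t)) \<Longrightarrow> 0 \<le> t \<Longrightarrow>
    {\<omega>\<in>E. h \<omega> \<le> t \<and> thr cs z y (\<lambda>s. w \<omega> (h \<omega> + s) - k \<omega>) (t - h \<omega>) = d} \<in> sets (N t)"
proof (induction cs arbitrary: E h k y t)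
  case Nil
  show ?case
  proof (cases "d = 0")
    case True
    then show ?thesis using Nil.prems(3)[OF Nil.prems(6)] by simp
  qed simp
next
  case (Cons c cs)
  note E = Cons.prems(1) and hk = Cons.prems(2) and Em = Cons.prems(3) and hm = Cons.prems(4)
    and km = Cons.prems(5) and t0 = Cons.prems(6)
  show ?case
  proof (cases "cs = []")
    case True
    then have "{\<omega>\<in>E. h \<omega> \<le> t \<and> thr (c # cs) z y (\<lambda>s. w \<omega> (h \<omega> + s) - k \<omega>) (t - h \<omega>) = d} =
      (if c = d then {\<omega>\<in>E. h \<omega> \<le> t} else {})" by auto
    then show ?thesis using Em[OF t0] by simp
  next
    case ne: False
    show ?thesis
    proof (cases "z c \<le> y")
      case True
      then show ?thesis using Cons.IH[OF E hk Em hm km t0, of y] ne by simp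
    next
      case False
      then have y: "y < z c" by simp
      define w' where "w' \<omega> s = w \<omega> (h \<omega> + s) - k \<omega>" for \<omega> s
      define g where "g \<omega> = Inf {s. 0 \<le> s \<and> z c \<le> y + w' \<omega> s - c * s}" for \<omega>
      define E' where "E' = {\<omega>\<in>E. \<exists>s\<ge>0. z c \<le> y + w' \<omega> s - c * s}"
      define h' where "h' \<omega> = h \<omega> + g \<omega>" for \<omega>
      define k' where "k' \<omega> = z c - y + k \<omega> + c * (h' \<omega> - h \<omega>)" for \<omega>
      have w'c: "continuous_on {0..} (w' \<omega>)" "w' \<omega> 0 = 0" if "\<omega> \<in> E" for \<omega>
      proof -
        have \<omega>: "\<omega> \<in> \<Omega>" "0 \<le> h \<omega>" "k \<omega> = w \<omega> (h \<omega>)" using E that hk[OF that] by auto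
        show "continuous_on {0..} (w' \<omega>)" unfolding w'_def
          by (intro continuous_on_diff continuous_on_compose2[OF wc[OF \<omega>(1)]] continuous_on_add continuous_on_const continuous_on_id)
             (use \<omega> in auto)
        show "w' \<omega> 0 = 0" using \<omega> by (simp add: w'_def)
      qed
      have hit: "0 < g \<omega>" "y + w' \<omega> (g \<omega>) - c * g \<omega> = z c"
        "\<And>s. 0 \<le> s \<Longrightarrow> s < g \<omega> \<Longrightarrow> y + w' \<omega> s - c * s < z c" if "\<omega> \<in> E'" for \<omega>
        using first_hit[of "w' \<omega>" y "z c" c] w'c[of \<omega>] y that unfolding E'_def g_def by auto
      have sub: "E' \<subseteq> E" by (auto simp: E'_def)
      have thr': "thr (c # cs) z y (w' \<omega>) (t - h \<omega>) = (if \<omega> \<in> E' \<and> h' \<omega> \<le> t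
          then thr cs z (z c) (\<lambda>s. w \<omega> (h' \<omega> + s) - k' \<omega>) (t - h' \<omega>) else c)" if "\<omega> \<in> E" for \<omega>
      proof (cases "\<omega> \<in> E'")
        case True
        \<comment> \<open>After the switch the restarted path has the same form with
          \<open>h'\<close> and \<open>k'\<close> in place of \<open>h\<close> and \<open>k\<close>,
          which closes the induction.\<close>
        have shift: "(\<lambda>s. w' \<omega> (g \<omega> + s) - w' \<omega> (g \<omega>)) = (\<lambda>s. w \<omega> (h' \<omega> + s) - k' \<omega>)"
        proof (rule HOL.ext)
          show "w' \<omega> (g \<omega> + s) - w' \<omega> (g \<omega>) = w \<omega> (h' \<omega> + s) - k' \<omega>" for s
            using hit(2)[OF True] unfolding w'_def k'_def h'_def by (simp add: algebra_simps)
        qed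
        have "thr (c # cs) z y (w' \<omega>) (t - h \<omega>) =
            (if t - h \<omega> < g \<omega> then c else thr cs z (z c) (\<lambda>s. w' \<omega> (g \<omega> + s) - w' \<omega> (g \<omega>)) (t - h \<omega> - g \<omega>))"
          using thr_Cons_unfold[of cs y z c "w' \<omega>" "g \<omega>"] ne y True unfolding E'_def g_def by blast
        then show ?thesis
          unfolding shift using True by (auto simp: h'_def diff_diff_eq simp del: thr.simps)
      next
        case False
        then have "\<not> (\<exists>s\<ge>0. z c \<le> y + w' \<omega> s - c * s)" using that by (auto simp: E'_def)
        then have "thr (c # cs) z y (w' \<omega>) (t - h \<omega>) = c" using y by auto
        then show ?thesis using False by simp
      qed
      have E'm: "{\<omega>\<in>E'. h' \<omega> \<le> t} \<in> sets (N t)" if "0 \<le> t" for t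
      proof -
        \<comment> \<open>Cut off outside the event that the switch has already happened, the time
          and the path value are measurable with respect to the information at \<open>t\<close>; on
          that event nothing is changed.\<close>
        define hT where "hT \<omega> = (if \<omega> \<in> E \<and> h \<omega> \<le> t then h \<omega> else 0)" for \<omega>
        define kT where "kT \<omega> = (if \<omega> \<in> E \<and> h \<omega> \<le> t then k \<omega> else 0)" for \<omega>
        have [measurable]: "hT \<in> borel_measurable (N t)" "kT \<in> borel_measurable (N t)" "{\<omega>\<in>E. h \<omega> \<le> t} \<in> sets (N t)"
          using hm km Em that unfolding hT_def kT_def by auto
        have "{\<omega>\<in>E'. h' \<omega> \<le> t} = {\<omega>\<in>E. h \<omega> \<le> t} \<inter> {\<omega>\<in>space (N t). \<forall>n. \<exists>r\<in>insert t (\<rat> \<inter> {0..t}).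
            hT \<omega> \<le> r \<and> z c - y + kT \<omega> - c * hT \<omega> - inverse (real (Suc n)) < w \<omega> r - c * r}" (is "_ = _ \<inter> ?S")
        proof (intro set_eqI)
          fix \<omega>
          show "\<omega> \<in> {\<omega>\<in>E'. h' \<omega> \<le> t} \<longleftrightarrow> \<omega> \<in> {\<omega>\<in>E. h \<omega> \<le> t} \<inter> ?S"
          proof (cases "\<omega> \<in> E \<and> h \<omega> \<le> t")
            case True
            then have eq: "hT \<omega> = h \<omega>" "kT \<omega> = k \<omega>" and sp': "\<omega> \<in> space (N t)" using E sp by (auto simp: hT_def kT_def)
            have Z: "continuous_on {0..} (\<lambda>u. w \<omega> u - c * u)"
              using wc[of \<omega>] True E by (auto intro!: continuous_intros)
            have hh: "0 \<le> h \<omega>" "h \<omega> \<le> t" using True hk by auto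
            have "\<omega> \<in> E' \<and> h' \<omega> \<le> t \<longleftrightarrow> (\<exists>u. h \<omega> \<le> u \<and> u \<le> t \<and> z c - y + k \<omega> - c * h \<omega> \<le> w \<omega> u - c * u)"
            proof
              assume a: "\<omega> \<in> E' \<and> h' \<omega> \<le> t"
              then have "z c - y + k \<omega> - c * h \<omega> \<le> w \<omega> (h' \<omega>) - c * h' \<omega>" "h \<omega> \<le> h' \<omega>"
                using hit(1,2)[of \<omega>] unfolding w'_def h'_def by (auto simp: algebra_simps)
              then show "\<exists>u. h \<omega> \<le> u \<and> u \<le> t \<and> z c - y + k \<omega> - c * h \<omega> \<le> w \<omega> u - c * u" using a by blast
            next
              assume "\<exists>u. h \<omega> \<le> u \<and> u \<le> t \<and> z c - y + k \<omega> - c * h \<omega> \<le> w \<omega> u - c * u"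
              then obtain u where u: "h \<omega> \<le> u" "u \<le> t" "z c - y + k \<omega> - c * h \<omega> \<le> w \<omega> u - c * u" by blast
              then have s: "z c \<le> y + w' \<omega> (u - h \<omega>) - c * (u - h \<omega>)" unfolding w'_def by (simp add: algebra_simps)
              then have E': "\<omega> \<in> E'" using True u(1) unfolding E'_def by (auto intro!: exI[of _ "u - h \<omega>"])
              have "g \<omega> \<le> u - h \<omega>" using hit(3)[OF E', of "u - h \<omega>"] s u(1) by fastforce
              then show "\<omega> \<in> E' \<and> h' \<omega> \<le> t" using E' u(2) unfolding h'_def by auto
            qed
            also have "\<dots> \<longleftrightarrow> \<omega> \<in> ?S"
              using exists_rational_between_near[OF Z hh, of "z c - y + k \<omega> - c * h \<omega>"] sp' by (simp add: eq)
            finally show ?thesis using True by simp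
          next
            case False
            have "\<omega> \<notin> {\<omega>\<in>E'. h' \<omega> \<le> t}"
              using False hit(1)[of \<omega>] sub unfolding h'_def by force
            then show ?thesis using False by auto
          qed
        qed
        also have "\<dots> \<in> sets (N t)"
        proof (intro sets.Int)
          show "?S \<in> sets (N t)"
          proof (rule sets_Collect_all_nat_countable_bex)
            fix n r assume r: "r \<in> insert t (\<rat> \<inter> {0..t})"
            have [measurable]: "(\<lambda>\<omega>. w \<omega> r) \<in> borel_measurable (N t)" using r \<open>0 \<le> t\<close> by (intro wm) auto
            show "{\<omega>\<in>space (N t). hT \<omega> \<le> r \<and> z c - y + kT \<omega> - c * hT \<omega> - inverse (real (Suc n)) < w \<omega> r - c * r} \<in> sets (N t)"
              by measurable
          qed (auto intro: countable_subset[OF _ countable_rat])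
        qed measurable
        finally show ?thesis .
      qed
      have h'm: "(\<lambda>\<omega>. if \<omega> \<in> E' \<and> h' \<omega> \<le> t then h' \<omega> else 0) \<in> borel_measurable (N t)" if t: "0 \<le> t" for t
      proof (unfold borel_measurable_iff_le, intro allI)
        fix a :: real
        have nn: "0 \<le> h' \<omega>" if "\<omega> \<in> E'" for \<omega> using hit(1)[OF that] hk[of \<omega>] sub that by (auto simp: h'_def)
        show "{\<omega>\<in>space (N t). (if \<omega> \<in> E' \<and> h' \<omega> \<le> t then h' \<omega> else 0) \<le> a} \<in> sets (N t)"
        proof (cases "0 \<le> a")
          case True
          have "{\<omega>\<in>E'. h' \<omega> \<le> min a t} \<in> sets (N t)"
            using E'm[of "min a t"] mono[of "min a t" t] True t by auto
          \<comment> \<open>For \<open>a \<ge> 0\<close> the cut-off time exceeds \<open>a\<close>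
            exactly when the switch falls after \<open>a\<close> and not after \<open>t\<close>, so
            the level set is a complement of a difference of known events.\<close>
          then have "space (N t) - ({\<omega>\<in>E'. h' \<omega> \<le> t} - {\<omega>\<in>E'. h' \<omega> \<le> min a t}) \<in> sets (N t)"
            using E'm[OF t] by auto
          also have "space (N t) - ({\<omega>\<in>E'. h' \<omega> \<le> t} - {\<omega>\<in>E'. h' \<omega> \<le> min a t}) =
            {\<omega>\<in>space (N t). (if \<omega> \<in> E' \<and> h' \<omega> \<le> t then h' \<omega> else 0) \<le> a}" using True by auto
          finally show ?thesis .
        next
          case False
          have "\<not> (if \<omega> \<in> E' \<and> h' \<omega> \<le> t then h' \<omega> else 0) \<le> a" for \<omega>
            using False nn[of \<omega>] by auto
          then show ?thesis by simp
        qed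
      qed
      have k'm: "(\<lambda>\<omega>. if \<omega> \<in> E' \<and> h' \<omega> \<le> t then k' \<omega> else 0) \<in> borel_measurable (N t)" if t: "0 \<le> t" for t
      proof -
        note [measurable] = h'm[OF t] hm[OF t] km[OF t] E'm[OF t]
        have "(\<lambda>\<omega>. if \<omega> \<in> E' \<and> h' \<omega> \<le> t then k' \<omega> else 0) =
          (\<lambda>\<omega>. if \<omega> \<in> {\<omega>\<in>E'. h' \<omega> \<le> t} then z c - y + (if \<omega> \<in> E \<and> h \<omega> \<le> t then k \<omega> else 0)
            + c * ((if \<omega> \<in> E' \<and> h' \<omega> \<le> t then h' \<omega> else 0) - (if \<omega> \<in> E \<and> h \<omega> \<le> t then h \<omega> else 0)) else 0)"
        proof (rule HOL.ext)
          fix \<omega>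
          have "\<omega> \<in> E \<and> h \<omega> \<le> t" if "\<omega> \<in> E' \<and> h' \<omega> \<le> t" using that hit(1)[of \<omega>] sub by (auto simp: h'_def)
          then show "(if \<omega> \<in> E' \<and> h' \<omega> \<le> t then k' \<omega> else 0) =
            (if \<omega> \<in> {\<omega>\<in>E'. h' \<omega> \<le> t} then z c - y + (if \<omega> \<in> E \<and> h \<omega> \<le> t then k \<omega> else 0)
            + c * ((if \<omega> \<in> E' \<and> h' \<omega> \<le> t then h' \<omega> else 0) - (if \<omega> \<in> E \<and> h \<omega> \<le> t then h \<omega> else 0)) else 0)"
            by (auto simp: k'_def)
        qed
        also have "\<dots> \<in> borel_measurable (N t)"
          by (intro measurable_If_set borel_measurable_add borel_measurable_times borel_measurable_diff
              borel_measurable_const h'm[OF t] hm[OF t] km[OF t]) (use E'm[OF t] in auto)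
        finally show ?thesis .
      qed
      have hk': "0 \<le> h' \<omega> \<and> k' \<omega> = w \<omega> (h' \<omega>)" if "\<omega> \<in> E'" for \<omega>
        using hit(1,2)[OF that] hk[of \<omega>] sub that unfolding h'_def k'_def w'_def by (auto simp: algebra_simps)
      have E'\<Omega>: "E' \<subseteq> \<Omega>" using E sub by auto
      have IH: "{\<omega>\<in>E'. h' \<omega> \<le> t \<and> thr cs z (z c) (\<lambda>s. w \<omega> (h' \<omega> + s) - k' \<omega>) (t - h' \<omega>) = d} \<in> sets (N t)"
        by (rule Cons.IH[OF E'\<Omega> hk' E'm h'm k'm t0])
      have "{\<omega>\<in>E. h \<omega> \<le> t \<and> thr (c # cs) z y (w' \<omega>) (t - h \<omega>) = d} =
        {\<omega>\<in>E'. h' \<omega> \<le> t \<and> thr cs z (z c) (\<lambda>s. w \<omega> (h' \<omega> + s) - k' \<omega>) (t - h' \<omega>) = d} \<union>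
        (if c = d then {\<omega>\<in>E. h \<omega> \<le> t} - {\<omega>\<in>E'. h' \<omega> \<le> t} else {})" (is "?L = ?R")
      proof (intro set_eqI)
        fix \<omega>
        have "h \<omega> \<le> t" if "\<omega> \<in> E'" "h' \<omega> \<le> t" using hit(1)[OF that(1)] that(2) by (simp add: h'_def)
        then show "\<omega> \<in> ?L \<longleftrightarrow> \<omega> \<in> ?R"
          using thr'[of \<omega>] sub by (auto simp del: thr.simps split: if_splits)
      qed
      also have "\<dots> \<in> sets (N t)" using IH Em[OF t0] E'm[OF t0] by auto
      finally show ?thesis unfolding w'_def .
    qed
  qed
qed

text \<open>\<open>thr_adapted\<close> is started on the whole space with switching time 0. It gives
  adaptedness already to the uncompleted past; the path properties come from
  \<open>thr_path\<close>.\<close>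

lemma thr_strategy_admissible:
  assumes BM: "std_brownian_motion M W" and cs: "cs \<noteq> []" "sorted_wrt (<) cs" and i: "i < length cs"
  shows "thr_strategy \<mu> \<sigma> W cs z x i \<in> admissible M \<mu> \<sigma> W (set cs) x (cs ! i)"
proof -
  have paths: "\<forall>\<omega>\<in>space M. W 0 \<omega> = 0 \<and> continuous_on {0..} (\<lambda>t. W t \<omega>)"
    using BM unfolding std_brownian_motion_def by blast
  let ?w = "\<lambda>\<omega> s. \<mu> * s + \<sigma> * W s \<omega>"
  define ds where "ds = drop i cs"
  have ds: "ds \<noteq> []" "sorted_wrt (<) ds" "set ds \<subseteq> set cs" "hd ds = cs ! i"
    using cs i by (auto simp: ds_def hd_drop_conv_nth dest: in_set_dropD)
  have ge: "cs ! i \<le> d" if "d \<in> set ds" for d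
    using that ds by (cases ds) auto
  have wc: "continuous_on {0..} (?w \<omega>)" "?w \<omega> 0 = 0" if "\<omega> \<in> space M" for \<omega>
    using paths that by (auto intro!: continuous_intros)
  note path = thr_path[OF ds(1,2) wc]
  define N where "N t = sigma (space M) (gen_sigma M \<mu> \<sigma> W x t)" for t
  have N: "space (N t) = space M" "sets (N t) = gen_sigma M \<mu> \<sigma> W x t" for t
  proof -
    interpret sigma_algebra "space M" "gen_sigma M \<mu> \<sigma> W x t" by (rule gen_sigma_sigma_algebra)
    show "space (N t) = space M" "sets (N t) = gen_sigma M \<mu> \<sigma> W x t"
      unfolding N_def by (auto simp: space_measure_of_conv sets_measure_of_conv space_closed sigma_sets_eq)
  qed
  have "(\<lambda>\<omega>. ?w \<omega> s) \<in> borel_measurable (N t)" if "0 \<le> s" "s \<le> t" for s t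
  proof -
    have "surplus \<mu> \<sigma> W x s \<in> borel_measurable (N t)"
    proof (rule measurableI)
      fix B :: "real set" assume "B \<in> sets borel"
      then have "surplus \<mu> \<sigma> W x s -` B \<inter> space M \<in> gen_sigma M \<mu> \<sigma> W x t"
        unfolding gen_sigma_def using that by (intro sigma_sets.Basic) auto
      then show "surplus \<mu> \<sigma> W x s -` B \<inter> space (N t) \<in> sets (N t)" by (simp add: N)
    qed simp
    then have "(\<lambda>\<omega>. surplus \<mu> \<sigma> W x s \<omega> - x) \<in> borel_measurable (N t)" by simp
    then show ?thesis by (simp add: surplus_def)
  qed
  note wm = this
  \<comment> \<open>Events that fix one level are enough, since the strategy takes finitely many
    values.\<close>
  have lev: "{\<omega>\<in>space M. thr ds z x (?w \<omega>) t = d} \<in> gen_sigma M \<mu> \<sigma> W x t" if t: "0 \<le> t" for t d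
  proof -
    have sub: "sets (N s) \<subseteq> sets (N t)" if "s \<le> t" for s t unfolding N by (rule gen_sigma_mono[OF that])
    have "{\<omega>\<in>space M. 0 \<le> t \<and> thr ds z x (\<lambda>s. ?w \<omega> (0 + s) - 0) (t - 0) = d} \<in> sets (N t)"
    proof (rule thr_adapted[of N "space M" ?w "space M" "\<lambda>_. 0" "\<lambda>_. 0" t ds z x d, OF N(1) sub wm wc(1)])
      show "{\<omega>\<in>space M. 0 \<le> t} \<in> sets (N t)" if "0 \<le> t" for t using that sets.top[of "N t"] by (simp add: N)
    qed (use wc(2) t in auto)
    then show ?thesis using t by (simp add: N)
  qed
  show ?thesis
    unfolding admissible_def
  proof (intro CollectI conjI ballI allI impI)
    fix t :: real and B :: "real set" assume t: "0 \<le> t" and B: "B \<in> sets borel"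
    interpret sigma_algebra "space M" "gen_sigma M \<mu> \<sigma> W x t" by (rule gen_sigma_sigma_algebra)
    have "thr_strategy \<mu> \<sigma> W cs z x i t -` B \<inter> space M = (\<Union>d\<in>set ds \<inter> B. {\<omega>\<in>space M. thr ds z x (?w \<omega>) t = d})"
      using path t by (auto simp: thr_strategy_def ds_def)
    also have "\<dots> \<in> gen_sigma M \<mu> \<sigma> W x t" using lev[OF t] by (intro finite_UN) auto
    finally show "thr_strategy \<mu> \<sigma> W cs z x i t -` B \<inter> space M \<in> filt M \<mu> \<sigma> W x t"
      using gen_sigma_sub_filt by (rule set_mp[rotated])
  next
    fix \<omega> assume \<omega>: "\<omega> \<in> space M"
    have eq: "thr_strategy \<mu> \<sigma> W cs z x i t \<omega> = thr ds z x (?w \<omega>) t" for t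
      by (simp add: thr_strategy_def ds_def)
    show "thr_strategy \<mu> \<sigma> W cs z x i t \<omega> \<in> set cs" "cs ! i \<le> thr_strategy \<mu> \<sigma> W cs z x i t \<omega>" if "0 \<le> t" for t
      using path[OF \<omega> \<omega>, of z x] that ds(3) ge unfolding eq by blast+
    show "mono_on {0..} (\<lambda>t. thr_strategy \<mu> \<sigma> W cs z x i t \<omega>)" using path[OF \<omega> \<omega>, of z x] unfolding eq by blast
    show "continuous (at_right t) (\<lambda>s. thr_strategy \<mu> \<sigma> W cs z x i s \<omega>)" if "0 \<le> t" for t
      using path[OF \<omega> \<omega>, of z x] that unfolding eq by blast
  qed
qed

subsection \<open>Freezing the control on a grid\<close>

text \<open>The mesh is 1/(m+1), so an integer horizon \<open>T\<close> is a grid point for every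
  \<open>m\<close>, with index \<open>T * Suc m\<close>.\<close>

definition grid :: "nat \<Rightarrow> nat \<Rightarrow> real" where
  "grid m k = real k / real (Suc m)"

definition cell :: "nat \<Rightarrow> real \<Rightarrow> nat" where
  "cell m s = nat \<lfloor>s * real (Suc m)\<rfloor>"

lemma grid_nonneg [simp]: "0 \<le> grid m k"
  and grid_0 [simp]: "grid m 0 = 0"
  and grid_mono: "j \<le> k \<Longrightarrow> grid m j \<le> grid m k"
  and grid_Suc: "grid m (Suc k) = grid m k + inverse (real (Suc m))"
  by (auto simp: grid_def divide_right_mono add_divide_distrib inverse_eq_divide)

lemma grid_mult_Suc [simp]: "grid m (T * Suc m) = real T"
  by (simp only: grid_def of_nat_mult) simp

lemma cell_grid [simp]: "cell m (grid m k) = k"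
  by (simp add: cell_def grid_def del: of_nat_Suc)

lemma cell_bounds:
  assumes "0 \<le> s"
  shows "grid m (cell m s) \<le> s" "s < grid m (cell m s) + inverse (real (Suc m))"
proof -
  have "0 \<le> s * real (Suc m)" using assms by simp
  then have "real (cell m s) = of_int \<lfloor>s * real (Suc m)\<rfloor>" unfolding cell_def by (simp del: of_nat_Suc)
  then have "real (cell m s) \<le> s * real (Suc m)" "s * real (Suc m) < real (cell m s) + 1" by linarith+
  then show "grid m (cell m s) \<le> s" "s < grid m (cell m s) + inverse (real (Suc m))"
    unfolding grid_def by (simp_all add: field_simps del: of_nat_Suc)
qed

lemma cell_eqI:
  assumes "grid m k \<le> s" "s < grid m (Suc k)"
  shows "cell m s = k"
proof -
  have "real k \<le> s * real (Suc m)" "s * real (Suc m) < real k + 1"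
    using assms unfolding grid_def by (simp_all add: field_simps del: of_nat_Suc)
  then have "\<lfloor>s * real (Suc m)\<rfloor> = int k" by (simp add: floor_eq_iff del: of_nat_Suc)
  then show ?thesis by (simp add: cell_def del: of_nat_Suc)
qed

lemma grid_le_imp_le_cell:
  assumes "grid m j \<le> s"
  shows "j \<le> cell m s"
proof (rule ccontr)
  assume "\<not> j \<le> cell m s"
  then have "grid m (Suc (cell m s)) \<le> grid m j" by (intro grid_mono) simp
  moreover have "0 \<le> s" using assms grid_nonneg[of m j] by linarith
  ultimately show False using cell_bounds(2)[of s m] assms by (simp add: grid_Suc)
qed

lemma inverse_Suc_tendsto: "(\<lambda>m. a * inverse (real (Suc m))) \<longlonglongrightarrow> 0"
  using tendsto_mult[OF tendsto_const[of a] LIMSEQ_inverse_real_of_nat] by simp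

lemma grid_cell_tendsto:
  assumes "0 \<le> s"
  shows "(\<lambda>m. grid m (cell m s)) \<longlonglongrightarrow> s"
proof (rule tendsto_sandwich[of "\<lambda>m. s - 1 * inverse (real (Suc m))" _ _ "\<lambda>_. s"])
  show "(\<lambda>m. s - 1 * inverse (real (Suc m))) \<longlonglongrightarrow> s"
    using tendsto_diff[OF tendsto_const[of s] inverse_Suc_tendsto[of 1]] by simp
qed (use cell_bounds[OF assms] in \<open>auto intro!: always_eventually less_imp_le simp: diff_less_eq\<close>)

text \<open>Freezing the control at the last grid point makes the drift constant on each cell, so that the
  one-step formula applies.\<close>

definition frozen_at :: "real \<Rightarrow> (real \<Rightarrow> real) \<Rightarrow> (real \<Rightarrow> real) \<Rightarrow> nat \<Rightarrow> nat \<Rightarrow> real" where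
  "frozen_at x w c m k = x + w (grid m k) - (\<Sum>j<k. c (grid m j)) * inverse (real (Suc m))"

definition frozen :: "real \<Rightarrow> (real \<Rightarrow> real) \<Rightarrow> (real \<Rightarrow> real) \<Rightarrow> nat \<Rightarrow> real \<Rightarrow> real" where
  "frozen x w c m s = frozen_at x w c m (cell m s) + (w s - w (grid m (cell m s)))
     - c (grid m (cell m s)) * (s - grid m (cell m s))"

definition alive :: "real \<Rightarrow> (real \<Rightarrow> real) \<Rightarrow> (real \<Rightarrow> real) \<Rightarrow> nat \<Rightarrow> nat \<Rightarrow> bool" where
  "alive x w c m k \<longleftrightarrow> (\<forall>j\<le>k. 0 \<le> frozen_at x w c m j)"

definition reserve :: "real \<Rightarrow> (real \<Rightarrow> real) \<Rightarrow> (real \<Rightarrow> real) \<Rightarrow> real \<Rightarrow> real" where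
  "reserve x w c t = x + w t - integral {0..t} c"

definition ruin :: "real \<Rightarrow> (real \<Rightarrow> real) \<Rightarrow> (real \<Rightarrow> real) \<Rightarrow> ereal" where
  "ruin x w c = Inf (ereal ` {t. 0 \<le> t \<and> reserve x w c t < 0})"

locale ratchet_path =
  fixes x :: real and w c :: "real \<Rightarrow> real" and S :: "real set"
  assumes w_cont: "continuous_on {0..} w" and w0: "w 0 = 0" and x0: "0 \<le> x"
    and finS: "finite S" and Snn: "S \<subseteq> {0..}"
    and cS: "\<And>t. 0 \<le> t \<Longrightarrow> c t \<in> S" and c_mono: "mono_on {0..} c"
begin

abbreviation "Yg \<equiv> frozen_at x w c"
abbreviation "Ys \<equiv> frozen x w c"
abbreviation "X \<equiv> reserve x w c"

definition cb :: real where "cb = Max (insert 0 S)"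

lemma c_bounds: "0 \<le> t \<Longrightarrow> 0 \<le> c t \<and> c t \<le> cb"
  using cS[of t] finS Snn unfolding cb_def by (auto intro!: Max_ge)

lemma c_int: "0 \<le> a \<Longrightarrow> c integrable_on {a..b}"
  by (rule integrable_on_mono_on[OF monotone_on_subset[OF c_mono]]) auto

lemma c_integral_bounds:
  assumes "0 \<le> a" "a \<le> b"
  shows "c a * (b - a) \<le> integral {a..b} c" "integral {a..b} c \<le> c b * (b - a)"
proof -
  have "integral {a..b} (\<lambda>_. c a) \<le> integral {a..b} c"
    using assms by (intro integral_le c_int mono_onD[OF c_mono]) auto
  then show "c a * (b - a) \<le> integral {a..b} c" using assms by (simp add: mult.commute)
  have "integral {a..b} c \<le> integral {a..b} (\<lambda>_. c b)"
    using assms by (intro integral_le c_int mono_onD[OF c_mono]) auto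
  then show "integral {a..b} c \<le> c b * (b - a)" using assms by (simp add: mult.commute)
qed

lemma c_integral_split:
  "0 \<le> a \<Longrightarrow> a \<le> b \<Longrightarrow> integral {0..b} c = integral {0..a} c + integral {a..b} c"
  by (rule Henstock_Kurzweil_Integration.integral_combine[symmetric]) (auto intro: c_int)

text \<open>Left Riemann sums of a nondecreasing function lie below the integral, and the errors
  over the cells telescope to the total rise times the mesh.\<close>

lemma grid_riemann:
  "0 \<le> integral {0..grid m k} c - (\<Sum>j<k. c (grid m j)) * inverse (real (Suc m))"
  "integral {0..grid m k} c - (\<Sum>j<k. c (grid m j)) * inverse (real (Suc m)) \<le> (c (grid m k) - c 0) * inverse (real (Suc m))"
proof (induction k)
  case (Suc k)
  have s: "integral {0..grid m (Suc k)} c = integral {0..grid m k} c + integral {grid m k..grid m (Suc k)} c"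
    by (rule c_integral_split) (auto intro: grid_mono)
  have b: "c (grid m k) * inverse (real (Suc m)) \<le> integral {grid m k..grid m (Suc k)} c"
    "integral {grid m k..grid m (Suc k)} c \<le> c (grid m (Suc k)) * inverse (real (Suc m))"
    using c_integral_bounds[of "grid m k" "grid m (Suc k)"] by (auto simp: grid_Suc simp del: of_nat_Suc)
  {
    case 1
    show ?case using Suc.IH(1) b(1) unfolding s by (simp add: distrib_right del: of_nat_Suc)
  next
    case 2
    show ?case using Suc.IH(2) b(2) unfolding s by (simp add: distrib_right left_diff_distrib del: of_nat_Suc)
  }
qed auto

text \<open>Freezing at the left end pays less than the nondecreasing control, which gives the lower
  bound. The upper bound adds the Riemann error of the completed cells to that of the current cell;
  together they cost at most the total rise of the control times the mesh.\<close>

lemma frozen_ge_reserve: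
  assumes "0 \<le> s"
  shows "X s \<le> Ys m s" and "Ys m s \<le> X s + cb * inverse (real (Suc m))"
proof -
  define k where "k = cell m s"
  define d where "d = inverse (real (Suc m))"
  have k: "grid m k \<le> s" "s < grid m k + d" using cell_bounds[OF assms] by (auto simp: k_def d_def)
  have s: "integral {0..s} c = integral {0..grid m k} c + integral {grid m k..s} c"
    by (rule c_integral_split) (use k in auto)
  have b: "c (grid m k) * (s - grid m k) \<le> integral {grid m k..s} c" "integral {grid m k..s} c \<le> c s * (s - grid m k)"
    using c_integral_bounds[of "grid m k" s] k by auto
  have eq: "Ys m s - X s = (integral {0..grid m k} c - (\<Sum>j<k. c (grid m j)) * d) + (integral {grid m k..s} c - c (grid m k) * (s - grid m k))"
    unfolding frozen_def frozen_at_def reserve_def s k_def[symmetric] d_def by (simp add: algebra_simps)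
  have g: "0 \<le> integral {0..grid m k} c - (\<Sum>j<k. c (grid m j)) * d"
    "integral {0..grid m k} c - (\<Sum>j<k. c (grid m j)) * d \<le> (c (grid m k) - c 0) * d"
    using grid_riemann[of m k] unfolding d_def by blast+
  show "X s \<le> Ys m s" using eq g b by linarith
  have cc: "c (grid m k) \<le> c s" using k by (intro mono_onD[OF c_mono]) (auto intro: order_trans[OF grid_nonneg])
  have "(c s - c (grid m k)) * (s - grid m k) \<le> (c s - c (grid m k)) * d" using cc k by (intro mult_left_mono) auto
  then have "integral {grid m k..s} c - c (grid m k) * (s - grid m k) \<le> (c s - c (grid m k)) * d"
    using b(2) by (simp add: left_diff_distrib)
  then have "Ys m s - X s \<le> (c s - c 0) * d" using eq g(2) by (simp add: left_diff_distrib)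
  also have "\<dots> \<le> cb * d" using c_bounds[OF assms] c_bounds[of 0] by (intro mult_right_mono) (auto simp: d_def)
  finally show "Ys m s \<le> X s + cb * inverse (real (Suc m))" by (simp add: d_def)
qed

lemma frozen_grid: "Ys m (grid m k) = Yg m k"
  by (simp add: frozen_def)

lemma abs_frozen_sub_reserve: "0 \<le> s \<Longrightarrow> \<bar>Ys m s - X s\<bar> \<le> cb * inverse (real (Suc m))"
  using frozen_ge_reserve[of s m] by linarith

lemma frozen_tendsto: "0 \<le> s \<Longrightarrow> (\<lambda>m. Ys m s) \<longlonglongrightarrow> X s"
  by (rule LIM_zero_cancel, rule Lim_null_comparison[OF _ inverse_Suc_tendsto[of cb]])
     (use abs_frozen_sub_reserve in auto)

lemma X_cont: "continuous_on {0..} X"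
proof -
  have cT: "continuous_on {0..T} X" for T
    unfolding reserve_def[abs_def]
    by (intro continuous_on_diff continuous_on_add continuous_on_const continuous_on_subset[OF w_cont]
        indefinite_integral_continuous_1 c_int) auto
  have "continuous_on {0..<T} X" for T using cT[of T] by (rule continuous_on_subset) auto
  moreover have "{0..<T} = {0..} \<inter> {..<T}" for T :: real by auto
  ultimately have c: "continuous_on ({0..} \<inter> {..<T}) X" for T by metis
  show ?thesis
    unfolding continuous_on_eq_continuous_within
  proof
    fix t :: real assume t: "t \<in> {0..}"
    have "continuous (at t within {0..} \<inter> {..<t + 1}) X"
      using c[of "t + 1"] t by (auto simp: continuous_on_eq_continuous_within)
    moreover have eq: "at t within {0..} = at t within {0..} \<inter> {..<t + 1}"
      by (rule at_within_nhd[of t "{..<t + 1}"]) auto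
    ultimately show "continuous (at t within {0..}) X" by (simp only: eq)
  qed
qed

lemma reserve_nonneg_before_ruin:
  assumes "ereal s < ruin x w c" "0 \<le> u" "u \<le> s"
  shows "0 \<le> X u"
proof (rule ccontr)
  assume "\<not> 0 \<le> X u"
  then have "ruin x w c \<le> ereal u" unfolding ruin_def using assms by (intro Inf_lower) auto
  also have "\<dots> \<le> ereal s" using assms by simp
  finally show False using assms(1) by simp
qed

lemma alive_before_ruin:
  assumes "ereal s < ruin x w c" "0 \<le> s"
  shows "alive x w c m (cell m s)"
  unfolding alive_def
proof (intro allI impI)
  fix j assume "j \<le> cell m s"
  then have "grid m j \<le> grid m (cell m s)" by (rule grid_mono)
  also have "\<dots> \<le> s" by (rule cell_bounds[OF assms(2)])
  finally have "0 \<le> X (grid m j)" by (rule reserve_nonneg_before_ruin[OF assms(1) grid_nonneg])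
  also have "\<dots> \<le> Yg m j" using frozen_ge_reserve(1)[of "grid m j" m] by (simp add: frozen_grid)
  finally show "0 \<le> Yg m j" .
qed

lemma not_alive_after_ruin:
  assumes "ruin x w c < ereal s"
  shows "\<forall>\<^sub>F m in sequentially. \<not> alive x w c m (cell m s)"
proof -
  obtain u where u: "0 \<le> u" "u < s" "X u < 0"
    using assms unfolding ruin_def Inf_less_iff by auto
  have "isCont X' u" if "X' = (\<lambda>t. X (max 0 t))" for X'
  proof -
    have "continuous_on UNIV (\<lambda>t. X (max 0 t))"
      by (rule continuous_on_compose2[OF X_cont]) (auto intro!: continuous_intros)
    then show ?thesis using that by (auto simp: continuous_on_eq_continuous_at)
  qed
  then have "isCont (\<lambda>t. X (max 0 t)) u" by simp
  then obtain e where e: "0 < e" "\<And>t. \<bar>t - u\<bar> < e \<Longrightarrow> X (max 0 t) < X u / 2"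
  proof -
    have "\<forall>\<^sub>F t in nhds u. X (max 0 t) < X u / 2"
      using \<open>isCont (\<lambda>t. X (max 0 t)) u\<close>[unfolded continuous_within] u
      by (intro order_tendstoD(2)[OF isCont_tendsto_compose[OF \<open>isCont (\<lambda>t. X (max 0 t)) u\<close> filterlim_ident]]) auto
    then show thesis using that unfolding eventually_nhds_metric dist_real_def by blast
  qed
  define e' where "e' = min e (s - u)"
  have e': "0 < e'" using e u by (auto simp: e'_def)
  have "\<forall>\<^sub>F m in sequentially. 1 * inverse (real (Suc m)) < e'"
    using order_tendstoD(2)[OF inverse_Suc_tendsto[of 1] e'] .
  moreover have "\<forall>\<^sub>F m in sequentially. cb * inverse (real (Suc m)) < - X u / 2"
    using order_tendstoD(2)[OF inverse_Suc_tendsto[of cb], of "- X u / 2"] u by simp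
  ultimately show ?thesis
  proof eventually_elim
    case (elim m)
    \<comment> \<open>The first grid point strictly after \<open>u\<close>; it still lies before
      \<open>s\<close>, so survival at the cell of \<open>s\<close> would include it.\<close>
    define j where "j = Suc (cell m u)"
    have j: "u < grid m j" "grid m j < u + e'"
      using cell_bounds[OF u(1), of m] elim(1) by (auto simp: j_def grid_Suc simp del: of_nat_Suc)
    then have "X (max 0 (grid m j)) < X u / 2" using e(2)[of "grid m j"] by (auto simp: e'_def)
    then have "X (grid m j) < X u / 2" by (simp add: max_absorb2)
    moreover have "Yg m j \<le> X (grid m j) + cb * inverse (real (Suc m))"
      using frozen_ge_reserve(2)[of "grid m j" m] by (simp add: frozen_grid)
    ultimately have "Yg m j < 0" using elim(2) by linarith
    moreover have "j \<le> cell m s" using j by (intro grid_le_imp_le_cell) (auto simp: e'_def)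
    ultimately show ?case unfolding alive_def by (auto simp: not_le)
  qed
qed

text \<open>A convergent sequence with values in a finite set is eventually equal to its
  limit.\<close>

lemma control_eventually_const:
  assumes "0 < s" "isCont c s"
  shows "\<forall>\<^sub>F m in sequentially. c (grid m (cell m s)) = c s"
proof -
  have lim: "(\<lambda>m. c (grid m (cell m s))) \<longlonglongrightarrow> c s"
    using assms by (intro isCont_tendsto_compose[OF assms(2)] grid_cell_tendsto) auto
  have "open (- (S - {c s}))" using finS by (intro open_Compl finite_imp_closed) auto
  moreover have "c s \<in> - (S - {c s})" by auto
  ultimately have "\<forall>\<^sub>F m in sequentially. c (grid m (cell m s)) \<in> - (S - {c s})"
    using lim by (intro topological_tendstoD) auto
  then show ?thesis by eventually_elim (use cS in auto)
qed

lemma countable_discontinuities: "countable {s \<in> {0<..}. \<not> isCont c s}"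
  by (rule mono_on_ctble_discont_open[OF open_greaterThan]) (rule monotone_on_subset[OF c_mono], auto)

lemma uniform_grid:
  assumes "continuous_on {0..} \<phi>" "0 < (e::real)"
  shows "\<forall>\<^sub>F m in sequentially. \<forall>k<T * Suc m. \<bar>\<phi> (grid m (Suc k)) - \<phi> (grid m k)\<bar> \<le> e"
proof -
  have "uniformly_continuous_on {0..real T} \<phi>"
    by (rule compact_uniformly_continuous[OF continuous_on_subset[OF assms(1)]]) auto
  then obtain d where d: "0 < d" "\<And>s t. s \<in> {0..real T} \<Longrightarrow> t \<in> {0..real T} \<Longrightarrow> dist s t < d \<Longrightarrow> dist (\<phi> s) (\<phi> t) < e"
    using assms(2) unfolding uniformly_continuous_on_def by metis
  have "\<forall>\<^sub>F m in sequentially. 1 * inverse (real (Suc m)) < d"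
    using order_tendstoD(2)[OF inverse_Suc_tendsto[of 1] d(1)] .
  then show ?thesis
  proof (eventually_elim, intro allI impI)
    fix m k assume m: "1 * inverse (real (Suc m)) < d" and k: "k < T * Suc m"
    have "grid m (Suc k) \<le> grid m (T * Suc m)" using k by (intro grid_mono) simp
    then have "grid m (Suc k) \<in> {0..real T}" "grid m k \<in> {0..real T}"
      using grid_mono[of k "Suc k" m] unfolding grid_mult_Suc by auto
    then have "dist (\<phi> (grid m (Suc k))) (\<phi> (grid m k)) < e"
      using m by (intro d(2)) (auto simp: grid_Suc dist_real_def simp del: of_nat_Suc)
    then show "\<bar>\<phi> (grid m (Suc k)) - \<phi> (grid m k)\<bar> \<le> e" by (simp add: dist_real_def)
  qed
qed

lemma frozen_increment:
  assumes "0 < e"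
  shows "\<forall>\<^sub>F m in sequentially. \<forall>k<T * Suc m. \<bar>Yg m (Suc k) - Yg m k\<bar> \<le> e"
proof -
  have "\<forall>\<^sub>F m in sequentially. cb * inverse (real (Suc m)) < e / 2"
    using order_tendstoD(2)[OF inverse_Suc_tendsto[of cb], of "e / 2"] assms by simp
  moreover have "\<forall>\<^sub>F m in sequentially. \<forall>k<T * Suc m. \<bar>w (grid m (Suc k)) - w (grid m k)\<bar> \<le> e / 2"
    using assms by (intro uniform_grid w_cont) auto
  ultimately show ?thesis
  proof (eventually_elim, intro allI impI)
    fix m k assume a: "cb * inverse (real (Suc m)) < e / 2" "\<forall>k<T * Suc m. \<bar>w (grid m (Suc k)) - w (grid m k)\<bar> \<le> e / 2" "k < T * Suc m"
    have "Yg m (Suc k) - Yg m k = (w (grid m (Suc k)) - w (grid m k)) - c (grid m k) * inverse (real (Suc m))"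
      by (simp add: frozen_at_def distrib_right del: of_nat_Suc)
    moreover have "0 \<le> c (grid m k) * inverse (real (Suc m))" "c (grid m k) * inverse (real (Suc m)) \<le> cb * inverse (real (Suc m))"
      using c_bounds[of "grid m k"] by (auto intro!: mult_right_mono)
    ultimately show "\<bar>Yg m (Suc k) - Yg m k\<bar> \<le> e" using a by (smt (verit) field_sum_of_halves)
  qed
qed

lemma value_switch_small:
  fixes v :: "real \<Rightarrow> real \<Rightarrow> real"
  assumes lip: "\<And>a y y'. a \<in> S \<Longrightarrow> \<bar>v a y - v a y'\<bar> \<le> K * \<bar>y - y'\<bar>" and K: "0 \<le> K"
    and cont: "continuous_on {0..} (\<lambda>t. v (c t) (X t))" and e: "0 < e"
  shows "\<forall>\<^sub>F m in sequentially. \<forall>k<T * Suc m.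
    \<bar>v (c (grid m (Suc k))) (Yg m (Suc k)) - v (c (grid m k)) (Yg m (Suc k))\<bar> \<le> e"
proof -
  \<comment> \<open>The budget is one \<open>e'\<close> for the continuous value process, one
    \<open>K * e'\<close> for the new level, and two for the old level, whose argument also moves by
    one grid step.\<close>
  define e' where "e' = e / (1 + 3 * K)"
  have e': "0 < e'" "e' + 3 * K * e' = e" using e K by (auto simp: e'_def field_simps add_nonneg_eq_0_iff)
  have "\<forall>\<^sub>F m in sequentially. cb * inverse (real (Suc m)) < e'"
    using order_tendstoD(2)[OF inverse_Suc_tendsto[of cb]] e' by simp
  moreover have "\<forall>\<^sub>F m in sequentially. \<forall>k<T * Suc m. \<bar>v (c (grid m (Suc k))) (X (grid m (Suc k))) - v (c (grid m k)) (X (grid m k))\<bar> \<le> e'"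
    using uniform_grid[OF cont e'(1)] .
  moreover have "\<forall>\<^sub>F m in sequentially. \<forall>k<T * Suc m. \<bar>Yg m (Suc k) - Yg m k\<bar> \<le> e'"
    using frozen_increment[OF e'(1)] .
  ultimately show ?thesis
  proof (eventually_elim, intro allI impI)
    fix m k assume a: "cb * inverse (real (Suc m)) < e'"
      "\<forall>k<T * Suc m. \<bar>v (c (grid m (Suc k))) (X (grid m (Suc k))) - v (c (grid m k)) (X (grid m k))\<bar> \<le> e'"
      "\<forall>k<T * Suc m. \<bar>Yg m (Suc k) - Yg m k\<bar> \<le> e'" "k < T * Suc m"
    let ?a = "c (grid m (Suc k))" and ?b = "c (grid m k)"
    have S: "?a \<in> S" "?b \<in> S" by (auto intro: cS)
    have XY: "\<bar>Yg m j - X (grid m j)\<bar> \<le> e'" for j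
      using abs_frozen_sub_reserve[of "grid m j" m] a(1) by (simp add: frozen_grid)
    have "\<bar>v ?a (Yg m (Suc k)) - v ?a (X (grid m (Suc k)))\<bar> \<le> K * e'"
      using lip[OF S(1), of "Yg m (Suc k)" "X (grid m (Suc k))"] mult_left_mono[OF XY[of "Suc k"] K] by linarith
    moreover have "\<bar>v ?b (X (grid m k)) - v ?b (Yg m (Suc k))\<bar> \<le> K * (2 * e')"
    proof -
      have "\<bar>X (grid m k) - Yg m (Suc k)\<bar> \<le> 2 * e'" using XY[of k] a(3,4) by fastforce
      then show ?thesis using lip[OF S(2), of "X (grid m k)" "Yg m (Suc k)"] mult_left_mono[OF _ K] by fastforce
    qed
    moreover have "\<bar>v ?a (X (grid m (Suc k))) - v ?b (X (grid m k))\<bar> \<le> e'" using a(2,4) by blast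
    ultimately have "\<bar>v ?a (Yg m (Suc k)) - v ?b (Yg m (Suc k))\<bar> \<le> e' + 3 * K * e'" by linarith
    then show "\<bar>v ?a (Yg m (Suc k)) - v ?b (Yg m (Suc k))\<bar> \<le> e" using e'(2) by simp
  qed
qed

end

lemma finite_gap:
  fixes S :: "real set"
  assumes "finite S"
  obtains g where "0 < g" "\<And>a b. a \<in> S \<Longrightarrow> b \<in> S \<Longrightarrow> a < b \<Longrightarrow> g \<le> b - a"
proof -
  define D where "D = insert 1 ((\<lambda>(a, b). b - a) ` {p \<in> S \<times> S. fst p < snd p})"
  have D: "finite D" using assms unfolding D_def by auto
  have "0 < Min D" using D unfolding D_def by (subst Min_gr_iff) auto
  moreover have "Min D \<le> b - a" if "a \<in> S" "b \<in> S" "a < b" for a b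
    using D that unfolding D_def by (intro Min_le) (auto intro!: image_eqI[of _ _ "(a, b)"])
  ultimately show thesis by (rule that)
qed

text \<open>Each change raises the control by at least the gap \<open>g\<close>, while the total
  rise is at most \<open>cb\<close>.\<close>

lemma (in ratchet_path) switch_count:
  assumes g: "0 < g" "\<And>a b. a \<in> S \<Longrightarrow> b \<in> S \<Longrightarrow> a < b \<Longrightarrow> g \<le> b - a"
  shows "(\<Sum>k<N. if c (grid m (Suc k)) \<noteq> c (grid m k) then 1 else 0 :: real) \<le> cb / g"
proof -
  have "(\<Sum>k<N. if c (grid m (Suc k)) \<noteq> c (grid m k) then 1 else 0 :: real) \<le> (\<Sum>k<N. (c (grid m (Suc k)) - c (grid m k)) / g)"
  proof (rule sum_mono)
    fix k
    have le: "c (grid m k) \<le> c (grid m (Suc k))" by (intro mono_onD[OF c_mono] grid_mono) auto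
    show "(if c (grid m (Suc k)) \<noteq> c (grid m k) then 1 else 0) \<le> (c (grid m (Suc k)) - c (grid m k)) / g"
      using le g(1) g(2)[OF cS cS, of "grid m k" "grid m (Suc k)"] by (auto simp: field_simps)
  qed
  also have "\<dots> = (c (grid m N) - c (grid m 0)) / g"
    unfolding sum_divide_distrib[symmetric] by (subst sum_lessThan_telescope) simp
  also have "\<dots> \<le> cb / g" using c_bounds[of "grid m N"] c_bounds[of 0] g(1) by (intro divide_right_mono) auto
  finally show ?thesis .
qed

subsection \<open>The discounted value along the frozen surplus\<close>

lemma measurable_finite_index:
  fixes f :: "'b \<Rightarrow> real"
  assumes "f \<in> measurable N (count_space S)" "finite S" "\<And>c. c \<in> S \<Longrightarrow> H c \<in> borel_measurable borel"
    and [measurable]: "y \<in> borel_measurable N"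
  shows "(\<lambda>p. H (f p) (y p) :: real) \<in> borel_measurable N"
proof (rule measurable_compose_countable'[of S "\<lambda>c p. H c (y p)"])
  show "(\<lambda>p. H c (y p)) \<in> borel_measurable N" if "c \<in> S" for c
    by (rule measurable_compose[OF assms(4) assms(3)[OF that]])
qed (use assms in \<open>auto intro: countable_finite\<close>)

lemma bounded_set_integrable:
  fixes f :: "real \<Rightarrow> real"
  assumes [measurable]: "f \<in> borel_measurable borel" and "\<And>s. s \<in> {a..b} \<Longrightarrow> \<bar>f s\<bar> \<le> B"
  shows "set_integrable lborel {a..b} f"
  unfolding set_integrable_def
proof (rule Bochner_Integration.integrable_bound)
  show "integrable lborel (\<lambda>s. indicat_real {a..b} s * B)"
    by (intro integrable_mult_left integrable_real_indicator) (auto simp: emeasure_lborel_Icc_eq)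
  show "AE s in lborel. norm (indicat_real {a..b} s *\<^sub>R f s) \<le> norm (indicat_real {a..b} s * B)"
    using assms(2) by (intro always_eventually allI) (auto simp: indicator_def intro: order_trans[OF _ abs_ge_self])
qed measurable

lemma (in prob_space) bounded_inner_integrable:
  fixes h :: "'a \<Rightarrow> real \<Rightarrow> real"
  assumes [measurable]: "(\<lambda>(\<omega>, s). h \<omega> s) \<in> borel_measurable (M \<Otimes>\<^sub>M borel)"
    and B: "\<And>\<omega> s. \<omega> \<in> space M \<Longrightarrow> s \<in> {a..b} \<Longrightarrow> \<bar>h \<omega> s\<bar> \<le> B"
  shows "(\<lambda>\<omega>. LINT s:{a..b}|lborel. h \<omega> s) \<in> borel_measurable M"
    and "\<omega> \<in> space M \<Longrightarrow> a \<le> b \<Longrightarrow> \<bar>LINT s:{a..b}|lborel. h \<omega> s\<bar> \<le> B * (b - a)"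
    and "\<omega> \<in> space M \<Longrightarrow> set_integrable lborel {a..b} (h \<omega>)"
proof -
  have [measurable]: "(\<lambda>(\<omega>, s). h \<omega> s) \<in> borel_measurable (M \<Otimes>\<^sub>M lborel)"
    using assms(1) by simp
  show "(\<lambda>\<omega>. LINT s:{a..b}|lborel. h \<omega> s) \<in> borel_measurable M"
    unfolding set_lebesgue_integral_def by measurable
  assume \<omega>: "\<omega> \<in> space M"
  have hm: "h \<omega> \<in> borel_measurable borel"
    using measurable_compose[OF measurable_Pair1'[OF \<omega>] assms(1)] by simp
  show si: "set_integrable lborel {a..b} (h \<omega>)"
    by (rule bounded_set_integrable[OF hm B[OF \<omega>]])
  assume ab: "a \<le> b"
  have "\<bar>LINT s:{a..b}|lborel. h \<omega> s\<bar> \<le> (LINT s:{a..b}|lborel. \<bar>h \<omega> s\<bar>)"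
    using set_integral_norm_bound[OF si] by simp
  also have "\<dots> \<le> (LINT s:{a..b}|lborel. B)"
    by (rule set_integral_mono[OF set_integrable_abs[OF si] bounded_set_integrable[of _ _ _ "\<bar>B\<bar>"]]) (use B[OF \<omega>] in simp_all)
  also have "\<dots> = B * (b - a)" using ab by (simp add: set_lebesgue_integral_def)
  finally show "\<bar>LINT s:{a..b}|lborel. h \<omega> s\<bar> \<le> B * (b - a)" .
qed

lemma sum_grid_integrals:
  fixes f :: "real \<Rightarrow> real"
  assumes "\<And>a b. 0 \<le> a \<Longrightarrow> set_integrable lborel {a..b} f"
  shows "(\<Sum>k<N. LINT s:{grid m k..grid m (Suc k)}|lborel. f s) = (LINT s:{0..grid m N}|lborel. f s)"
proof (induction N)
  case 0
  show ?case using set_borel_integral_eq_integral(2)[OF assms, of 0 0] by simp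
next
  case (Suc N)
  note i = set_borel_integral_eq_integral[OF assms]
  have "integral {0..grid m N} f + integral {grid m N..grid m (Suc N)} f = integral {0..grid m (Suc N)} f"
    by (rule Henstock_Kurzweil_Integration.integral_combine) (auto intro: grid_mono i(1))
  then show ?case using Suc by (simp add: i(2))
qed

lemma set_integral_shift:
  fixes f :: "real \<Rightarrow> real"
  shows "(LINT s:{t..t + d}|lborel. f s) = (LINT s:{0..d}|lborel. f (t + s))"
proof -
  have "(LINT s:{t..t + d}|lborel. f s) = (LINT s|lborel. indicator {t..t + d} (t + 1 * s) *\<^sub>R f (t + 1 * s))"
    unfolding set_lebesgue_integral_def by (subst lborel_integral_real_affine[of 1 _ t]) auto
  also have "\<dots> = (LINT s:{0..d}|lborel. f (t + s))"
    unfolding set_lebesgue_integral_def by (intro Bochner_Integration.integral_cong) (auto simp: indicator_def)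
  finally show ?thesis .
qed

text \<open>An arbitrary ratchet control together with an arbitrary family of regular functions.
  Sign, monotonicity and the equation enter only in \<open>upper_bound\<close> and
  \<open>lower_bound\<close>, so both share one telescoping identity.\<close>

locale ratchet_control = bm_filtration M W F + dividend_model \<mu> \<sigma> q
  for M :: "'a measure" and W :: "real \<Rightarrow> 'a \<Rightarrow> real" and F :: "real \<Rightarrow> 'a set set" and \<mu> \<sigma> q :: real +
  fixes x :: real and S :: "real set" and C :: "real \<Rightarrow> 'a \<Rightarrow> real"
    and V V1 V2 :: "real \<Rightarrow> real \<Rightarrow> real"
  assumes x_nonneg: "0 \<le> x" and S_fin: "finite S" and S_nn: "S \<subseteq> {0..}"
    and C_adapted: "\<And>t B. 0 \<le> t \<Longrightarrow> B \<in> sets borel \<Longrightarrow> C t -` B \<inter> space M \<in> F t"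
    and C_in: "\<And>\<omega> t. \<omega> \<in> space M \<Longrightarrow> 0 \<le> t \<Longrightarrow> C t \<omega> \<in> S"
    and C_mono: "\<And>\<omega>. \<omega> \<in> space M \<Longrightarrow> mono_on {0..} (\<lambda>t. C t \<omega>)"
    and V_regular: "\<And>c. c \<in> S \<Longrightarrow> regular (V c) (V1 c) (V2 c)"
begin

abbreviation drv :: "'a \<Rightarrow> real \<Rightarrow> real" where "drv \<omega> t \<equiv> \<mu> * t + \<sigma> * W t \<omega>"
abbreviation ctl :: "'a \<Rightarrow> real \<Rightarrow> real" where "ctl \<omega> t \<equiv> C t \<omega>"
abbreviation Cg :: "nat \<Rightarrow> nat \<Rightarrow> 'a \<Rightarrow> real" where "Cg m k \<omega> \<equiv> C (grid m k) \<omega>"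
abbreviation YG :: "nat \<Rightarrow> nat \<Rightarrow> 'a \<Rightarrow> real" where "YG m k \<omega> \<equiv> frozen_at x (drv \<omega>) (ctl \<omega>) m k"
abbreviation AL :: "nat \<Rightarrow> nat \<Rightarrow> 'a \<Rightarrow> bool" where "AL m k \<omega> \<equiv> alive x (drv \<omega>) (ctl \<omega>) m k"

definition Qf :: "real \<Rightarrow> real \<Rightarrow> real" where "Qf c y = gen c (V c y) (V1 c y) (V2 c y)"

definition Yk :: "nat \<Rightarrow> nat \<Rightarrow> real \<Rightarrow> 'a \<Rightarrow> real" where
  "Yk m k s \<omega> = YG m k \<omega> + (\<mu> - Cg m k \<omega>) * (s - grid m k) + \<sigma> * (W (max 0 s) \<omega> - W (grid m k) \<omega>)"

definition qk :: "nat \<Rightarrow> nat \<Rightarrow> 'a \<Rightarrow> real \<Rightarrow> real" where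
  "qk m k \<omega> s = (if AL m k \<omega> then exp (- q * s) * Qf (Cg m k \<omega>) (Yk m k s \<omega>) else 0)"

definition pk :: "nat \<Rightarrow> nat \<Rightarrow> 'a \<Rightarrow> real \<Rightarrow> real" where
  "pk m k \<omega> s = (if AL m k \<omega> then exp (- q * s) * Cg m k \<omega> else 0)"

definition qm :: "nat \<Rightarrow> 'a \<Rightarrow> real \<Rightarrow> real" where "qm m \<omega> s = qk m (cell m s) \<omega> s"

definition pm :: "nat \<Rightarrow> 'a \<Rightarrow> real \<Rightarrow> real" where "pm m \<omega> s = pk m (cell m s) \<omega> s"

text \<open>\<open>av\<close> is the discounted value at the start of cell \<open>k\<close>;
  \<open>bv\<close> below is the value at its end, still with the level and the survival status of
  the start. The change from \<open>bv m k\<close> to \<open>av m (Suc k)\<close> is therefore due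
  only to switching and stopping.\<close>

definition av :: "nat \<Rightarrow> nat \<Rightarrow> 'a \<Rightarrow> real" where
  "av m k \<omega> = (if AL m k \<omega> then exp (- q * grid m k) * V (Cg m k \<omega>) (YG m k \<omega>) else 0)"

definition bv :: "nat \<Rightarrow> nat \<Rightarrow> 'a \<Rightarrow> real" where
  "bv m k \<omega> = (if AL m k \<omega> then exp (- q * grid m (Suc k)) * V (Cg m k \<omega>) (YG m (Suc k) \<omega>) else 0)"

text \<open>The sum of all effects of switching levels and of stopping at grid points.\<close>

definition Rm :: "nat \<Rightarrow> nat \<Rightarrow> 'a \<Rightarrow> real" where
  "Rm m N \<omega> = (\<Sum>k<N. av m (Suc k) \<omega> - bv m k \<omega>)"

lemma path: "\<omega> \<in> space M \<Longrightarrow> ratchet_path x (drv \<omega>) (ctl \<omega>) S"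
proof (rule ratchet_path.intro)
  assume \<omega>: "\<omega> \<in> space M"
  show "continuous_on {0..} (drv \<omega>)"
    by (intro continuous_on_add continuous_on_mult continuous_on_const continuous_on_id W_cont[OF \<omega>])
  show "drv \<omega> 0 = 0" using W_zero[OF \<omega>] by simp
  show "ctl \<omega> t \<in> S" if "0 \<le> t" for t by (rule C_in[OF \<omega> that])
  show "mono_on {0..} (ctl \<omega>)" by (rule C_mono[OF \<omega>])
qed (use x_nonneg S_fin S_nn in simp_all)

lemma C_count: "0 \<le> t \<Longrightarrow> C t \<in> measurable (Fm t) (count_space S)"
  unfolding measurable_count_space_eq2[OF S_fin] using C_in C_adapted[of t "{_}"] by simp

lemma C_Fm: "0 \<le> s \<Longrightarrow> s \<le> t \<Longrightarrow> C s \<in> borel_measurable (Fm t)"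
  by (rule measurable_Fm_mono[of _ s], rule measurableI) (use C_adapted in simp_all)

lemma YG_Fm: "grid m k \<le> t \<Longrightarrow> YG m k \<in> borel_measurable (Fm t)"
  unfolding frozen_at_def
  by (intro borel_measurable_diff borel_measurable_add borel_measurable_times borel_measurable_const
      borel_measurable_sum W_Fm C_Fm grid_nonneg) (auto intro: order_trans[OF grid_mono[OF less_imp_le]])

lemma AL_F: "{\<omega>\<in>space M. AL m k \<omega>} \<in> F (grid m k)"
proof -
  have "{\<omega>\<in>space M. 0 \<le> YG m j \<omega>} \<in> F (grid m k)" if "j \<le> k" for j
  proof -
    have "YG m j \<in> borel_measurable (Fm (grid m k))" by (rule YG_Fm) (rule grid_mono[OF that])
    from measurable_sets[OF this, of "{0..}"] show ?thesis by (simp add: vimage_def Int_def conj_commute)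
  qed
  then have "{\<omega>\<in>space (Fm (grid m k)). \<forall>j\<in>{..k}. 0 \<le> YG m j \<omega>} \<in> sets (Fm (grid m k))"
    by (intro sets.sets_Collect_finite_All) auto
  then show ?thesis by (simp add: alive_def Ball_def)
qed

lemma grid_measurable:
  shows "Cg m k \<in> measurable M (count_space S)" "C (grid m k) \<in> borel_measurable M"
    "YG m k \<in> borel_measurable M" "Measurable.pred M (AL m k)"
proof -
  show "Cg m k \<in> measurable M (count_space S)" by (rule measurable_Fm[OF C_count]) simp
  show "C (grid m k) \<in> borel_measurable M" by (rule measurable_Fm[OF C_Fm[OF grid_nonneg order_refl]])
  show "YG m k \<in> borel_measurable M" by (rule measurable_Fm[OF YG_Fm[OF order_refl]])
  show "Measurable.pred M (AL m k)" unfolding pred_def using AL_F[of m k] F_sub[of "grid m k"] by (rule rev_subsetD)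
qed

text \<open>With finitely many levels, the sum of the bounds for the single levels serves all of
  them at once, also as a Lipschitz constant.\<close>

lemma uniform_bound:
  obtains K where "0 \<le> K" "\<And>c. c \<in> S \<Longrightarrow> c \<le> K" "\<And>c y. c \<in> S \<Longrightarrow> \<bar>V c y\<bar> \<le> K" "\<And>c y. c \<in> S \<Longrightarrow> \<bar>Qf c y\<bar> \<le> K"
    "\<And>c y y'. c \<in> S \<Longrightarrow> \<bar>V c y - V c y'\<bar> \<le> K * \<bar>y - y'\<bar>"
proof -
  have "\<forall>c\<in>S. \<exists>B. 0 \<le> B \<and> (\<forall>y. \<bar>V c y\<bar> \<le> B \<and> \<bar>V1 c y\<bar> \<le> B \<and> \<bar>V2 c y\<bar> \<le> B)"
    using regular_bound[OF V_regular] by metis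
  then obtain B where B: "\<And>c. c \<in> S \<Longrightarrow> 0 \<le> B c"
    "\<And>c y. c \<in> S \<Longrightarrow> \<bar>V c y\<bar> \<le> B c \<and> \<bar>V1 c y\<bar> \<le> B c \<and> \<bar>V2 c y\<bar> \<le> B c" by metis
  define k where "k c = \<sigma>\<^sup>2 / 2 * B c + \<bar>\<mu> - c\<bar> * B c + q * B c + c + B c" for c
  have kn: "0 \<le> c" "0 \<le> k c" "B c \<le> k c" "c \<le> k c" if "c \<in> S" for c
    using B(1)[OF that] S_nn that q_pos unfolding k_def by auto
  have kS: "k c \<le> (\<Sum>c\<in>S. k c)" if "c \<in> S" for c
    using that kn by (intro member_le_sum S_fin) auto
  have Qk: "\<bar>Qf c y\<bar> \<le> k c" if "c \<in> S" for c y
  proof -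
    have "\<bar>Qf c y\<bar> \<le> \<bar>\<sigma>\<^sup>2 / 2 * V2 c y\<bar> + \<bar>(\<mu> - c) * V1 c y\<bar> + \<bar>q * V c y\<bar> + \<bar>c\<bar>"
      unfolding Qf_def gen_def by linarith
    also have "\<dots> \<le> \<sigma>\<^sup>2 / 2 * B c + \<bar>\<mu> - c\<bar> * B c + q * B c + c"
      using B(2)[OF that, of y] q_pos kn(1)[OF that] unfolding abs_mult
      by (intro add_mono mult_mono) auto
    finally show ?thesis using B(1)[OF that] by (simp add: k_def)
  qed
  have lip: "\<bar>V c y - V c y'\<bar> \<le> B c * \<bar>y - y'\<bar>" if "c \<in> S" for c y y'
    using field_differentiable_bound[of UNIV "V c" "V1 c" "B c" y y'] regularD(1)[OF V_regular[OF that]] B(2)[OF that]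
    by (simp add: has_field_derivative_at_within)
  show thesis
  proof (rule that[of "\<Sum>c\<in>S. k c"])
    show "0 \<le> (\<Sum>c\<in>S. k c)" using kn by (intro sum_nonneg) auto
    show "\<bar>V c y - V c y'\<bar> \<le> (\<Sum>c\<in>S. k c) * \<bar>y - y'\<bar>" if "c \<in> S" for c y y'
      using lip[OF that, of y y'] mult_right_mono[OF order_trans[OF kn(3)[OF that] kS[OF that]], of "\<bar>y - y'\<bar>"] by simp
    fix c y assume c: "c \<in> S"
    show "c \<le> (\<Sum>c\<in>S. k c)" using kn(4)[OF c] kS[OF c] by linarith
    show "\<bar>V c y\<bar> \<le> (\<Sum>c\<in>S. k c)" using B(2)[OF c, of y] kn(3)[OF c] kS[OF c] by linarith
    show "\<bar>Qf c y\<bar> \<le> (\<Sum>c\<in>S. k c)" using Qk[OF c, of y] kS[OF c] by linarith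
  qed
qed

lemma V_measurable: "c \<in> S \<Longrightarrow> V c \<in> borel_measurable borel" "c \<in> S \<Longrightarrow> Qf c \<in> borel_measurable borel"
proof -
  assume c: "c \<in> S"
  note [measurable] = regularD(3-5)[OF V_regular[OF c]]
  show "V c \<in> borel_measurable borel" "Qf c \<in> borel_measurable borel"
    unfolding Qf_def[abs_def] gen_def by measurable
qed

lemma av_measurable [measurable]: "av m k \<in> borel_measurable M"
  and bv_measurable [measurable]: "bv m k \<in> borel_measurable M"
proof -
  note [measurable] = grid_measurable
  have [measurable]: "(\<lambda>\<omega>. V (Cg m k \<omega>) (YG m j \<omega>)) \<in> borel_measurable M" for j
    by (rule measurable_finite_index[OF grid_measurable(1) S_fin V_measurable(1)]) (auto intro: grid_measurable)
  show "av m k \<in> borel_measurable M" "bv m k \<in> borel_measurable M"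
    unfolding av_def[abs_def] bv_def[abs_def] by measurable
qed

lemma Rm_measurable [measurable]: "Rm m N \<in> borel_measurable M"
  unfolding Rm_def[abs_def] by measurable

lemma qm_measurable [measurable]: "(\<lambda>(\<omega>, s). qm m \<omega> s) \<in> borel_measurable (M \<Otimes>\<^sub>M borel)"
  and pm_measurable [measurable]: "(\<lambda>(\<omega>, s). pm m \<omega> s) \<in> borel_measurable (M \<Otimes>\<^sub>M borel)"
proof -
  have [measurable]: "cell m \<in> measurable borel (count_space UNIV)"
    unfolding cell_def[abs_def] by measurable
  have cell: "(\<lambda>p. cell m (snd p)) \<in> measurable (M \<Otimes>\<^sub>M borel) (count_space UNIV)" by measurable
  note [measurable] = grid_measurable
  have W [measurable]: "W (grid m k) \<in> borel_measurable M" for k by (rule W_measurable) simp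
  have Yk [measurable]: "(\<lambda>p. Yk m k (snd p) (fst p)) \<in> borel_measurable (M \<Otimes>\<^sub>M borel)" for k
    unfolding Yk_def by measurable
  have [measurable]: "(\<lambda>p. Qf (Cg m k (fst p)) (Yk m k (snd p) (fst p))) \<in> borel_measurable (M \<Otimes>\<^sub>M borel)" for k
    by (rule measurable_finite_index[OF measurable_compose[OF measurable_fst grid_measurable(1)] S_fin V_measurable(2) Yk])
  have "(\<lambda>p. qk m (cell m (snd p)) (fst p) (snd p)) \<in> borel_measurable (M \<Otimes>\<^sub>M borel)"
    by (rule measurable_compose_countable[OF _ cell, of "\<lambda>k p. qk m k (fst p) (snd p)"]) (unfold qk_def, measurable)
  then show "(\<lambda>(\<omega>, s). qm m \<omega> s) \<in> borel_measurable (M \<Otimes>\<^sub>M borel)"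
    by (simp add: qm_def case_prod_beta)
  have "(\<lambda>p. pk m (cell m (snd p)) (fst p) (snd p)) \<in> borel_measurable (M \<Otimes>\<^sub>M borel)"
    by (rule measurable_compose_countable[OF _ cell, of "\<lambda>k p. pk m k (fst p) (snd p)"]) (unfold pk_def, measurable)
  then show "(\<lambda>(\<omega>, s). pm m \<omega> s) \<in> borel_measurable (M \<Otimes>\<^sub>M borel)"
    by (simp add: pm_def case_prod_beta)
qed

lemma discount_le_one: "0 \<le> s \<Longrightarrow> exp (- q * s) \<le> 1"
  using q_pos by simp

lemma abs_discount_le: "0 \<le> s \<Longrightarrow> \<bar>y\<bar> \<le> K \<Longrightarrow> \<bar>exp (- q * s) * y\<bar> \<le> K"
  using mult_mono[OF discount_le_one[of s], of "\<bar>y\<bar>" K] by (simp add: abs_mult)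

lemma abs_qm_pm_le:
  assumes K: "\<And>c. c \<in> S \<Longrightarrow> c \<le> K" "\<And>c y. c \<in> S \<Longrightarrow> \<bar>Qf c y\<bar> \<le> K" "0 \<le> K" and "\<omega> \<in> space M" "0 \<le> s"
  shows "\<bar>qm m \<omega> s\<bar> \<le> K" "\<bar>pm m \<omega> s\<bar> \<le> K" "0 \<le> pm m \<omega> s"
proof -
  have "Cg m (cell m s) \<omega> \<in> S" using C_in assms by auto
  then have "\<bar>Qf (Cg m (cell m s) \<omega>) y\<bar> \<le> K" "\<bar>Cg m (cell m s) \<omega>\<bar> \<le> K" "0 \<le> Cg m (cell m s) \<omega>" for y
    using K S_nn by auto
  then have "\<bar>exp (- q * s) * Qf (Cg m (cell m s) \<omega>) y\<bar> \<le> K" "\<bar>exp (- q * s) * Cg m (cell m s) \<omega>\<bar> \<le> K"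
    "0 \<le> exp (- q * s) * Cg m (cell m s) \<omega>" for y
    using abs_discount_le[OF assms(5)] by (blast, blast, simp)
  then show "\<bar>qm m \<omega> s\<bar> \<le> K" "\<bar>pm m \<omega> s\<bar> \<le> K" "0 \<le> pm m \<omega> s"
    using assms(3) unfolding qm_def pm_def qk_def pk_def by (auto simp only: abs_zero split: if_splits)
qed

lemma abs_av_bv_le:
  assumes K: "\<And>c y. c \<in> S \<Longrightarrow> \<bar>V c y\<bar> \<le> K" "0 \<le> K" and "\<omega> \<in> space M"
  shows "\<bar>av m k \<omega>\<bar> \<le> K" "\<bar>bv m k \<omega>\<bar> \<le> K"
  using abs_discount_le[OF grid_nonneg K(1)] C_in[OF assms(3) grid_nonneg] K(2) unfolding av_def bv_def by auto

lemma av_bv_integrable [simp]: "integrable M (av m k)" "integrable M (bv m k)"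
proof -
  obtain K where K: "0 \<le> K" "\<And>c y. c \<in> S \<Longrightarrow> \<bar>V c y\<bar> \<le> K" using uniform_bound by metis
  show "integrable M (av m k)" "integrable M (bv m k)"
    using abs_av_bv_le[OF K(2,1)] by (auto intro!: integrable_const_bound[of _ K] AE_I2)
qed

text \<open>It translates the integrand of \<open>dynkin_step\<close>, which starts its clock at
  zero, into absolute time; the factor \<open>exp (q * grid m k)\<close> undoes the discounting up
  to the cell. Subtracting \<open>pm\<close> removes the payment contained in
  \<open>Qf\<close>.\<close>

lemma cell_integral:
  assumes \<omega>: "\<omega> \<in> space M" and AL: "AL m k \<omega>" and c: "Cg m k \<omega> = c"
  defines "d \<equiv> inverse (real (Suc m))"
  shows "(LINT s:{0..d}|lborel. exp (- q * s) * (\<sigma>\<^sup>2 / 2 * V2 c (YG m k \<omega> + (\<mu> - c) * s + \<sigma> * (W (grid m k + s) \<omega> - W (grid m k) \<omega>))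
      + (\<mu> - c) * V1 c (YG m k \<omega> + (\<mu> - c) * s + \<sigma> * (W (grid m k + s) \<omega> - W (grid m k) \<omega>))
      - q * V c (YG m k \<omega> + (\<mu> - c) * s + \<sigma> * (W (grid m k + s) \<omega> - W (grid m k) \<omega>)))) =
    exp (q * grid m k) * (LINT s:{grid m k..grid m (Suc k)}|lborel. qm m \<omega> s - pm m \<omega> s)" (is "(LINT s:_|_. ?h s) = _")
proof -
  have "(LINT s:{grid m k..grid m (Suc k)}|lborel. qm m \<omega> s - pm m \<omega> s)
    = (LINT s:{0..d}|lborel. qm m \<omega> (grid m k + s) - pm m \<omega> (grid m k + s))"
    unfolding grid_Suc d_def by (rule set_integral_shift)
  then have "exp (q * grid m k) * (LINT s:{grid m k..grid m (Suc k)}|lborel. qm m \<omega> s - pm m \<omega> s) =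
      (LINT s:{0..d}|lborel. exp (q * grid m k) * (qm m \<omega> (grid m k + s) - pm m \<omega> (grid m k + s)))"
    by simp
  also have "\<dots> = (LINT s:{0..d}|lborel. ?h s)"
  proof -
    \<comment> \<open>Half-open on the right: the right end point belongs to the next cell, so the
      integrands agree only almost everywhere.\<close>
    have eq: "exp (q * grid m k) * (qm m \<omega> (grid m k + s) - pm m \<omega> (grid m k + s)) = ?h s" if "s \<in> {0..<d}" for s
    proof -
      have cell: "cell m (grid m k + s) = k" using that by (intro cell_eqI) (auto simp: grid_Suc d_def)
      have max: "max 0 (grid m k + s) = grid m k + s" using that grid_nonneg[of m k] by (auto simp: max_def)
      have e: "exp (q * grid m k) * exp (- q * (grid m k + s)) = exp (- q * s)"
        by (simp add: exp_add[symmetric] algebra_simps)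
      have Y: "Yk m k (grid m k + s) \<omega> = YG m k \<omega> + (\<mu> - c) * s + \<sigma> * (W (grid m k + s) \<omega> - W (grid m k) \<omega>)"
        by (simp add: Yk_def max c)
      have "qm m \<omega> (grid m k + s) = exp (- q * (grid m k + s)) * Qf c (Yk m k (grid m k + s) \<omega>)"
        "pm m \<omega> (grid m k + s) = exp (- q * (grid m k + s)) * c"
        unfolding qm_def pm_def cell qk_def pk_def using AL c by simp_all
      then have "exp (q * grid m k) * (qm m \<omega> (grid m k + s) - pm m \<omega> (grid m k + s)) =
        exp (q * grid m k) * exp (- q * (grid m k + s)) * (Qf c (Yk m k (grid m k + s) \<omega>) - c)"
        by (simp only: right_diff_distrib mult.assoc)
      also have "\<dots> = ?h s"
        unfolding e Y Qf_def gen_def by simp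
      finally show ?thesis .
    qed
    define h' where "h' s = exp (- q * s) * (Qf c (YG m k \<omega> + (\<mu> - c) * s + \<sigma> * (W (max 0 (grid m k + s)) \<omega> - W (grid m k) \<omega>)) - c)" for s
    have h': "?h s = h' s" if "s \<in> {0..d}" for s
    proof -
      have max: "max 0 (grid m k + s) = grid m k + s" using that grid_nonneg[of m k] by (auto simp: max_def)
      show ?thesis unfolding h'_def max Qf_def gen_def by simp
    qed
    have cS: "c \<in> S" using C_in[OF \<omega> grid_nonneg] c by blast
    note [measurable] = V_measurable(2)[OF cS]
    have "(\<lambda>s. W (max 0 s) \<omega>) \<in> borel_measurable borel"
      using measurable_compose[OF measurable_Pair1'[OF \<omega>] W_joint_measurable] by simp
    then have [measurable]: "(\<lambda>s. W (max 0 (grid m k + s)) \<omega>) \<in> borel_measurable borel"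
      by (rule measurable_compose[rotated]) simp
    have [measurable]: "h' \<in> borel_measurable borel" unfolding h'_def by measurable
    have [measurable]: "qm m \<omega> \<in> borel_measurable borel" "pm m \<omega> \<in> borel_measurable borel"
      using measurable_compose[OF measurable_Pair1'[OF \<omega>] qm_measurable] measurable_compose[OF measurable_Pair1'[OF \<omega>] pm_measurable]
      by simp_all
    have "(LINT s:{0..d}|lborel. exp (q * grid m k) * (qm m \<omega> (grid m k + s) - pm m \<omega> (grid m k + s))) = (LINT s:{0..d}|lborel. h' s)"
    proof (rule set_lebesgue_integral_cong_AE)
      have "AE s in lborel. s \<noteq> d" by (rule AE_lborel_singleton)
      then show "AE s\<in>{0..d} in lborel. exp (q * grid m k) * (qm m \<omega> (grid m k + s) - pm m \<omega> (grid m k + s)) = h' s"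
      proof eventually_elim
        case (elim s)
        show ?case
        proof
          assume s: "s \<in> {0..d}"
          then have "s \<in> {0..<d}" using elim by auto
          from eq[OF this] h'[OF s] show "exp (q * grid m k) * (qm m \<omega> (grid m k + s) - pm m \<omega> (grid m k + s)) = h' s"
            by (simp only:)
        qed
      qed
    qed measurable
    also have "\<dots> = (LINT s:{0..d}|lborel. ?h s)"
      by (rule set_lebesgue_integral_cong) (use h' in simp_all)
    finally show ?thesis .
  qed
  finally show ?thesis ..
qed

end

section \<open>Expected change over a cell and its sum over the grid\<close>

context ratchet_control
begin

lemma alive_mono: "alive x w c m k \<Longrightarrow> j \<le> k \<Longrightarrow> alive x w c m j"
  by (auto simp: alive_def)

lemma uniform_cell_bounds:
  obtains K where "0 \<le> K" "\<And>m \<omega> s. \<omega> \<in> space M \<Longrightarrow> 0 \<le> s \<Longrightarrow> \<bar>qm m \<omega> s\<bar> \<le> K"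
    "\<And>m \<omega> s. \<omega> \<in> space M \<Longrightarrow> 0 \<le> s \<Longrightarrow> \<bar>pm m \<omega> s\<bar> \<le> K"
    "\<And>m k \<omega>. \<omega> \<in> space M \<Longrightarrow> \<bar>av m k \<omega>\<bar> \<le> K"
    "\<And>c y. c \<in> S \<Longrightarrow> \<bar>V c y\<bar> \<le> K" "\<And>c y y'. c \<in> S \<Longrightarrow> \<bar>V c y - V c y'\<bar> \<le> K * \<bar>y - y'\<bar>"
proof -
  obtain K where K: "0 \<le> K" "\<And>c. c \<in> S \<Longrightarrow> c \<le> K" "\<And>c y. c \<in> S \<Longrightarrow> \<bar>V c y\<bar> \<le> K" "\<And>c y. c \<in> S \<Longrightarrow> \<bar>Qf c y\<bar> \<le> K"
    "\<And>c y y'. c \<in> S \<Longrightarrow> \<bar>V c y - V c y'\<bar> \<le> K * \<bar>y - y'\<bar>" using uniform_bound by metis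
  show thesis
    by (rule that[OF K(1) abs_qm_pm_le(1)[OF K(2,4,1)] abs_qm_pm_le(2)[OF K(2,4,1)] abs_av_bv_le(1)[OF K(3,1)] K(3,5)])
qed

lemma qm_pm_inner_integrable:
  assumes "0 \<le> a"
  shows "(\<lambda>\<omega>. LINT s:{a..b}|lborel. qm m \<omega> s) \<in> borel_measurable M"
    "(\<lambda>\<omega>. LINT s:{a..b}|lborel. pm m \<omega> s) \<in> borel_measurable M"
    "\<omega> \<in> space M \<Longrightarrow> set_integrable lborel {a..b} (qm m \<omega>)"
    "\<omega> \<in> space M \<Longrightarrow> set_integrable lborel {a..b} (pm m \<omega>)"
    "a \<le> b \<Longrightarrow> integrable M (\<lambda>\<omega>. LINT s:{a..b}|lborel. qm m \<omega> s)"
    "a \<le> b \<Longrightarrow> integrable M (\<lambda>\<omega>. LINT s:{a..b}|lborel. pm m \<omega> s)"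
proof -
  obtain K where K: "0 \<le> K" "\<And>m \<omega> s. \<omega> \<in> space M \<Longrightarrow> 0 \<le> s \<Longrightarrow> \<bar>qm m \<omega> s\<bar> \<le> K"
    "\<And>m \<omega> s. \<omega> \<in> space M \<Longrightarrow> 0 \<le> s \<Longrightarrow> \<bar>pm m \<omega> s\<bar> \<le> K" using uniform_cell_bounds by metis
  have bq: "\<bar>qm m \<omega> s\<bar> \<le> K" and bp: "\<bar>pm m \<omega> s\<bar> \<le> K" if "\<omega> \<in> space M" "s \<in> {a..b}" for \<omega> s
    using K(2,3)[OF that(1)] that(2) assms by auto
  note iq = bounded_inner_integrable[OF qm_measurable bq] and ip = bounded_inner_integrable[OF pm_measurable bp]
  show "(\<lambda>\<omega>. LINT s:{a..b}|lborel. qm m \<omega> s) \<in> borel_measurable M"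
    "(\<lambda>\<omega>. LINT s:{a..b}|lborel. pm m \<omega> s) \<in> borel_measurable M"
    "\<omega> \<in> space M \<Longrightarrow> set_integrable lborel {a..b} (qm m \<omega>)"
    "\<omega> \<in> space M \<Longrightarrow> set_integrable lborel {a..b} (pm m \<omega>)"
    using iq(1,3) ip(1,3) by blast+
  assume ab: "a \<le> b"
  show "integrable M (\<lambda>\<omega>. LINT s:{a..b}|lborel. qm m \<omega> s)"
    by (rule integrable_const_bound[of _ "K * (b - a)"]) (use iq(1,2) ab in \<open>auto intro: AE_I2\<close>)
  show "integrable M (\<lambda>\<omega>. LINT s:{a..b}|lborel. pm m \<omega> s)"
    by (rule integrable_const_bound[of _ "K * (b - a)"]) (use ip(1,2) ab in \<open>auto intro: AE_I2\<close>)
qed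

text \<open>Splitting by the level in force at the start of the cell makes the drift a constant on
  each piece, and survival together with that level is an event of the past; so
  \<open>dynkin_step\<close> applies to each of the finitely many pieces.\<close>

lemma one_step:
  "(\<integral>\<omega>. bv m k \<omega> - av m k \<omega> \<partial>M) =
   (\<integral>\<omega>. (LINT s:{grid m k..grid m (Suc k)}|lborel. qm m \<omega> s - pm m \<omega> s) \<partial>M)"
proof -
  define t where "t = grid m k"
  define d where "d = inverse (real (Suc m))"
  have t0: "0 \<le> t" and d0: "0 \<le> d" by (auto simp: t_def d_def)
  define A where "A c = {\<omega>\<in>space M. AL m k \<omega>} \<inter> (C t -` {c} \<inter> space M)" for c
  define D where "D c \<omega> = exp (- q * d) * V c (YG m k \<omega> + (\<mu> - c) * d + \<sigma> * (W (t + d) \<omega> - W t \<omega>)) - V c (YG m k \<omega>)" for c \<omega>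
  define J where "J \<omega> = (LINT s:{grid m k..grid m (Suc k)}|lborel. qm m \<omega> s - pm m \<omega> s)" for \<omega>
  have AF: "A c \<in> F t" for c
  proof -
    interpret sigma_algebra "space M" "F t" by (rule F_sigma)
    show ?thesis unfolding A_def by (rule Int[OF AL_F[of m k, folded t_def] C_adapted[OF t0]]) simp
  qed
  have AM [measurable]: "A c \<in> sets M" for c using AF F_sub by blast
  have U: "YG m k \<in> borel_measurable (Fm t)" unfolding t_def by (rule YG_Fm) simp
  have ind: "(\<Sum>c\<in>S. indicator (A c) \<omega> * h c) = (if AL m k \<omega> then h (C t \<omega>) else (0::real))" if "\<omega> \<in> space M" for \<omega> h
  proof -
    have cS: "C t \<omega> \<in> S" by (rule C_in[OF that t0])
    have "(\<Sum>c\<in>S. indicator (A c) \<omega> * h c) = (\<Sum>c\<in>S. if C t \<omega> = c then (if AL m k \<omega> then h c else 0) else 0)"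
      using that by (intro sum.cong) (auto simp: A_def indicator_def)
    also have "\<dots> = (if AL m k \<omega> then h (C t \<omega>) else 0)" using cS S_fin by (simp add: sum.delta')
    finally show ?thesis .
  qed
  have iJ: "integrable M J"
    unfolding J_def using qm_pm_inner_integrable[OF grid_nonneg] grid_mono[of k "Suc k" m]
    by (subst Bochner_Integration.integrable_cong[OF refl set_integral_diff(2)]) auto
  have YS: "YG m (Suc k) \<omega> = YG m k \<omega> + (\<mu> - C t \<omega>) * d + \<sigma> * (W (t + d) \<omega> - W t \<omega>)" for \<omega>
    unfolding frozen_at_def t_def d_def grid_Suc by (simp add: algebra_simps del: of_nat_Suc)
  have "(\<integral>\<omega>. bv m k \<omega> - av m k \<omega> \<partial>M) = (\<integral>\<omega>. (\<Sum>c\<in>S. exp (- q * t) * (indicator (A c) \<omega> * D c \<omega>)) \<partial>M)"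
  proof (intro Bochner_Integration.integral_cong refl)
    fix \<omega> assume \<omega>: "\<omega> \<in> space M"
    have e: "exp (- q * grid m (Suc k)) = exp (- q * t) * exp (- q * d)"
      unfolding grid_Suc t_def d_def by (simp add: exp_add[symmetric] algebra_simps)
    have "bv m k \<omega> - av m k \<omega> = exp (- q * t) * (if AL m k \<omega> then D (C t \<omega>) \<omega> else 0)"
      unfolding bv_def av_def e YS D_def by (simp add: t_def right_diff_distrib mult.assoc)
    then show "bv m k \<omega> - av m k \<omega> = (\<Sum>c\<in>S. exp (- q * t) * (indicator (A c) \<omega> * D c \<omega>))"
      unfolding sum_distrib_left[symmetric] ind[OF \<omega>] .
  qed
  also have "\<dots> = (\<Sum>c\<in>S. (\<integral>\<omega>. exp (- q * t) * (indicator (A c) \<omega> * D c \<omega>) \<partial>M))"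
  proof (rule Bochner_Integration.integral_sum)
    fix c assume c: "c \<in> S"
    obtain K where K: "0 \<le> K" "\<And>c y. c \<in> S \<Longrightarrow> \<bar>V c y\<bar> \<le> K" using uniform_bound by metis
    have [measurable]: "V c \<in> borel_measurable borel" "YG m k \<in> borel_measurable M" "W (t + d) \<in> borel_measurable M" "W t \<in> borel_measurable M"
      using V_measurable[OF c] grid_measurable t0 d0 by (auto intro: W_measurable)
    show "integrable M (\<lambda>\<omega>. exp (- q * t) * (indicator (A c) \<omega> * D c \<omega>))"
    proof (intro integrable_mult_right integrable_const_bound[of _ "2 * K"] AE_I2)
      fix \<omega>
      have "\<bar>exp (- q * d) * V c (YG m k \<omega> + (\<mu> - c) * d + \<sigma> * (W (t + d) \<omega> - W t \<omega>))\<bar> \<le> K"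
        by (rule abs_discount_le[OF d0 K(2)[OF c]])
      then have "\<bar>D c \<omega>\<bar> \<le> 2 * K" using K(2)[OF c, of "YG m k \<omega>"] unfolding D_def by linarith
      then show "norm (indicator (A c) \<omega> * D c \<omega>) \<le> 2 * K" using K(1) by (auto simp: indicator_def)
    qed (unfold D_def, measurable)
  qed
  also have "\<dots> = (\<Sum>c\<in>S. (\<integral>\<omega>. indicator (A c) \<omega> * J \<omega> \<partial>M))"
  proof (rule sum.cong[OF refl])
    fix c assume c: "c \<in> S"
    have "(\<integral>\<omega>. exp (- q * t) * (indicator (A c) \<omega> * D c \<omega>) \<partial>M) = exp (- q * t) * (\<integral>\<omega>. indicator (A c) \<omega> * D c \<omega> \<partial>M)" by simp
    also have "(\<integral>\<omega>. indicator (A c) \<omega> * D c \<omega> \<partial>M) = (\<integral>\<omega>. exp (q * t) * (indicator (A c) \<omega> * J \<omega>) \<partial>M)"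
      unfolding D_def
    proof (subst dynkin_step[OF V_regular[OF c] less_imp_le[OF q_pos] t0 d0 AF U], intro Bochner_Integration.integral_cong refl)
      fix \<omega> assume \<omega>: "\<omega> \<in> space M"
      let ?h = "\<lambda>s. exp (- q * s) * (\<sigma>\<^sup>2 / 2 * V2 c (YG m k \<omega> + (\<mu> - c) * s + \<sigma> * (W (t + s) \<omega> - W t \<omega>))
        + (\<mu> - c) * V1 c (YG m k \<omega> + (\<mu> - c) * s + \<sigma> * (W (t + s) \<omega> - W t \<omega>))
        - q * V c (YG m k \<omega> + (\<mu> - c) * s + \<sigma> * (W (t + s) \<omega> - W t \<omega>)))"
      show "(LINT s:{0..d}|lborel. indicator (A c) \<omega> * ?h s) = exp (q * t) * (indicator (A c) \<omega> * J \<omega>)"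
      proof (cases "\<omega> \<in> A c")
        case True
        then have "AL m k \<omega>" "C (grid m k) \<omega> = c" by (auto simp: A_def t_def)
        from cell_integral[OF \<omega> this] have "(LINT s:{0..d}|lborel. ?h s) = exp (q * t) * J \<omega>"
          unfolding J_def t_def d_def .
        then show ?thesis using True by simp
      qed (simp add: set_lebesgue_integral_def)
    qed
    also have "exp (- q * t) * (\<integral>\<omega>. exp (q * t) * (indicator (A c) \<omega> * J \<omega>) \<partial>M) = (\<integral>\<omega>. indicator (A c) \<omega> * J \<omega> \<partial>M)"
      by (simp add: exp_minus)
    finally show "(\<integral>\<omega>. exp (- q * t) * (indicator (A c) \<omega> * D c \<omega>) \<partial>M) = (\<integral>\<omega>. indicator (A c) \<omega> * J \<omega> \<partial>M)" .
  qed
  also have "\<dots> = (\<integral>\<omega>. (\<Sum>c\<in>S. indicator (A c) \<omega> * J \<omega>) \<partial>M)"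
    using integrable_real_mult_indicator[OF AM iJ]
    by (subst Bochner_Integration.integral_sum) (auto simp: mult.commute)
  also have "\<dots> = (\<integral>\<omega>. J \<omega> \<partial>M)"
  proof (intro Bochner_Integration.integral_cong refl)
    fix \<omega> assume \<omega>: "\<omega> \<in> space M"
    \<comment> \<open>Survival is antitone in the index, so a path stopped at \<open>k\<close>
      contributes nothing at any time of the closed cell, including the end point owned by the next
      cell.\<close>
    have "J \<omega> = 0" if "\<not> AL m k \<omega>"
    proof -
      have "qm m \<omega> s - pm m \<omega> s = 0" if s: "s \<in> {grid m k..grid m (Suc k)}" for s
      proof -
        have "k \<le> cell m s" using s by (intro grid_le_imp_le_cell) simp
        then have "\<not> AL m (cell m s) \<omega>" using \<open>\<not> AL m k \<omega>\<close> alive_mono by blast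
        then show ?thesis by (simp add: qm_def pm_def qk_def pk_def)
      qed
      then have "J \<omega> = (LINT s:{grid m k..grid m (Suc k)}|lborel. 0)"
        unfolding J_def by (intro set_lebesgue_integral_cong) auto
      then show ?thesis by simp
    qed
    then show "(\<Sum>c\<in>S. indicator (A c) \<omega> * J \<omega>) = J \<omega>" by (simp add: ind[OF \<omega>, of "\<lambda>_. J \<omega>"])
  qed
  finally show ?thesis unfolding J_def .
qed

text \<open>The expected values at grid points telescope. Each difference splits at
  \<open>bv\<close> into the motion inside the cell, given by \<open>one_step\<close>, and the
  effect of switching or stopping at its end.\<close>

lemma telescoping_identity:
  "(\<integral>\<omega>. (LINT s:{0..real T}|lborel. pm m \<omega> s) \<partial>M) = (\<integral>\<omega>. av m 0 \<omega> \<partial>M) - (\<integral>\<omega>. av m (T * Suc m) \<omega> \<partial>M)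
     + (\<integral>\<omega>. (LINT s:{0..real T}|lborel. qm m \<omega> s) \<partial>M) + (\<integral>\<omega>. Rm m (T * Suc m) \<omega> \<partial>M)"
proof -
  define N where "N = T * Suc m"
  define J where "J k \<omega> = (LINT s:{grid m k..grid m (Suc k)}|lborel. qm m \<omega> s - pm m \<omega> s)" for k \<omega>
  have diff: "(LINT s:{a..b}|lborel. qm m \<omega> s - pm m \<omega> s) = (LINT s:{a..b}|lborel. qm m \<omega> s) - (LINT s:{a..b}|lborel. pm m \<omega> s)"
    if "\<omega> \<in> space M" "0 \<le> a" for \<omega> a b
    using that by (intro set_integral_diff(2) qm_pm_inner_integrable)
  have iJ: "integrable M (J k)" for k
    unfolding J_def using qm_pm_inner_integrable[OF grid_nonneg] grid_mono[of k "Suc k" m]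
    by (subst Bochner_Integration.integrable_cong[OF refl diff]) auto
  have "(\<integral>\<omega>. av m N \<omega> \<partial>M) - (\<integral>\<omega>. av m 0 \<omega> \<partial>M) = (\<Sum>k<N. (\<integral>\<omega>. av m (Suc k) \<omega> \<partial>M) - (\<integral>\<omega>. av m k \<omega> \<partial>M))"
    by (rule sum_lessThan_telescope[symmetric])
  also have "\<dots> = (\<Sum>k<N. (\<integral>\<omega>. bv m k \<omega> - av m k \<omega> \<partial>M) + (\<integral>\<omega>. av m (Suc k) \<omega> - bv m k \<omega> \<partial>M))"
    by simp
  also have "\<dots> = (\<Sum>k<N. (\<integral>\<omega>. J k \<omega> \<partial>M)) + (\<Sum>k<N. (\<integral>\<omega>. av m (Suc k) \<omega> - bv m k \<omega> \<partial>M))"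
    unfolding one_step J_def by (rule sum.distrib)
  also have "(\<Sum>k<N. (\<integral>\<omega>. av m (Suc k) \<omega> - bv m k \<omega> \<partial>M)) = (\<integral>\<omega>. Rm m N \<omega> \<partial>M)"
    unfolding Rm_def by (rule Bochner_Integration.integral_sum[symmetric]) simp
  also have "(\<Sum>k<N. (\<integral>\<omega>. J k \<omega> \<partial>M)) = (\<integral>\<omega>. (\<Sum>k<N. J k \<omega>) \<partial>M)"
    by (rule Bochner_Integration.integral_sum[symmetric]) (rule iJ)
  also have "\<dots> = (\<integral>\<omega>. (LINT s:{0..real T}|lborel. qm m \<omega> s) - (LINT s:{0..real T}|lborel. pm m \<omega> s) \<partial>M)"
  proof (intro Bochner_Integration.integral_cong refl)
    fix \<omega> assume \<omega>: "\<omega> \<in> space M"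
    have "(\<Sum>k<N. J k \<omega>) = (LINT s:{0..grid m N}|lborel. qm m \<omega> s - pm m \<omega> s)"
      unfolding J_def by (rule sum_grid_integrals) (intro set_integral_diff(1) qm_pm_inner_integrable \<omega>)
    then show "(\<Sum>k<N. J k \<omega>) = (LINT s:{0..real T}|lborel. qm m \<omega> s) - (LINT s:{0..real T}|lborel. pm m \<omega> s)"
      unfolding N_def grid_mult_Suc by (simp add: diff[OF \<omega>])
  qed
  also have "\<dots> = (\<integral>\<omega>. (LINT s:{0..real T}|lborel. qm m \<omega> s) \<partial>M) - (\<integral>\<omega>. (LINT s:{0..real T}|lborel. pm m \<omega> s) \<partial>M)"
    by (intro Bochner_Integration.integral_diff qm_pm_inner_integrable) auto
  finally show ?thesis unfolding N_def by simp
qed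

end

subsection \<open>Passage to the limit\<close>

text \<open>The limit \<open>g\<close> is asked to be measurable in time for each outcome only: its
  time integral is measurable in the outcome as a limit of measurable time integrals.\<close>

lemma (in prob_space) double_dominated_convergence:
  fixes h :: "nat \<Rightarrow> 'a \<Rightarrow> real \<Rightarrow> real"
  assumes h: "\<And>m. (\<lambda>(\<omega>, s). h m \<omega> s) \<in> borel_measurable (M \<Otimes>\<^sub>M borel)"
    and B: "\<And>m \<omega> s. \<omega> \<in> space M \<Longrightarrow> s \<in> {0..b} \<Longrightarrow> \<bar>h m \<omega> s\<bar> \<le> K" and b: "0 \<le> b"
    and g: "\<And>\<omega>. \<omega> \<in> space M \<Longrightarrow> g \<omega> \<in> borel_measurable borel"
    and lim: "\<And>\<omega>. \<omega> \<in> space M \<Longrightarrow> AE s in lborel. s \<in> {0..b} \<longrightarrow> (\<lambda>m. h m \<omega> s) \<longlonglongrightarrow> g \<omega> s"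
  shows "(\<lambda>\<omega>. LINT s:{0..b}|lborel. g \<omega> s) \<in> borel_measurable M"
    and "(\<lambda>m. \<integral>\<omega>. (LINT s:{0..b}|lborel. h m \<omega> s) \<partial>M) \<longlonglongrightarrow> (\<integral>\<omega>. (LINT s:{0..b}|lborel. g \<omega> s) \<partial>M)"
    and "\<And>\<omega>. \<omega> \<in> space M \<Longrightarrow> \<bar>LINT s:{0..b}|lborel. g \<omega> s\<bar> \<le> K * b"
proof -
  have ii1: "(\<lambda>\<omega>. LINT s:{0..b}|lborel. h m \<omega> s) \<in> borel_measurable M" for m
    by (rule bounded_inner_integrable(1)[where a = 0 and b = b and B = K, OF h B])
  have ii2: "\<bar>LINT s:{0..b}|lborel. h m \<omega> s\<bar> \<le> K * b" if "\<omega> \<in> space M" for m \<omega>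
    using bounded_inner_integrable(2)[where a = 0 and b = b and B = K, OF h B that b] by simp
  have inner: "(\<lambda>m. LINT s:{0..b}|lborel. h m \<omega> s) \<longlonglongrightarrow> (LINT s:{0..b}|lborel. g \<omega> s)" if \<omega>: "\<omega> \<in> space M" for \<omega>
    unfolding set_lebesgue_integral_def
  proof (rule integral_dominated_convergence[where w = "\<lambda>s. indicator {0..b} s * K"])
    show "integrable lborel (\<lambda>s. indicator {0..b} s * K)"
      by (intro integrable_mult_left integrable_real_indicator) (auto simp: emeasure_lborel_Icc_eq)
    show "AE s in lborel. (\<lambda>m. indicator {0..b} s *\<^sub>R h m \<omega> s) \<longlonglongrightarrow> indicator {0..b} s *\<^sub>R g \<omega> s"
      using lim[OF \<omega>]
    proof eventually_elim
      case (elim s)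
      then show ?case by (cases "s \<in> {0..b}") auto
    qed
    show "AE s in lborel. norm (indicat_real {0..b} s *\<^sub>R h m \<omega> s) \<le> indicat_real {0..b} s * K" for m
      using B[OF \<omega>] by (intro always_eventually allI) (auto simp: indicator_def)
    have "h m \<omega> \<in> borel_measurable borel" for m
      using measurable_compose[OF measurable_Pair1'[OF \<omega>] h] by simp
    then show "(\<lambda>s. indicat_real {0..b} s *\<^sub>R h m \<omega> s) \<in> borel_measurable lborel" for m
      by (intro borel_measurable_scaleR borel_measurable_indicator) auto
    show "(\<lambda>s. indicat_real {0..b} s *\<^sub>R g \<omega> s) \<in> borel_measurable lborel"
      using g[OF \<omega>] by (intro borel_measurable_scaleR borel_measurable_indicator) auto
  qed
  show gm: "(\<lambda>\<omega>. LINT s:{0..b}|lborel. g \<omega> s) \<in> borel_measurable M"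
    by (rule borel_measurable_LIMSEQ_real[OF inner ii1])
  show "\<bar>LINT s:{0..b}|lborel. g \<omega> s\<bar> \<le> K * b" if \<omega>: "\<omega> \<in> space M" for \<omega>
  proof (rule LIMSEQ_le_const2[OF tendsto_rabs[OF inner[OF \<omega>]]])
    show "\<exists>N. \<forall>m\<ge>N. \<bar>LINT s:{0..b}|lborel. h m \<omega> s\<bar> \<le> K * b" using ii2[OF \<omega>] by simp
  qed
  show "(\<lambda>m. \<integral>\<omega>. (LINT s:{0..b}|lborel. h m \<omega> s) \<partial>M) \<longlonglongrightarrow> (\<integral>\<omega>. (LINT s:{0..b}|lborel. g \<omega> s) \<partial>M)"
  proof (rule integral_dominated_convergence[where w = "\<lambda>_. K * b"])
    show "AE \<omega> in M. norm (LINT s:{0..b}|lborel. h m \<omega> s) \<le> K * b" for m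
      using ii2 by (intro AE_I2) simp
  qed (use ii1 gm inner in \<open>auto intro: AE_I2\<close>)
qed

context ratchet_control
begin

definition pl :: "'a \<Rightarrow> real \<Rightarrow> real" where
  "pl \<omega> s = (if 0 \<le> s \<and> ereal s < ruin x (drv \<omega>) (ctl \<omega>) then exp (- q * s) * C s \<omega> else 0)"

definition PT :: "nat \<Rightarrow> 'a \<Rightarrow> real" where
  "PT T \<omega> = (LINT s:{0..real T}|lborel. pl \<omega> s)"

lemma pl_measurable:
  assumes \<omega>: "\<omega> \<in> space M"
  shows "pl \<omega> \<in> borel_measurable borel"
proof -
  have "mono (\<lambda>s. C (max 0 s) \<omega>)"
    by (rule monoI) (auto intro!: mono_onD[OF C_mono[OF \<omega>]])
  then have [measurable]: "(\<lambda>s. C (max 0 s) \<omega>) \<in> borel_measurable borel" by (rule borel_measurable_mono)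
  have "pl \<omega> = (\<lambda>s. if 0 \<le> s \<and> ereal s < ruin x (drv \<omega>) (ctl \<omega>) then exp (- q * s) * C (max 0 s) \<omega> else 0)"
    by (rule HOL.ext) (simp add: pl_def max_absorb2)
  also have "\<dots> \<in> borel_measurable borel" by measurable
  finally show ?thesis .
qed

text \<open>A monotone control has countably many discontinuities, and the origin and the ruin time
  are single points.\<close>

lemma AE_generic_time:
  assumes \<omega>: "\<omega> \<in> space M"
  shows "AE s in lborel. s \<in> {0..b} \<longrightarrow> 0 < s \<and> ereal s \<noteq> ruin x (drv \<omega>) (ctl \<omega>) \<and> isCont (ctl \<omega>) s"
proof -
  interpret P: ratchet_path x "drv \<omega>" "ctl \<omega>" S by (rule path[OF \<omega>])
  have "AE s in lborel. s \<notin> {s \<in> {0<..}. \<not> isCont (ctl \<omega>) s}"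
    by (rule AE_not_in[OF countable_imp_null_set_lborel[OF P.countable_discontinuities]])
  moreover have "AE s in lborel. s \<noteq> (0::real)" by (rule AE_lborel_singleton)
  \<comment> \<open>If ruin is infinite this excludes a harmless real number; if ruin is finite it
    excludes the ruin time.\<close>
  moreover have "AE s in lborel. s \<noteq> real_of_ereal (ruin x (drv \<omega>) (ctl \<omega>))" by (rule AE_lborel_singleton)
  ultimately show ?thesis
  proof eventually_elim
    case (elim s)
    have "ereal s \<noteq> ruin x (drv \<omega>) (ctl \<omega>)" using elim(3) by (metis real_of_ereal.simps(1))
    then show ?case using elim by auto
  qed
qed

lemma Yk_frozen: "0 \<le> s \<Longrightarrow> Yk m (cell m s) s \<omega> = frozen x (drv \<omega>) (ctl \<omega>) m s"
  by (simp add: Yk_def frozen_def max_absorb2 algebra_simps)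

lemma pm_tendsto:
  assumes \<omega>: "\<omega> \<in> space M" and s: "0 < s" "ereal s \<noteq> ruin x (drv \<omega>) (ctl \<omega>)" "isCont (ctl \<omega>) s"
  shows "(\<lambda>m. pm m \<omega> s) \<longlonglongrightarrow> pl \<omega> s"
proof -
  interpret P: ratchet_path x "drv \<omega>" "ctl \<omega>" S by (rule path[OF \<omega>])
  have "\<forall>\<^sub>F m in sequentially. pm m \<omega> s = pl \<omega> s"
  proof (cases "ereal s < ruin x (drv \<omega>) (ctl \<omega>)")
    case True
    show ?thesis using P.control_eventually_const[OF s(1,3)]
      by eventually_elim (use True s P.alive_before_ruin[OF True] in \<open>simp add: pm_def pk_def pl_def\<close>)
  next
    case False
    then have "ruin x (drv \<omega>) (ctl \<omega>) < ereal s" using s(2) by auto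
    from P.not_alive_after_ruin[OF this] show ?thesis
      by eventually_elim (use False in \<open>simp add: pm_def pk_def pl_def\<close>)
  qed
  then show ?thesis by (rule tendsto_eventually)
qed

lemma qm_pos_tendsto:
  assumes super: "\<And>c y. c \<in> S \<Longrightarrow> 0 \<le> y \<Longrightarrow> Qf c y \<le> 0"
    and \<omega>: "\<omega> \<in> space M" and s: "0 < s" "ereal s \<noteq> ruin x (drv \<omega>) (ctl \<omega>)"
  shows "(\<lambda>m. max 0 (qm m \<omega> s)) \<longlonglongrightarrow> 0"
proof -
  interpret P: ratchet_path x "drv \<omega>" "ctl \<omega>" S by (rule path[OF \<omega>])
  have "\<forall>\<^sub>F m in sequentially. max 0 (qm m \<omega> s) = 0"
  proof (cases "ereal s < ruin x (drv \<omega>) (ctl \<omega>)")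
    case True
    have "max 0 (qm m \<omega> s) = 0" for m
    proof -
      have "0 \<le> reserve x (drv \<omega>) (ctl \<omega>) s" using s by (intro P.reserve_nonneg_before_ruin[OF True]) auto
      also have "\<dots> \<le> Yk m (cell m s) s \<omega>" using P.frozen_ge_reserve(1)[of s m] s by (simp add: Yk_frozen)
      finally have "Qf (Cg m (cell m s) \<omega>) (Yk m (cell m s) s \<omega>) \<le> 0"
        by (intro super C_in[OF \<omega>]) auto
      then show ?thesis by (simp add: qm_def qk_def mult_nonneg_nonpos max_absorb1)
    qed
    then show ?thesis by simp
  next
    case False
    then have "ruin x (drv \<omega>) (ctl \<omega>) < ereal s" using s(2) by auto
    from P.not_alive_after_ruin[OF this] show ?thesis
      by eventually_elim (simp add: qm_def qk_def)
  qed
  then show ?thesis by (rule tendsto_eventually)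
qed

lemma qm_tendsto:
  assumes \<omega>: "\<omega> \<in> space M" and s: "0 < s" "ereal s \<noteq> ruin x (drv \<omega>) (ctl \<omega>)" "isCont (ctl \<omega>) s"
    and harm: "\<And>s. 0 \<le> s \<Longrightarrow> 0 \<le> reserve x (drv \<omega>) (ctl \<omega>) s \<Longrightarrow>
      \<exists>e>0. \<forall>y. reserve x (drv \<omega>) (ctl \<omega>) s \<le> y \<and> y < reserve x (drv \<omega>) (ctl \<omega>) s + e \<longrightarrow> Qf (C s \<omega>) y = 0"
  shows "(\<lambda>m. qm m \<omega> s) \<longlonglongrightarrow> 0"
proof -
  interpret P: ratchet_path x "drv \<omega>" "ctl \<omega>" S by (rule path[OF \<omega>])
  have "\<forall>\<^sub>F m in sequentially. qm m \<omega> s = 0"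
  proof (cases "ereal s < ruin x (drv \<omega>) (ctl \<omega>)")
    case True
    have s0: "0 \<le> s" using s by simp
    have "0 \<le> reserve x (drv \<omega>) (ctl \<omega>) s" using s by (intro P.reserve_nonneg_before_ruin[OF True]) auto
    from harm[OF s0 this] obtain e where e: "0 < e"
      "\<And>y. reserve x (drv \<omega>) (ctl \<omega>) s \<le> y \<Longrightarrow> y < reserve x (drv \<omega>) (ctl \<omega>) s + e \<Longrightarrow> Qf (C s \<omega>) y = 0" by blast
    have "\<forall>\<^sub>F m in sequentially. frozen x (drv \<omega>) (ctl \<omega>) m s < reserve x (drv \<omega>) (ctl \<omega>) s + e"
      using order_tendstoD(2)[OF P.frozen_tendsto[OF s0]] e(1) by simp
    then show ?thesis using P.control_eventually_const[OF s(1,3)]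
    proof eventually_elim
      case (elim m)
      then show ?case using e(2) P.frozen_ge_reserve(1)[OF s0, of m] by (simp add: qm_def qk_def Yk_frozen[OF s0])
    qed
  next
    case False
    then have "ruin x (drv \<omega>) (ctl \<omega>) < ereal s" using s(2) by auto
    from P.not_alive_after_ruin[OF this] show ?thesis
      by eventually_elim (simp add: qm_def qk_def)
  qed
  then show ?thesis by (rule tendsto_eventually)
qed

lemma PT_limit:
  shows "PT T \<in> borel_measurable M" "integrable M (PT T)"
    "(\<lambda>m. \<integral>\<omega>. (LINT s:{0..real T}|lborel. pm m \<omega> s) \<partial>M) \<longlonglongrightarrow> (\<integral>\<omega>. PT T \<omega> \<partial>M)"
proof -
  obtain K where K: "0 \<le> K" "\<And>m \<omega> s. \<omega> \<in> space M \<Longrightarrow> 0 \<le> s \<Longrightarrow> \<bar>pm m \<omega> s\<bar> \<le> K" using uniform_cell_bounds by metis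
  have lim: "AE s in lborel. s \<in> {0..real T} \<longrightarrow> (\<lambda>m. pm m \<omega> s) \<longlonglongrightarrow> pl \<omega> s" if "\<omega> \<in> space M" for \<omega>
    using AE_generic_time[OF that, of "real T"] by eventually_elim (use pm_tendsto[OF that] in blast)
  have bound: "\<bar>pm m \<omega> s\<bar> \<le> K" if "\<omega> \<in> space M" "s \<in> {0..real T}" for m \<omega> s using K(2)[OF that(1)] that(2) by simp
  note D = double_dominated_convergence[OF pm_measurable bound of_nat_0_le_iff pl_measurable lim]
  show "PT T \<in> borel_measurable M" unfolding PT_def[abs_def] by (rule D(1))
  show "integrable M (PT T)" unfolding PT_def[abs_def]
    by (rule integrable_const_bound[of _ "K * real T"]) (use D(1,3) in \<open>auto intro: AE_I2\<close>)
  show "(\<lambda>m. \<integral>\<omega>. (LINT s:{0..real T}|lborel. pm m \<omega> s) \<partial>M) \<longlonglongrightarrow> (\<integral>\<omega>. PT T \<omega> \<partial>M)"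
    unfolding PT_def by (rule D(2))
qed

section \<open>The remainder from switching and stopping\<close>

abbreviation iA :: "nat \<Rightarrow> nat \<Rightarrow> 'a \<Rightarrow> real" where "iA m k \<omega> \<equiv> (if AL m k \<omega> then 1 else 0)"

lemma AL_Suc: "AL m (Suc k) \<omega> \<longleftrightarrow> AL m k \<omega> \<and> 0 \<le> YG m (Suc k) \<omega>"
  by (auto simp: alive_def le_Suc_eq)

lemma step_term_cases:
  "AL m (Suc k) \<omega> \<Longrightarrow> av m (Suc k) \<omega> - bv m k \<omega> =
     exp (- q * grid m (Suc k)) * (V (Cg m (Suc k) \<omega>) (YG m (Suc k) \<omega>) - V (Cg m k \<omega>) (YG m (Suc k) \<omega>))"
  "AL m k \<omega> \<Longrightarrow> \<not> AL m (Suc k) \<omega> \<Longrightarrow> av m (Suc k) \<omega> - bv m k \<omega> = - (exp (- q * grid m (Suc k)) * V (Cg m k \<omega>) (YG m (Suc k) \<omega>))"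
  "\<not> AL m k \<omega> \<Longrightarrow> av m (Suc k) \<omega> - bv m k \<omega> = 0"
  unfolding av_def bv_def by (auto simp: AL_Suc right_diff_distrib)

text \<open>The indicator of survival drops from 1 to 0 at most once, so an error caused by stopping
  is counted at most once however fine the grid is.\<close>

lemma sum_iA_le: "0 \<le> \<delta> \<Longrightarrow> (\<Sum>k<N. (iA m k \<omega> - iA m (Suc k) \<omega>) * \<delta>) \<le> \<delta>"
proof -
  assume "0 \<le> \<delta>"
  have "(\<Sum>k<N. iA m k \<omega> - iA m (Suc k) \<omega>) = iA m 0 \<omega> - iA m N \<omega>"
    by (rule sum_lessThan_telescope'[of "\<lambda>k. iA m k \<omega>"])
  then have "(\<Sum>k<N. iA m k \<omega> - iA m (Suc k) \<omega>) \<le> 1" by (simp split: if_splits)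
  from mult_right_mono[OF this \<open>0 \<le> \<delta>\<close>] show ?thesis by (simp only: sum_distrib_right mult_1_left)
qed

text \<open>While the path survives, a switch can only lower the value, so these terms are
  nonpositive; stopping contributes at most one \<open>\<delta>\<close>.\<close>

lemma Rm_le:
  assumes \<delta>: "0 \<le> \<delta>" "\<And>k. k < N \<Longrightarrow> 0 \<le> YG m k \<omega> \<Longrightarrow> YG m (Suc k) \<omega> < 0 \<Longrightarrow> \<bar>V (Cg m k \<omega>) (YG m (Suc k) \<omega>)\<bar> \<le> \<delta>"
    and mono: "\<And>k. k < N \<Longrightarrow> 0 \<le> YG m (Suc k) \<omega> \<Longrightarrow>
      V (Cg m (Suc k) \<omega>) (YG m (Suc k) \<omega>) \<le> V (Cg m k \<omega>) (YG m (Suc k) \<omega>)"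
  shows "Rm m N \<omega> \<le> \<delta>"
proof -
  have "Rm m N \<omega> \<le> (\<Sum>k<N. (iA m k \<omega> - iA m (Suc k) \<omega>) * \<delta>)"
    unfolding Rm_def
  proof (rule sum_mono)
    fix k assume "k \<in> {..<N}"
    then have k: "k < N" by simp
    consider "AL m (Suc k) \<omega>" | "AL m k \<omega>" "\<not> AL m (Suc k) \<omega>" | "\<not> AL m k \<omega>" by blast
    then show "av m (Suc k) \<omega> - bv m k \<omega> \<le> (iA m k \<omega> - iA m (Suc k) \<omega>) * \<delta>"
    proof cases
      case 1
      then have "AL m k \<omega>" "0 \<le> YG m (Suc k) \<omega>" by (auto simp: AL_Suc)
      then show ?thesis using step_term_cases(1)[OF 1] mono[OF k] 1 by (simp add: mult_nonneg_nonpos)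
    next
      case 2
      then have "0 \<le> YG m k \<omega>" "YG m (Suc k) \<omega> < 0" by (auto simp: AL_Suc) (auto simp: alive_def)
      then have "\<bar>exp (- q * grid m (Suc k)) * V (Cg m k \<omega>) (YG m (Suc k) \<omega>)\<bar> \<le> \<delta>"
        by (intro abs_discount_le \<delta>(2) k) auto
      then show ?thesis using step_term_cases(2)[OF 2] 2 by simp
    next
      case 3
      then have "\<not> AL m (Suc k) \<omega>" by (simp add: AL_Suc)
      then show ?thesis using step_term_cases(3)[OF 3] 3 by simp
    qed
  qed
  also have "\<dots> \<le> \<delta>" by (rule sum_iA_le[OF \<delta>(1)])
  finally show ?thesis .
qed

text \<open>A switching term vanishes unless the level changes over the cell, so only the number of
  changes multiplies \<open>\<epsilon>\<close>.\<close>

lemma abs_Rm_le: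
  assumes \<delta>: "0 \<le> \<delta>" "\<And>k. k < N \<Longrightarrow> 0 \<le> YG m k \<omega> \<Longrightarrow> YG m (Suc k) \<omega> < 0 \<Longrightarrow> \<bar>V (Cg m k \<omega>) (YG m (Suc k) \<omega>)\<bar> \<le> \<delta>"
    and sw: "0 \<le> \<epsilon>" "\<And>k. k < N \<Longrightarrow> \<bar>V (Cg m (Suc k) \<omega>) (YG m (Suc k) \<omega>) - V (Cg m k \<omega>) (YG m (Suc k) \<omega>)\<bar> \<le> \<epsilon>"
  shows "\<bar>Rm m N \<omega>\<bar> \<le> \<delta> + (\<Sum>k<N. if Cg m (Suc k) \<omega> \<noteq> Cg m k \<omega> then 1 else 0) * \<epsilon>"
proof -
  let ?i = "\<lambda>k. (if Cg m (Suc k) \<omega> \<noteq> Cg m k \<omega> then 1 else 0) :: real"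
  have "\<bar>Rm m N \<omega>\<bar> \<le> (\<Sum>k<N. \<bar>av m (Suc k) \<omega> - bv m k \<omega>\<bar>)" unfolding Rm_def by (rule sum_abs)
  also have "\<dots> \<le> (\<Sum>k<N. (iA m k \<omega> - iA m (Suc k) \<omega>) * \<delta> + ?i k * \<epsilon>)"
  proof (rule sum_mono)
    fix k assume "k \<in> {..<N}"
    then have k: "k < N" by simp
    have i: "0 \<le> ?i k * \<epsilon>" using sw(1) by simp
    consider "AL m (Suc k) \<omega>" | "AL m k \<omega>" "\<not> AL m (Suc k) \<omega>" | "\<not> AL m k \<omega>" by blast
    then show "\<bar>av m (Suc k) \<omega> - bv m k \<omega>\<bar> \<le> (iA m k \<omega> - iA m (Suc k) \<omega>) * \<delta> + ?i k * \<epsilon>"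
    proof cases
      case 1
      then have "AL m k \<omega>" by (auto simp: AL_Suc)
      moreover have "\<bar>exp (- q * grid m (Suc k)) * (V (Cg m (Suc k) \<omega>) (YG m (Suc k) \<omega>) - V (Cg m k \<omega>) (YG m (Suc k) \<omega>))\<bar> \<le> ?i k * \<epsilon>"
        by (rule abs_discount_le[OF grid_nonneg]) (use sw(2)[OF k] in auto)
      ultimately show ?thesis using step_term_cases(1)[OF 1] 1 by simp
    next
      case 2
      then have "0 \<le> YG m k \<omega>" "YG m (Suc k) \<omega> < 0" by (auto simp: AL_Suc) (auto simp: alive_def)
      then have "\<bar>exp (- q * grid m (Suc k)) * V (Cg m k \<omega>) (YG m (Suc k) \<omega>)\<bar> \<le> \<delta>"
        by (intro abs_discount_le \<delta>(2) k) auto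
      moreover have "(iA m k \<omega> - iA m (Suc k) \<omega>) * \<delta> = \<delta>" using 2 by simp
      ultimately show ?thesis unfolding step_term_cases(2)[OF 2] abs_minus_cancel using i by linarith
    next
      case 3
      then have "\<not> AL m (Suc k) \<omega>" by (simp add: AL_Suc)
      then have "(iA m k \<omega> - iA m (Suc k) \<omega>) * \<delta> = 0" using 3 by simp
      then show ?thesis unfolding step_term_cases(3)[OF 3] using i by linarith
    qed
  qed
  also have "\<dots> = (\<Sum>k<N. (iA m k \<omega> - iA m (Suc k) \<omega>) * \<delta>) + (\<Sum>k<N. ?i k) * \<epsilon>"
    by (simp only: sum.distrib sum_distrib_right)
  also have "\<dots> \<le> \<delta> + (\<Sum>k<N. ?i k) * \<epsilon>" using sum_iA_le[OF \<delta>(1)] by simp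
  finally show ?thesis .
qed

lemma av_0: "\<omega> \<in> space M \<Longrightarrow> av m 0 \<omega> = V (C 0 \<omega>) x"
  using W_zero x_nonneg by (simp add: av_def alive_def frozen_at_def)

lemma abs_av_final:
  assumes "\<omega> \<in> space M" "\<And>c y. c \<in> S \<Longrightarrow> \<bar>V c y\<bar> \<le> K" "0 \<le> K"
  shows "\<bar>av m (T * Suc m) \<omega>\<bar> \<le> exp (- q * real T) * K"
proof -
  have "C (real T) \<omega> \<in> S" by (rule C_in[OF assms(1)]) simp
  from assms(2)[OF this, of "YG m (T * Suc m) \<omega>"] assms(3) show ?thesis
    unfolding av_def grid_mult_Suc by (auto simp: abs_mult simp del: mult_Suc_right)
qed

lemma Rm_integrable [simp]: "integrable M (Rm m N)"
  unfolding Rm_def[abs_def] by simp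

lemma stopped_value_small:
  assumes zero: "\<And>c. c \<in> S \<Longrightarrow> V c 0 = 0" and lip: "\<And>c y y'. c \<in> S \<Longrightarrow> \<bar>V c y - V c y'\<bar> \<le> K * \<bar>y - y'\<bar>"
    and K: "0 \<le> K" and \<omega>: "\<omega> \<in> space M" and Y: "0 \<le> YG m k \<omega>" "YG m (Suc k) \<omega> < 0" "\<bar>YG m (Suc k) \<omega> - YG m k \<omega>\<bar> \<le> e"
  shows "\<bar>V (Cg m k \<omega>) (YG m (Suc k) \<omega>)\<bar> \<le> K * e"
proof -
  have c: "Cg m k \<omega> \<in> S" by (rule C_in[OF \<omega> grid_nonneg])
  have "\<bar>V (Cg m k \<omega>) (YG m (Suc k) \<omega>)\<bar> \<le> K * \<bar>YG m (Suc k) \<omega>\<bar>"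
    using lip[OF c, of "YG m (Suc k) \<omega>" 0] zero[OF c] by simp
  also have "\<dots> \<le> K * e" using Y K by (intro mult_left_mono) auto
  finally show ?thesis .
qed

text \<open>In the telescoping identity the generator term and the remainder are replaced by their
  positive parts, which vanish in the limit. The value left at the horizon costs a bounded amount
  times the discount factor, and the initial level only lowers the starting value.\<close>

lemma upper_bound:
  assumes super: "\<And>c y. c \<in> S \<Longrightarrow> 0 \<le> y \<Longrightarrow> Qf c y \<le> 0"
    and mono: "\<And>c c' y. c \<in> S \<Longrightarrow> c' \<in> S \<Longrightarrow> c \<le> c' \<Longrightarrow> 0 \<le> y \<Longrightarrow> V c' y \<le> V c y"
    and zero: "\<And>c. c \<in> S \<Longrightarrow> V c 0 = 0"
    and ci: "ci \<in> S" "\<And>\<omega>. \<omega> \<in> space M \<Longrightarrow> ci \<le> C 0 \<omega>"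
  shows "\<exists>K. \<forall>T. (\<integral>\<omega>. PT T \<omega> \<partial>M) \<le> V ci x + exp (- q * real T) * K"
proof -
  obtain K where K: "0 \<le> K" "\<And>m \<omega> s. \<omega> \<in> space M \<Longrightarrow> 0 \<le> s \<Longrightarrow> \<bar>qm m \<omega> s\<bar> \<le> K"
    "\<And>c y. c \<in> S \<Longrightarrow> \<bar>V c y\<bar> \<le> K" "\<And>c y y'. c \<in> S \<Longrightarrow> \<bar>V c y - V c y'\<bar> \<le> K * \<bar>y - y'\<bar>"
    using uniform_cell_bounds by metis
  have "(\<integral>\<omega>. PT T \<omega> \<partial>M) \<le> V ci x + exp (- q * real T) * K" for T
  proof -
    define N where "N m = T * Suc m" for m
    define h where "h m \<omega> s = max 0 (qm m \<omega> s)" for m \<omega> s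
    have hm: "(\<lambda>(\<omega>, s). h m \<omega> s) \<in> borel_measurable (M \<Otimes>\<^sub>M borel)" for m
      unfolding h_def case_prod_beta
      using borel_measurable_max[OF borel_measurable_const qm_measurable[of m], of 0] by (simp add: case_prod_beta)
    have hb: "\<bar>h m \<omega> s\<bar> \<le> K" if "\<omega> \<in> space M" "s \<in> {0..real T}" for m \<omega> s
      using K(1) K(2)[OF that(1), of s m] that(2) unfolding h_def by auto
    have hl: "AE s in lborel. s \<in> {0..real T} \<longrightarrow> (\<lambda>m. h m \<omega> s) \<longlonglongrightarrow> 0" if "\<omega> \<in> space M" for \<omega>
      using AE_generic_time[OF that, of "real T"] unfolding h_def
      by eventually_elim (use qm_pos_tendsto[OF super that] in blast)
    have hlim: "(\<lambda>m. \<integral>\<omega>. (LINT s:{0..real T}|lborel. h m \<omega> s) \<partial>M) \<longlonglongrightarrow> 0"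
      using double_dominated_convergence(2)[OF hm hb of_nat_0_le_iff _ hl] by simp
    have Rpos: "max 0 (Rm m (N m) \<omega>) \<le> K * e" if "\<omega> \<in> space M" "0 \<le> e"
      "\<And>k. k < N m \<Longrightarrow> \<bar>YG m (Suc k) \<omega> - YG m k \<omega>\<bar> \<le> e" for m \<omega> e
    proof -
      have "Rm m (N m) \<omega> \<le> K * e"
      proof (rule Rm_le)
        show "0 \<le> K * e" using K(1) that(2) by simp
        show "\<bar>V (Cg m k \<omega>) (YG m (Suc k) \<omega>)\<bar> \<le> K * e" if "k < N m" "0 \<le> YG m k \<omega>" "YG m (Suc k) \<omega> < 0" for k
          using stopped_value_small[OF zero K(4,1) \<open>\<omega> \<in> space M\<close> that(2,3) \<open>\<And>k. k < N m \<Longrightarrow> \<bar>YG m (Suc k) \<omega> - YG m k \<omega>\<bar> \<le> e\<close>[OF that(1)]] .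
        show "V (Cg m (Suc k) \<omega>) (YG m (Suc k) \<omega>) \<le> V (Cg m k \<omega>) (YG m (Suc k) \<omega>)" if "0 \<le> YG m (Suc k) \<omega>" for k
          using mono_onD[OF C_mono[OF \<open>\<omega> \<in> space M\<close>], of "grid m k" "grid m (Suc k)"] that grid_mono[of k "Suc k" m]
          by (intro mono C_in[OF \<open>\<omega> \<in> space M\<close>]) auto
      qed
      then show ?thesis using K(1) that(2) by simp
    qed
    \<comment> \<open>The dominating constant is \<open>K\<close> for every grid: switches are
      nonpositive and the single stopping term is at most \<open>K\<close>.\<close>
    have Rbound: "\<bar>max 0 (Rm m (N m) \<omega>)\<bar> \<le> K" if "\<omega> \<in> space M" for m \<omega>
    proof -
      have "Rm m (N m) \<omega> \<le> K"
      proof (rule Rm_le[OF K(1)])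
        show "\<bar>V (Cg m k \<omega>) (YG m (Suc k) \<omega>)\<bar> \<le> K" for k by (rule K(3)[OF C_in[OF that grid_nonneg]])
        show "V (Cg m (Suc k) \<omega>) (YG m (Suc k) \<omega>) \<le> V (Cg m k \<omega>) (YG m (Suc k) \<omega>)" if "0 \<le> YG m (Suc k) \<omega>" for k
          using mono_onD[OF C_mono[OF \<open>\<omega> \<in> space M\<close>], of "grid m k" "grid m (Suc k)"] that grid_mono[of k "Suc k" m]
          by (intro mono C_in[OF \<open>\<omega> \<in> space M\<close>]) auto
      qed
      then show ?thesis using K(1) by simp
    qed
    have "(\<lambda>m. \<integral>\<omega>. max 0 (Rm m (N m) \<omega>) \<partial>M) \<longlonglongrightarrow> (\<integral>\<omega>. 0 \<partial>M)"
    proof (rule integral_dominated_convergence[where w = "\<lambda>_. K"])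
      show "AE \<omega> in M. (\<lambda>m. max 0 (Rm m (N m) \<omega>)) \<longlonglongrightarrow> 0"
      proof (rule AE_I2)
        fix \<omega> assume \<omega>: "\<omega> \<in> space M"
        interpret P: ratchet_path x "drv \<omega>" "ctl \<omega>" S by (rule path[OF \<omega>])
        show "(\<lambda>m. max 0 (Rm m (N m) \<omega>)) \<longlonglongrightarrow> 0"
        proof (rule tendstoI)
          fix e :: real assume e: "0 < e"
          define e' where "e' = e / (K + 1)"
          have e': "0 < e'" "K * e' < e" using e K(1) by (auto simp: e'_def field_simps)
          show "\<forall>\<^sub>F m in sequentially. dist (max 0 (Rm m (N m) \<omega>)) 0 < e"
            using P.frozen_increment[OF e'(1), of T]
          proof eventually_elim
            case (elim m)
            have "max 0 (Rm m (N m) \<omega>) \<le> K * e'"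
              by (rule Rpos[OF \<omega> less_imp_le[OF e'(1)]]) (use elim in \<open>simp add: N_def\<close>)
            then show ?case using e'(2) by (simp add: dist_real_def)
          qed
        qed
      qed
      show "AE \<omega> in M. norm (max 0 (Rm m (N m) \<omega>)) \<le> K" for m using Rbound by (intro AE_I2) simp
    qed auto
    then have Rlim: "(\<lambda>m. \<integral>\<omega>. max 0 (Rm m (N m) \<omega>) \<partial>M) \<longlonglongrightarrow> 0" by simp
    have le: "(\<integral>\<omega>. (LINT s:{0..real T}|lborel. pm m \<omega> s) \<partial>M) \<le> (V ci x + exp (- q * real T) * K)
        + (\<integral>\<omega>. (LINT s:{0..real T}|lborel. h m \<omega> s) \<partial>M) + (\<integral>\<omega>. max 0 (Rm m (N m) \<omega>) \<partial>M)" for m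
    proof -
      have "(\<integral>\<omega>. av m 0 \<omega> \<partial>M) \<le> (\<integral>\<omega>. V ci x \<partial>M)"
        by (rule integral_mono) (auto simp: av_0 intro!: mono ci C_in x_nonneg)
      then have 1: "(\<integral>\<omega>. av m 0 \<omega> \<partial>M) \<le> V ci x" by (simp add: prob_space)
      have "(\<integral>\<omega>. - av m (N m) \<omega> \<partial>M) \<le> (\<integral>\<omega>. exp (- q * real T) * K \<partial>M)"
      proof (rule integral_mono)
        show "- av m (N m) \<omega> \<le> exp (- q * real T) * K" if "\<omega> \<in> space M" for \<omega>
          using abs_av_final[OF that K(3,1), of m T] unfolding N_def by linarith
      qed auto
      then have 2: "- (\<integral>\<omega>. av m (N m) \<omega> \<partial>M) \<le> exp (- q * real T) * K" by (simp add: prob_space)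
      have ih1: "(\<lambda>\<omega>. LINT s:{0..real T}|lborel. h m \<omega> s) \<in> borel_measurable M"
        by (rule bounded_inner_integrable(1)[where B = K, OF hm hb])
      have ih2: "\<bar>LINT s:{0..real T}|lborel. h m \<omega> s\<bar> \<le> K * (real T - 0)" if "\<omega> \<in> space M" for \<omega>
        by (rule bounded_inner_integrable(2)[where B = K, OF hm hb that]) auto
      have ih3: "set_integrable lborel {0..real T} (h m \<omega>)" if "\<omega> \<in> space M" for \<omega>
        by (rule bounded_inner_integrable(3)[where B = K, OF hm hb that])
      have 3: "(\<integral>\<omega>. (LINT s:{0..real T}|lborel. qm m \<omega> s) \<partial>M) \<le> (\<integral>\<omega>. (LINT s:{0..real T}|lborel. h m \<omega> s) \<partial>M)"
      proof (rule integral_mono)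
        show "integrable M (\<lambda>\<omega>. LINT s:{0..real T}|lborel. qm m \<omega> s)" by (rule qm_pm_inner_integrable) auto
        show "integrable M (\<lambda>\<omega>. LINT s:{0..real T}|lborel. h m \<omega> s)"
          by (rule integrable_const_bound[of _ "K * real T"]) (use ih1 ih2 in \<open>auto intro: AE_I2\<close>)
        fix \<omega> assume \<omega>: "\<omega> \<in> space M"
        show "(LINT s:{0..real T}|lborel. qm m \<omega> s) \<le> (LINT s:{0..real T}|lborel. h m \<omega> s)"
          by (rule set_integral_mono[OF qm_pm_inner_integrable(3)[OF order_refl \<omega>] ih3[OF \<omega>]]) (simp add: h_def)
      qed
      have 4: "(\<integral>\<omega>. Rm m (N m) \<omega> \<partial>M) \<le> (\<integral>\<omega>. max 0 (Rm m (N m) \<omega>) \<partial>M)"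
        by (rule integral_mono) auto
      show ?thesis using telescoping_identity[of T m, folded N_def] 1 2 3 4 by linarith
    qed
    have "(\<lambda>m. (V ci x + exp (- q * real T) * K) + (\<integral>\<omega>. (LINT s:{0..real T}|lborel. h m \<omega> s) \<partial>M)
        + (\<integral>\<omega>. max 0 (Rm m (N m) \<omega>) \<partial>M)) \<longlonglongrightarrow> (V ci x + exp (- q * real T) * K) + 0 + 0"
      by (intro tendsto_add tendsto_const hlim Rlim)
    from LIMSEQ_le[OF PT_limit(3) this] le show ?thesis by auto
  qed
  then show ?thesis by blast
qed

text \<open>The same identity, but now the generator term and the remainder tend to zero in both
  directions: the first by the equation along the path, the second because the value process is
  continuous across switches and their number is bounded.\<close>

lemma lower_bound:
  assumes harm: "\<And>\<omega> s. \<omega> \<in> space M \<Longrightarrow> 0 \<le> s \<Longrightarrow> 0 \<le> reserve x (drv \<omega>) (ctl \<omega>) s \<Longrightarrow>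
      \<exists>e>0. \<forall>y. reserve x (drv \<omega>) (ctl \<omega>) s \<le> y \<and> y < reserve x (drv \<omega>) (ctl \<omega>) s + e \<longrightarrow> Qf (C s \<omega>) y = 0"
    and cont: "\<And>\<omega>. \<omega> \<in> space M \<Longrightarrow> continuous_on {0..} (\<lambda>t. V (C t \<omega>) (reserve x (drv \<omega>) (ctl \<omega>) t))"
    and zero: "\<And>c. c \<in> S \<Longrightarrow> V c 0 = 0" and init: "\<And>\<omega>. \<omega> \<in> space M \<Longrightarrow> V (C 0 \<omega>) x = v0"
  shows "\<exists>K. \<forall>T. v0 - exp (- q * real T) * K \<le> (\<integral>\<omega>. PT T \<omega> \<partial>M)"
proof -
  obtain K where K: "0 \<le> K" "\<And>m \<omega> s. \<omega> \<in> space M \<Longrightarrow> 0 \<le> s \<Longrightarrow> \<bar>qm m \<omega> s\<bar> \<le> K"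
    "\<And>c y. c \<in> S \<Longrightarrow> \<bar>V c y\<bar> \<le> K" "\<And>c y y'. c \<in> S \<Longrightarrow> \<bar>V c y - V c y'\<bar> \<le> K * \<bar>y - y'\<bar>"
    using uniform_cell_bounds by metis
  obtain g where g: "0 < g" "\<And>a b. a \<in> S \<Longrightarrow> b \<in> S \<Longrightarrow> a < b \<Longrightarrow> g \<le> b - a" using finite_gap[OF S_fin] by metis
  define cm where "cm = Max (insert 0 S)"
  have cm: "0 \<le> cm" unfolding cm_def using S_fin by (intro Max_ge) auto
  have "v0 - exp (- q * real T) * K \<le> (\<integral>\<omega>. PT T \<omega> \<partial>M)" for T
  proof -
    define N where "N m = T * Suc m" for m
    have count: "(\<Sum>k<N m. if Cg m (Suc k) \<omega> \<noteq> Cg m k \<omega> then 1 else 0 :: real) \<le> cm / g" if \<omega>: "\<omega> \<in> space M" for m \<omega>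
    proof -
      interpret P: ratchet_path x "drv \<omega>" "ctl \<omega>" S by (rule path[OF \<omega>])
      show ?thesis using P.switch_count[OF g] unfolding P.cb_def cm_def by blast
    qed
    have qb: "\<bar>qm m \<omega> s\<bar> \<le> K" if "\<omega> \<in> space M" "s \<in> {0..real T}" for m \<omega> s
      using K(2)[OF that(1), of s m] that(2) by auto
    have ql: "AE s in lborel. s \<in> {0..real T} \<longrightarrow> (\<lambda>m. qm m \<omega> s) \<longlonglongrightarrow> 0" if "\<omega> \<in> space M" for \<omega>
      using AE_generic_time[OF that, of "real T"]
      by eventually_elim (use qm_tendsto[OF that _ _ _ harm[OF that]] in blast)
    have qlim: "(\<lambda>m. \<integral>\<omega>. (LINT s:{0..real T}|lborel. qm m \<omega> s) \<partial>M) \<longlonglongrightarrow> 0"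
      using double_dominated_convergence(2)[OF qm_measurable qb of_nat_0_le_iff _ ql] by simp
    have Rabs: "\<bar>Rm m (N m) \<omega>\<bar> \<le> \<delta> + cm / g * \<epsilon>" if "\<omega> \<in> space M" "0 \<le> \<delta>" "0 \<le> \<epsilon>"
      "\<And>k. k < N m \<Longrightarrow> 0 \<le> YG m k \<omega> \<Longrightarrow> YG m (Suc k) \<omega> < 0 \<Longrightarrow> \<bar>V (Cg m k \<omega>) (YG m (Suc k) \<omega>)\<bar> \<le> \<delta>"
      "\<And>k. k < N m \<Longrightarrow> \<bar>V (Cg m (Suc k) \<omega>) (YG m (Suc k) \<omega>) - V (Cg m k \<omega>) (YG m (Suc k) \<omega>)\<bar> \<le> \<epsilon>" for m \<omega> \<delta> \<epsilon>
      using abs_Rm_le[where \<delta> = \<delta> and N = "N m" and m = m and \<omega> = \<omega> and \<epsilon> = \<epsilon>, OF that(2,4,3,5)] mult_right_mono[OF count[OF that(1), of m] that(3)] by linarith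
    have "(\<lambda>m. \<integral>\<omega>. Rm m (N m) \<omega> \<partial>M) \<longlonglongrightarrow> (\<integral>\<omega>. 0 \<partial>M)"
    \<comment> \<open>One stopping term of size at most \<open>K\<close>, and at most
      \<open>cm / g\<close> switches of size at most \<open>2 * K\<close> each.\<close>
    proof (rule integral_dominated_convergence[where w = "\<lambda>_. K + cm / g * (2 * K)"])
      show "AE \<omega> in M. (\<lambda>m. Rm m (N m) \<omega>) \<longlonglongrightarrow> 0"
      proof (rule AE_I2)
        fix \<omega> assume \<omega>: "\<omega> \<in> space M"
        interpret P: ratchet_path x "drv \<omega>" "ctl \<omega>" S by (rule path[OF \<omega>])
        show "(\<lambda>m. Rm m (N m) \<omega>) \<longlonglongrightarrow> 0"
        proof (rule tendstoI)
          fix e :: real assume e: "0 < e"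
          define D where "D = K + cm / g + 1"
          define e' where "e' = e / D"
          have D: "0 < D" "K + cm / g < D" using K(1) cm g(1) by (auto simp: D_def add_nonneg_pos)
          have e': "0 < e'" "(K + cm / g) * e' < e"
            using e D by (auto simp: e'_def pos_divide_less_eq mult.commute)
          have sw: "\<forall>\<^sub>F m in sequentially. \<forall>k<T * Suc m.
            \<bar>V (Cg m (Suc k) \<omega>) (YG m (Suc k) \<omega>) - V (Cg m k \<omega>) (YG m (Suc k) \<omega>)\<bar> \<le> e'"
            by (rule P.value_switch_small[OF _ K(1) cont[OF \<omega>] e'(1)]) (rule K(4))
          show "\<forall>\<^sub>F m in sequentially. dist (Rm m (N m) \<omega>) 0 < e"
            using P.frozen_increment[OF e'(1), of T] sw
          proof eventually_elim
            case (elim m)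
            have "\<bar>Rm m (N m) \<omega>\<bar> \<le> K * e' + cm / g * e'"
            proof (rule Rabs[OF \<omega>])
              show "0 \<le> K * e'" "0 \<le> e'" using K(1) e'(1) by auto
              show "\<bar>V (Cg m k \<omega>) (YG m (Suc k) \<omega>)\<bar> \<le> K * e'" if "k < N m" "0 \<le> YG m k \<omega>" "YG m (Suc k) \<omega> < 0" for k
                by (rule stopped_value_small[OF zero K(4,1) \<omega> that(2,3) elim(1)[rule_format, OF that(1)[unfolded N_def]]])
              show "\<bar>V (Cg m (Suc k) \<omega>) (YG m (Suc k) \<omega>) - V (Cg m k \<omega>) (YG m (Suc k) \<omega>)\<bar> \<le> e'" if "k < N m" for k
                by (rule elim(2)[rule_format, OF that[unfolded N_def]])
            qed
            also have "\<dots> < e" using e'(2) by (simp add: distrib_right)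
            finally show ?case by (simp add: dist_real_def)
          qed
        qed
      qed
      show "AE \<omega> in M. norm (Rm m (N m) \<omega>) \<le> K + cm / g * (2 * K)" for m
      proof (rule AE_I2)
        fix \<omega> assume \<omega>: "\<omega> \<in> space M"
        have Vb: "\<bar>V (Cg m k \<omega>) y\<bar> \<le> K" for k y by (rule K(3)[OF C_in[OF \<omega> grid_nonneg]])
        have "\<bar>Rm m (N m) \<omega>\<bar> \<le> K + cm / g * (2 * K)"
        proof (rule Rabs[OF \<omega>])
          show "\<bar>V (Cg m (Suc k) \<omega>) (YG m (Suc k) \<omega>) - V (Cg m k \<omega>) (YG m (Suc k) \<omega>)\<bar> \<le> 2 * K" for k
            using Vb[of "Suc k" "YG m (Suc k) \<omega>"] Vb[of k "YG m (Suc k) \<omega>"] by linarith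
        qed (use K(1) Vb in auto)
        then show "norm (Rm m (N m) \<omega>) \<le> K + cm / g * (2 * K)" by simp
      qed
    qed auto
    then have Rlim: "(\<lambda>m. \<integral>\<omega>. Rm m (N m) \<omega> \<partial>M) \<longlonglongrightarrow> 0" by simp
    have le: "(v0 - exp (- q * real T) * K) + (\<integral>\<omega>. (LINT s:{0..real T}|lborel. qm m \<omega> s) \<partial>M) + (\<integral>\<omega>. Rm m (N m) \<omega> \<partial>M)
        \<le> (\<integral>\<omega>. (LINT s:{0..real T}|lborel. pm m \<omega> s) \<partial>M)" for m
    proof -
      have "(\<integral>\<omega>. av m 0 \<omega> \<partial>M) = (\<integral>\<omega>. v0 \<partial>M)"
        by (intro Bochner_Integration.integral_cong) (auto simp: av_0 init)
      then have 1: "(\<integral>\<omega>. av m 0 \<omega> \<partial>M) = v0" by (simp add: prob_space)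
      have "(\<integral>\<omega>. av m (N m) \<omega> \<partial>M) \<le> (\<integral>\<omega>. exp (- q * real T) * K \<partial>M)"
      proof (rule integral_mono)
        show "av m (N m) \<omega> \<le> exp (- q * real T) * K" if "\<omega> \<in> space M" for \<omega>
          using abs_av_final[OF that K(3,1), of m T] unfolding N_def by linarith
      qed auto
      then have 2: "(\<integral>\<omega>. av m (N m) \<omega> \<partial>M) \<le> exp (- q * real T) * K" by (simp add: prob_space)
      show ?thesis using telescoping_identity[of T m, folded N_def] 1 2 by linarith
    qed
    have "(\<lambda>m. (v0 - exp (- q * real T) * K) + (\<integral>\<omega>. (LINT s:{0..real T}|lborel. qm m \<omega> s) \<partial>M)
        + (\<integral>\<omega>. Rm m (N m) \<omega> \<partial>M)) \<longlonglongrightarrow> (v0 - exp (- q * real T) * K) + 0 + 0"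
      by (intro tendsto_add tendsto_const qlim Rlim)
    from LIMSEQ_le[OF this PT_limit(3)] le show ?thesis by auto
  qed
  then show ?thesis by blast
qed

text \<open>Monotone convergence in the horizon, applied to the time integral and then to the
  expectation; it links the payoff as a nonnegative integral to the truncated payoffs for which
  limits were taken.\<close>

lemma payoff_eq_SUP:
  "(\<integral>\<^sup>+ \<omega>. (\<integral>\<^sup>+ s. ennreal (exp (- q * s) * C s \<omega>) * indicator {s. 0 \<le> s \<and> ereal s < ruin x (drv \<omega>) (ctl \<omega>)} s \<partial>lborel) \<partial>M)
    = (SUP T. ennreal (\<integral>\<omega>. PT T \<omega> \<partial>M))"
proof -
  obtain K where K: "0 \<le> K" "\<And>c. c \<in> S \<Longrightarrow> c \<le> K" using uniform_bound by metis
  have pl: "0 \<le> pl \<omega> s" "\<bar>pl \<omega> s\<bar> \<le> K" if "\<omega> \<in> space M" for \<omega> s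
  proof -
    have c: "0 \<le> C s \<omega>" "\<bar>C s \<omega>\<bar> \<le> K" if "0 \<le> s" using C_in[OF \<open>\<omega> \<in> space M\<close> that] K S_nn by auto
    show "0 \<le> pl \<omega> s" using c(1) by (simp add: pl_def)
    show "\<bar>pl \<omega> s\<bar> \<le> K" unfolding pl_def using abs_discount_le[OF _ c(2)] K(1) by auto
  qed
  have si: "set_integrable lborel {0..real T} (pl \<omega>)" if "\<omega> \<in> space M" for \<omega> T
    by (rule bounded_set_integrable[OF pl_measurable[OF that] pl(2)[OF that]])
  have PT_nn: "0 \<le> PT T \<omega>" if "\<omega> \<in> space M" for T \<omega>
    unfolding PT_def set_lebesgue_integral_def using pl(1)[OF that] by (intro integral_nonneg_AE) auto
  have PT_ennreal: "(\<integral>\<^sup>+ s. ennreal (indicator {0..real T} s * pl \<omega> s) \<partial>lborel) = ennreal (PT T \<omega>)" if "\<omega> \<in> space M" for T \<omega>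
    using si[OF that, of T] pl(1)[OF that] unfolding PT_def set_lebesgue_integral_def set_integrable_def
    by (subst nn_integral_eq_integral) auto
  have inner: "(\<integral>\<^sup>+ s. ennreal (exp (- q * s) * C s \<omega>) * indicator {s. 0 \<le> s \<and> ereal s < ruin x (drv \<omega>) (ctl \<omega>)} s \<partial>lborel)
     = (SUP T. ennreal (PT T \<omega>))" if \<omega>: "\<omega> \<in> space M" for \<omega>
  proof -
    have "(\<integral>\<^sup>+ s. ennreal (exp (- q * s) * C s \<omega>) * indicator {s. 0 \<le> s \<and> ereal s < ruin x (drv \<omega>) (ctl \<omega>)} s \<partial>lborel)
      = (\<integral>\<^sup>+ s. (SUP T. ennreal (indicator {0..real T} s * pl \<omega> s)) \<partial>lborel)"
    proof (intro nn_integral_cong)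
      fix s :: real
      have "(SUP T. ennreal (indicator {0..real T} s * pl \<omega> s)) = ennreal (pl \<omega> s)"
      proof (rule antisym)
        show "(SUP T. ennreal (indicator {0..real T} s * pl \<omega> s)) \<le> ennreal (pl \<omega> s)"
          using pl(1)[OF \<omega>, of s] by (intro SUP_least) (auto simp: indicator_def)
        obtain T :: nat where "s \<le> real T" using real_arch_simple by blast
        then have "pl \<omega> s = indicator {0..real T} s * pl \<omega> s" by (auto simp: indicator_def pl_def)
        then have "ennreal (pl \<omega> s) = ennreal (indicator {0..real T} s * pl \<omega> s)" by (rule arg_cong)
        also have "\<dots> \<le> (SUP T. ennreal (indicator {0..real T} s * pl \<omega> s))" by (rule SUP_upper) simp
        finally show "ennreal (pl \<omega> s) \<le> (SUP T. ennreal (indicator {0..real T} s * pl \<omega> s))" .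
      qed
      then show "ennreal (exp (- q * s) * C s \<omega>) * indicator {s. 0 \<le> s \<and> ereal s < ruin x (drv \<omega>) (ctl \<omega>)} s =
        (SUP T. ennreal (indicator {0..real T} s * pl \<omega> s))"
        by (simp add: pl_def indicator_def)
    qed
    also have "\<dots> = (SUP T. \<integral>\<^sup>+ s. ennreal (indicator {0..real T} s * pl \<omega> s) \<partial>lborel)"
    proof (rule nn_integral_monotone_convergence_SUP)
      show "incseq (\<lambda>T s. ennreal (indicator {0..real T} s * pl \<omega> s))"
        using pl(1)[OF \<omega>] by (auto simp: incseq_def le_fun_def indicator_def intro!: ennreal_leI)
      show "(\<lambda>s. ennreal (indicator {0..real T} s * pl \<omega> s)) \<in> borel_measurable lborel" for T
        using pl_measurable[OF \<omega>] by (intro measurable_compose[OF _ measurable_ennreal] borel_measurable_times borel_measurable_indicator) auto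
    qed
    finally show ?thesis unfolding PT_ennreal[OF \<omega>] .
  qed
  have "(\<integral>\<^sup>+ \<omega>. (\<integral>\<^sup>+ s. ennreal (exp (- q * s) * C s \<omega>) * indicator {s. 0 \<le> s \<and> ereal s < ruin x (drv \<omega>) (ctl \<omega>)} s \<partial>lborel) \<partial>M)
    = (\<integral>\<^sup>+ \<omega>. (SUP T. ennreal (PT T \<omega>)) \<partial>M)"
    by (rule nn_integral_cong) (rule inner)
  also have "\<dots> = (SUP T. \<integral>\<^sup>+ \<omega>. ennreal (PT T \<omega>) \<partial>M)"
  proof (rule nn_integral_monotone_convergence_SUP_AE)
    show "AE \<omega> in M. ennreal (PT T \<omega>) \<le> ennreal (PT (Suc T) \<omega>)" for T
    proof (rule AE_I2)
      fix \<omega> assume \<omega>: "\<omega> \<in> space M"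
      show "ennreal (PT T \<omega>) \<le> ennreal (PT (Suc T) \<omega>)"
        unfolding PT_ennreal[OF \<omega>, symmetric] using pl(1)[OF \<omega>]
        by (intro nn_integral_mono ennreal_leI) (auto simp: indicator_def)
    qed
    show "(\<lambda>\<omega>. ennreal (PT T \<omega>)) \<in> borel_measurable M" for T using PT_limit(1) by measurable
  qed
  also have "\<dots> = (SUP T. ennreal (\<integral>\<omega>. PT T \<omega> \<partial>M))"
    using PT_limit(2) PT_nn by (intro SUP_cong refl nn_integral_eq_integral) (auto intro: AE_I2)
  finally show ?thesis .
qed

lemma expected_PT_mono: "T \<le> T' \<Longrightarrow> (\<integral>\<omega>. PT T \<omega> \<partial>M) \<le> (\<integral>\<omega>. PT T' \<omega> \<partial>M)"
proof (rule integral_mono[OF PT_limit(2) PT_limit(2)])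
  fix \<omega> assume T: "T \<le> T'" and \<omega>: "\<omega> \<in> space M"
  obtain K where K: "0 \<le> K" "\<And>c. c \<in> S \<Longrightarrow> c \<le> K" using uniform_bound by metis
  have c: "0 \<le> C s \<omega>" "\<bar>C s \<omega>\<bar> \<le> K" if "0 \<le> s" for s using C_in[OF \<omega> that] K S_nn by auto
  have pl: "0 \<le> pl \<omega> s" for s using c(1) by (simp add: pl_def)
  have "\<bar>pl \<omega> s\<bar> \<le> K" for s unfolding pl_def using abs_discount_le[OF _ c(2)] K(1) by auto
  then have si: "set_integrable lborel {0..real T} (pl \<omega>)" for T
    by (intro bounded_set_integrable[OF pl_measurable[OF \<omega>]])
  show "PT T \<omega> \<le> PT T' \<omega>"
    unfolding PT_def set_lebesgue_integral_def
  proof (rule integral_mono)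
    show "indicat_real {0..real T} s *\<^sub>R pl \<omega> s \<le> indicat_real {0..real T'} s *\<^sub>R pl \<omega> s" for s
      using pl[of s] T by (auto simp: indicator_def)
  qed (use si in \<open>auto simp: set_integrable_def\<close>)
qed

end

subsection \<open>Optimality of threshold strategies\<close>

lemma ruin_time_eq_ruin: "ruin_time \<mu> \<sigma> W x C \<omega> = ruin x (\<lambda>t. \<mu> * t + \<sigma> * W t \<omega>) (\<lambda>t. C t \<omega>)"
  by (simp add: ruin_time_def ruin_def ctrl_surplus_def surplus_def reserve_def add.assoc)

lemma admissible_ratchet_control:
  assumes BM: "std_brownian_motion M W" and \<sigma>: "\<sigma> > 0" and q: "q > 0" and x: "0 \<le> x"
    and S: "finite S" "S \<subseteq> {0..}" and C: "C \<in> admissible M \<mu> \<sigma> W S x c"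
    and V: "\<And>c. c \<in> S \<Longrightarrow> regular (V c) (V1 c) (V2 c)"
  shows "ratchet_control (completion M) W (filt M \<mu> \<sigma> W x) \<sigma> q x S C V V1 V2"
proof (intro ratchet_control.intro ratchet_control_axioms.intro)
  show "bm_filtration (completion M) W (filt M \<mu> \<sigma> W x)"
    using \<sigma> by (intro bm_filtration_completion[OF BM]) simp
  show "dividend_model \<sigma> q" using \<sigma> q by unfold_locales
qed (use x S C V in \<open>auto simp: admissible_def\<close>)

lemma Jval_completion: "Jval M \<mu> \<sigma> q W x C = Jval (completion M) \<mu> \<sigma> q W x C"
  by (simp add: Jval_def nn_integral_completion)

context ratchet_control
begin

lemma Jval_eq_SUP: "Jval M \<mu> \<sigma> q W x C = (SUP T. ennreal (\<integral>\<omega>. PT T \<omega> \<partial>M))"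
  unfolding Jval_def ruin_time_eq_ruin by (rule payoff_eq_SUP)

lemma discount_tendsto: "(\<lambda>T. exp (- q * real T) * K) \<longlonglongrightarrow> 0"
proof -
  have "filterlim (\<lambda>T. - q * real T) at_bot sequentially"
    by (rule filterlim_tendsto_neg_mult_at_bot[OF tendsto_const _ filterlim_real_sequentially]) (use q_pos in simp)
  then have "(\<lambda>T. exp (- q * real T)) \<longlonglongrightarrow> 0" by (rule filterlim_compose[OF exp_at_bot])
  from tendsto_mult_left_zero[OF this] show ?thesis .
qed

text \<open>The truncated payoff increases with the horizon, so the bound at a fixed horizon may
  borrow the error term of any later one, which tends to zero.\<close>

lemma Jval_le:
  assumes "\<forall>T. (\<integral>\<omega>. PT T \<omega> \<partial>M) \<le> v + exp (- q * real T) * K"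
  shows "Jval M \<mu> \<sigma> q W x C \<le> ennreal v"
  unfolding Jval_eq_SUP
proof (intro SUP_least ennreal_leI)
  fix T
  have "(\<lambda>T'. v + exp (- q * real T') * K) \<longlonglongrightarrow> v + 0" by (intro tendsto_add tendsto_const discount_tendsto)
  moreover have "\<forall>T'\<ge>T. (\<integral>\<omega>. PT T \<omega> \<partial>M) \<le> v + exp (- q * real T') * K"
    using assms expected_PT_mono[of T] order_trans by blast
  ultimately show "(\<integral>\<omega>. PT T \<omega> \<partial>M) \<le> v" using LIMSEQ_le_const[of _ "v + 0"] by auto
qed

lemma Jval_ge:
  assumes "\<forall>T. v - exp (- q * real T) * K \<le> (\<integral>\<omega>. PT T \<omega> \<partial>M)"
  shows "ennreal v \<le> Jval M \<mu> \<sigma> q W x C"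
  unfolding Jval_eq_SUP
proof (rule LIMSEQ_le_const2)
  have "(\<lambda>T. v - exp (- q * real T) * K) \<longlonglongrightarrow> v - 0" by (intro tendsto_diff tendsto_const discount_tendsto)
  then show "(\<lambda>T. ennreal (v - exp (- q * real T) * K)) \<longlonglongrightarrow> ennreal v" by (auto intro: tendsto_ennrealI)
  show "\<exists>N. \<forall>T\<ge>N. ennreal (v - exp (- q * real T) * K) \<le> (SUP T. ennreal (\<integral>\<omega>. PT T \<omega> \<partial>M))"
    using assms by (intro exI[of _ 0] allI impI SUP_upper2[where i = "_"] ennreal_leI) auto
qed

end

text \<open>The witness \<open>v\<close> is the solution of the variational system. Its nonpositive
  generator and antitonicity in the level bound every admissible payoff by it; the equation below
  the thresholds and the linking at them make the threshold payoff reach it.\<close>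

lemma ex_value_attaining_threshold:
  assumes BM: "std_brownian_motion M W" and sigma: "\<sigma> > 0" and q: "q > 0"
    and cs: "cs \<noteq> []" "sorted_wrt (<) cs" "0 \<le> hd cs"
  shows "\<exists>z v. threshold_fun cs z \<and> (\<forall>x\<ge>0. \<forall>i<length cs.
    Vval M \<mu> \<sigma> q W (set cs) x (cs ! i) \<le> v x i \<and> v x i \<le> Wz M \<mu> \<sigma> q W cs z x i)"
proof -
  interpret D: dividend_model \<mu> \<sigma> q using sigma q by unfold_locales
  obtain z V V1 V2 where sys: "D.variational_system (\<lambda>c f f1 f2. regular f f1 f2 \<and> f 0 = 0) cs z V V1 V2"
    using D.ex_variational_solution[OF cs] by blast
  have reg: "\<And>c. c \<in> set cs \<Longrightarrow> regular (V c) (V1 c) (V2 c)" and zero: "\<And>c. c \<in> set cs \<Longrightarrow> V c 0 = 0"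
    and super: "\<And>c x. c \<in> set cs \<Longrightarrow> 0 \<le> x \<Longrightarrow> D.gen c (V c x) (V1 c x) (V2 c x) \<le> 0"
    and top: "\<And>x. 0 \<le> x \<Longrightarrow> D.gen (last cs) (V (last cs) x) (V1 (last cs) x) (V2 (last cs) x) = 0"
    and z0: "\<And>i. Suc i < length cs \<Longrightarrow> 0 \<le> z (cs ! i)"
    and V_mono: "\<And>i x. Suc i < length cs \<Longrightarrow> 0 \<le> x \<Longrightarrow> V (cs ! Suc i) x \<le> V (cs ! i) x"
    and V_link: "\<And>i x. Suc i < length cs \<Longrightarrow> z (cs ! i) \<le> x \<Longrightarrow> V (cs ! i) x = V (cs ! Suc i) x"
    and harm: "\<And>i x. Suc i < length cs \<Longrightarrow> 0 \<le> x \<Longrightarrow> x < z (cs ! i) \<Longrightarrow>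
       D.gen (cs ! i) (V (cs ! i) x) (V1 (cs ! i) x) (V2 (cs ! i) x) = 0"
    using sys unfolding D.variational_system_def by blast+
  have S: "finite (set cs)" "set cs \<subseteq> {0..}"
    using cs by (auto, cases cs) auto
  \<comment> \<open>The system orders neighbouring levels only; any control may jump over several
    levels at once, so the order is chained.\<close>
  have V_anti: "V (cs ! j) y \<le> V (cs ! i) y" if "i \<le> j" "j < length cs" "0 \<le> y" for i j y
    using that
  proof (induction j rule: dec_induct)
    case (step n)
    then show ?case using V_mono[of n y] by auto
  qed simp
  have mono: "V c' y \<le> V c y" if cc: "c \<in> set cs" "c' \<in> set cs" "c \<le> c'" "0 \<le> y" for c c' y
  proof -
    obtain i j where ij: "i < length cs" "j < length cs" "c = cs ! i" "c' = cs ! j"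
      using cc by (auto simp: in_set_conv_nth)
    have "i \<le> j" using sorted_wrt_nth_less[OF cs(2), of j i] ij cc(3) by (meson leD leI)
    then show ?thesis using V_anti[of i j y] ij cc by simp
  qed
  have "threshold_fun cs z"
    unfolding threshold_fun_def using z0 by (auto simp: in_set_conv_nth nth_butlast)
  moreover have "Jval M \<mu> \<sigma> q W x C \<le> ennreal (V (cs ! i) x)"
    if x: "0 \<le> x" and i: "i < length cs" and C: "C \<in> admissible M \<mu> \<sigma> W (set cs) x (cs ! i)" for x i C
  proof -
    interpret R: ratchet_control "completion M" W "filt M \<mu> \<sigma> W x" \<mu> \<sigma> q x "set cs" C V V1 V2
      by (rule admissible_ratchet_control[OF BM sigma q x S C reg])
    have "\<exists>K. \<forall>T. (\<integral>\<omega>. R.PT T \<omega> \<partial>completion M) \<le> V (cs ! i) x + exp (- q * real T) * K"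
    proof (rule R.upper_bound)
      show "R.Qf c y \<le> 0" if "c \<in> set cs" "0 \<le> y" for c y unfolding R.Qf_def by (rule super[OF that])
      show "cs ! i \<le> C 0 \<omega>" if "\<omega> \<in> space (completion M)" for \<omega> using C that by (auto simp: admissible_def)
    qed (use mono zero i in auto)
    then show ?thesis unfolding Jval_completion[of M] using R.Jval_le by blast
  qed
  then have "Vval M \<mu> \<sigma> q W (set cs) x (cs ! i) \<le> ennreal (V (cs ! i) x)" if "0 \<le> x" "i < length cs" for x i
    unfolding Vval_def using that by (intro SUP_least) auto
  moreover have "ennreal (V (cs ! i) x) \<le> Wz M \<mu> \<sigma> q W cs z x i" if x: "0 \<le> x" and i: "i < length cs" for x i
  proof -
    define C where "C = thr_strategy \<mu> \<sigma> W cs z x i"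
    define ds where "ds = drop i cs"
    have C: "C \<in> admissible M \<mu> \<sigma> W (set cs) x (cs ! i)"
      unfolding C_def by (rule thr_strategy_admissible[OF BM cs(1,2) i])
    interpret R: ratchet_control "completion M" W "filt M \<mu> \<sigma> W x" \<mu> \<sigma> q x "set cs" C V V1 V2
      by (rule admissible_ratchet_control[OF BM sigma q x S C reg])
    have ds: "ds \<noteq> []" "sorted_wrt (<) ds" "set ds \<subseteq> set cs" "hd ds = cs ! i" "last ds = last cs"
      using cs i by (auto simp: ds_def hd_drop_conv_nth last_drop dest: in_set_dropD)
    have link: "linked ds z V"
      unfolding linked_def
    proof (intro allI impI)
      fix j y assume "Suc j < length ds" "z (ds ! j) \<le> y"
      then show "V (ds ! j) y = V (ds ! Suc j) y" using V_link[of "i + j" y] i by (simp add: ds_def)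
    qed
    have Vc: "\<forall>c\<in>set ds. continuous_on UNIV (V c)" using regularD(6)[OF reg] ds(3) by blast
    have C_eq: "(\<lambda>t. C t \<omega>) = thr ds z x (\<lambda>s. \<mu> * s + \<sigma> * W s \<omega>)" for \<omega>
      by (simp add: C_def thr_strategy_def[abs_def] ds_def)
    have path: "(\<forall>t\<ge>0. C t \<omega> \<noteq> last cs \<longrightarrow> reserve x (\<lambda>s. \<mu> * s + \<sigma> * W s \<omega>) (\<lambda>t. C t \<omega>) t < z (C t \<omega>)) \<and>
        continuous_on {0..} (\<lambda>t. V (C t \<omega>) (reserve x (\<lambda>s. \<mu> * s + \<sigma> * W s \<omega>) (\<lambda>t. C t \<omega>) t)) \<and> V (C 0 \<omega>) x = V (cs ! i) x"
      if "\<omega> \<in> space M" for \<omega>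
    proof -
      interpret P: ratchet_path x "\<lambda>t. \<mu> * t + \<sigma> * W t \<omega>" "\<lambda>t. C t \<omega>" "set cs"
        by (rule R.path) (simp add: that)
      have Ct: "C t \<omega> = thr ds z x (\<lambda>s. \<mu> * s + \<sigma> * W s \<omega>) t" for t using fun_cong[OF C_eq] .
      show ?thesis
        using thr_path[OF ds(1,2) P.w_cont P.w0, of z x V] Vc link ds(4,5) unfolding reserve_def C_eq Ct by simp
    qed
    have "\<exists>K. \<forall>T. V (cs ! i) x - exp (- q * real T) * K \<le> (\<integral>\<omega>. R.PT T \<omega> \<partial>completion M)"
    proof (rule R.lower_bound)
      fix \<omega> s assume \<omega>: "\<omega> \<in> space (completion M)" and s: "0 \<le> (s::real)"
        and nn: "0 \<le> reserve x (\<lambda>t. \<mu> * t + \<sigma> * W t \<omega>) (\<lambda>t. C t \<omega>) s"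
      let ?X = "reserve x (\<lambda>t. \<mu> * t + \<sigma> * W t \<omega>) (\<lambda>t. C t \<omega>) s"
      show "\<exists>e>0. \<forall>y. ?X \<le> y \<and> y < ?X + e \<longrightarrow> R.Qf (C s \<omega>) y = 0"
      \<comment> \<open>At the top level the equation holds on the whole half-line, so the radius 1
        is arbitrary. Otherwise the surplus is strictly below the threshold, and the distance to it
        is the radius.\<close>
      proof (cases "C s \<omega> = last cs")
        case True
        then show ?thesis using top nn by (auto simp: R.Qf_def intro!: exI[of _ 1])
      next
        case False
        obtain j where j: "j < length cs" "C s \<omega> = cs ! j" using R.C_in[OF \<omega> s] by (auto simp: in_set_conv_nth)
        have "j \<noteq> length cs - 1" using j False cs(1) by (auto simp: last_conv_nth)
        then have "Suc j < length cs" using j(1) by linarith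
        moreover have "\<omega> \<in> space M" using \<omega> by simp
        from conjunct1[OF path[OF this], rule_format, OF s False] have "?X < z (cs ! j)" by (simp only: j(2))
        ultimately show ?thesis using nn harm[of j] j(2)
          by (intro exI[of _ "z (cs ! j) - ?X"]) (auto simp: R.Qf_def)
      qed
    qed (use path zero in auto)
    then show ?thesis unfolding Wz_def C_def[symmetric] Jval_completion[of M] using R.Jval_ge by blast
  qed
  ultimately show ?thesis
    by (intro exI[of _ z] exI[of _ "\<lambda>x i. ennreal (V (cs ! i) x)"]) blast
qed

theorem mainTheorem13:
  fixes M :: "'a measure" and W :: "real \<Rightarrow> 'a \<Rightarrow> real"
    and \<mu> \<sigma> q :: real and cs :: "real list"
  assumes BM: "std_brownian_motion M W"
    and mu: "\<mu> > 0" and sigma: "\<sigma> > 0" and q: "q > 0"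
    and ne: "cs \<noteq> []" and incr: "sorted_wrt (<) cs" and nonneg: "0 \<le> hd cs"
  shows "(\<exists>zs. optimal_threshold M \<mu> \<sigma> q W cs zs) \<and>
         (\<forall>zs. optimal_threshold M \<mu> \<sigma> q W cs zs \<longrightarrow>
            (\<forall>x\<ge>0. \<forall>i<length cs.
               Wz M \<mu> \<sigma> q W cs zs x i = Vval M \<mu> \<sigma> q W (set cs) x (cs ! i) \<and>
               thr_strategy \<mu> \<sigma> W cs zs x i \<in> admissible M \<mu> \<sigma> W (set cs) x (cs ! i)))"
proof -
  obtain z v where z: "threshold_fun cs z"
    and v: "\<And>x i. 0 \<le> x \<Longrightarrow> i < length cs \<Longrightarrow> Vval M \<mu> \<sigma> q W (set cs) x (cs ! i) \<le> v x i"
      "\<And>x i. 0 \<le> x \<Longrightarrow> i < length cs \<Longrightarrow> v x i \<le> Wz M \<mu> \<sigma> q W cs z x i"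
    using ex_value_attaining_threshold[OF BM sigma q ne incr nonneg] by metis
  have adm: "thr_strategy \<mu> \<sigma> W cs z' x i \<in> admissible M \<mu> \<sigma> W (set cs) x (cs ! i)" if "i < length cs" for z' x i
    by (rule thr_strategy_admissible[OF BM ne incr that])
  have le: "Wz M \<mu> \<sigma> q W cs z' x i \<le> Vval M \<mu> \<sigma> q W (set cs) x (cs ! i)" if "i < length cs" for z' x i
    unfolding Wz_def Vval_def by (rule SUP_upper[OF adm[OF that]])
  have opt: "optimal_threshold M \<mu> \<sigma> q W cs z"
    unfolding optimal_threshold_def
  proof (intro conjI z allI impI)
    fix z' :: "real \<Rightarrow> real" and x :: real and i assume xi: "0 \<le> x" "i < length cs"
    have "Wz M \<mu> \<sigma> q W cs z' x i \<le> Vval M \<mu> \<sigma> q W (set cs) x (cs ! i)" by (rule le[OF xi(2)])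
    also have "\<dots> \<le> v x i" by (rule v(1)[OF xi])
    also have "\<dots> \<le> Wz M \<mu> \<sigma> q W cs z x i" by (rule v(2)[OF xi])
    finally show "Wz M \<mu> \<sigma> q W cs z' x i \<le> Wz M \<mu> \<sigma> q W cs z x i" .
  qed
  \<comment> \<open>An optimal \<open>zs\<close> dominates the constructed \<open>z\<close>, whose
    payoff is already at least the value function; admissibility gives the other inequality.\<close>
  moreover have "Wz M \<mu> \<sigma> q W cs zs x i = Vval M \<mu> \<sigma> q W (set cs) x (cs ! i)"
    if zs: "optimal_threshold M \<mu> \<sigma> q W cs zs" and xi: "0 \<le> x" "i < length cs" for zs x i
  proof (rule antisym[OF le[OF xi(2)]])
    have "Vval M \<mu> \<sigma> q W (set cs) x (cs ! i) \<le> v x i" by (rule v(1)[OF xi])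
    also have "\<dots> \<le> Wz M \<mu> \<sigma> q W cs z x i" by (rule v(2)[OF xi])
    also have "\<dots> \<le> Wz M \<mu> \<sigma> q W cs zs x i" using zs z xi by (auto simp: optimal_threshold_def)
    finally show "Vval M \<mu> \<sigma> q W (set cs) x (cs ! i) \<le> Wz M \<mu> \<sigma> q W cs zs x i" .
  qed
  ultimately show ?thesis using adm by blast
qed

end
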